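(* Let $1\le t\le n$ be integers. The sequence $\mathcal{G}_{n-t+1}(t,n_\downarrow)$ is a universal cycle for $\mathbf{Subset}(n,t)$ using difference representatives. Using $\mathcal{O}(nt^3)$ space, this sequence can be ranked in $\mathcal{O}(n^2t^3)$ time and unranked in $\mathcal{O}(n^2t^4\log n)$ time.
   Context: $\mathbf{Subset}(n,t)$ is the set of $t$-subsets of $\{1,\ldots,n\}$. The difference representative of a subset $\{s_1<s_2<\cdots<s_t\}$ is the length-$t$ string whose first symbol is $s_1$ and whose $j$-th symbol is $s_j-s_{j-1}$ for $1<j\le t$. A universal cycle for $\mathbf{Subset}(n,t)$ using difference representatives is a cyclic sequence of length $\binom{n}{t}$ in which the difference representative of each $t$-subset occurs exactly once as a length-$t$ cyclic substring. Notation: $\mathbf{S}_k(m)$ is the set of length-$m$ strings over $\{\mathtt{1},\ldots,\mathtt{k}\}$; weight is the sum of symbols; $\mathbf{S}_k(m,v^\uparrow)$ are those of weight at least $v$. A necklace is a string lexicographically smallest among its rotations; $\mathbf{N}_k(m,v^\uparrow)=(\alpha_1,\ldots,\alpha_p)$ lists the necklaces of $\mathbf{S}_k(m,v^\uparrow)$ in lexicographic order; $\mathrm{ap}(\mathbf{s})$ is the shortest $\mathbf{u}$ with $\mathbf{s}=\mathbf{u}^j$, $j\ge1$; $\mathcal{G}_k(m,v^\uparrow)=\mathrm{ap}(\alpha_1)\cdots\mathrm{ap}(\alpha_p)$. The complement $\mathrm{comp}$ replaces each symbol $\mathtt{x}$ by $\mathtt{k}-\mathtt{x}+1$, and $\mathcal{G}_k(m,v_\downarrow)=\mathrm{comp}(\mathcal{G}_k(m,(km-v+m)^\uparrow))$.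 Ranking: given a subset, output the 1-based starting index of its difference representative in the cyclic sequence; unranking: given an index, output the subset whose representative starts there. Complexity is in the unit-cost RAM model. *)

theory Defs
  imports Complex_Main "HOL-Library.List_Lexorder" "HOL-Library.Landau_Symbols"
begin

section \<open>Subsets, difference representatives and universal cycles\<close>

definition Subset :: "nat \<Rightarrow> nat \<Rightarrow> nat set set" where
  "Subset n t = {s. s \<subseteq> {1..n} \<and> card s = t}"

text \<open>Prepending \<open>0\<close> makes the first difference equal to \<open>s\<^sub>1\<close>.\<close>

definition diff_rep :: "nat set \<Rightarrow> nat list" where
  "diff_rep s = (let xs = sorted_list_of_set s in map2 (-) xs (0 # butlast xs))"

text \<open>Positions are 0-based here. Substrings wrap around, possibly several times, since a cycle
  may be shorter than \<open>t\<close> (as for \<open>t = n\<close>, where its length is 1).\<close>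

definition cyclic_substring :: "nat list \<Rightarrow> nat \<Rightarrow> nat \<Rightarrow> nat list" where
  "cyclic_substring c i t = map (\<lambda>j. c ! ((i + j) mod length c)) [0..<t]"

definition universal_cycle :: "nat \<Rightarrow> nat \<Rightarrow> nat list \<Rightarrow> bool" where
  "universal_cycle n t c \<longleftrightarrow>
     length c = n choose t \<and>
     (\<forall>s \<in> Subset n t. \<exists>!i. i < length c \<and> cyclic_substring c i t = diff_rep s)"

section \<open>The sequences built from necklaces of bounded weight\<close>

definition strings :: "nat \<Rightarrow> nat \<Rightarrow> nat list set" where
  "strings k m = {w. length w = m \<and> set w \<subseteq> {1..k}}"

definition strings_up :: "nat \<Rightarrow> nat \<Rightarrow> nat \<Rightarrow> nat list set" where
  "strings_up k m v = {w \<in> strings k m. sum_list w \<ge> v}"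

text \<open>The order on lists is the lexicographic one of \<open>List_Lexorder\<close>.\<close>

definition necklace :: "nat list \<Rightarrow> bool" where
  "necklace w \<longleftrightarrow> (\<forall>i. w \<le> rotate i w)"

definition necklaces_up :: "nat \<Rightarrow> nat \<Rightarrow> nat \<Rightarrow> nat list list" where
  "necklaces_up k m v = sorted_list_of_set {w \<in> strings_up k m v. necklace w}"

definition ap :: "nat list \<Rightarrow> nat list" where
  "ap s = arg_min length (\<lambda>u. \<exists>j\<ge>1. s = concat (replicate j u))"

definition G_up :: "nat \<Rightarrow> nat \<Rightarrow> nat \<Rightarrow> nat list" where
  "G_up k m v = concat (map ap (necklaces_up k m v))"

definition comp :: "nat \<Rightarrow> nat list \<Rightarrow> nat list" where
  "comp k w = map (\<lambda>x. k - x + 1) w"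

text \<open>If \<open>v > k * m\<close>, the truncated subtraction still leaves the bound \<open>m\<close>, which every string
  of length \<open>m\<close> meets.\<close>

definition G_down :: "nat \<Rightarrow> nat \<Rightarrow> nat \<Rightarrow> nat list" where
  "G_down k m v = comp k (G_up k m (k * m - v + m))"

section \<open>Ranking and unranking\<close>

definition rank :: "nat \<Rightarrow> nat list \<Rightarrow> nat set \<Rightarrow> nat" where
  "rank t c s =
     (THE i. i \<in> {1..length c} \<and> cyclic_substring c (i - 1) t = diff_rep s)"

definition unrank :: "nat \<Rightarrow> nat \<Rightarrow> nat list \<Rightarrow> nat \<Rightarrow> nat set" where
  "unrank n t c i =
     (THE s. s \<in> Subset n t \<and> diff_rep s = cyclic_substring c (i - 1) t)"

section \<open>The unit-cost RAM\<close>

text \<open>The random access machine of Aho, Hopcroft and Ullman with the uniform cost criterion: a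
  fixed program, a read-only input tape, a write-only output tape, and registers holding
  arbitrary integers, register 0 being the accumulator. Each executed instruction costs one unit
  of time; each register referenced during the computation costs one unit of space. All registers
  are initially 0.\<close>

datatype operand = Const int | Reg nat | Ind nat

datatype instr =
    LOAD operand | STORE operand
  | ADD operand | SUB operand | MULT operand | DIV operand
  | READ operand | WRITE operand
  | JUMP nat | JGTZ nat | JZERO nat | HALT

record config =
  pc :: nat
  mem :: "nat \<Rightarrow> int"
  in_tape :: "int list"
  out_tape :: "int list"
  used :: "nat set"

fun address :: "(nat \<Rightarrow> int) \<Rightarrow> operand \<Rightarrow> nat option" where
  "address m (Const z) = None"
| "address m (Reg r) = Some r"
| "address m (Ind r) = (if m r \<ge> 0 then Some (nat (m r)) else None)"

fun fetch :: "(nat \<Rightarrow> int) \<Rightarrow> operand \<Rightarrow> int option" where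
  "fetch m (Const z) = Some z"
| "fetch m a = map_option m (address m a)"

fun operand_regs :: "(nat \<Rightarrow> int) \<Rightarrow> operand \<Rightarrow> nat set" where
  "operand_regs m (Const z) = {}"
| "operand_regs m (Reg r) = {r}"
| "operand_regs m (Ind r) = {r, nat (m r)}"

fun instr_regs :: "(nat \<Rightarrow> int) \<Rightarrow> instr \<Rightarrow> nat set" where
  "instr_regs m (LOAD a) = insert 0 (operand_regs m a)"
| "instr_regs m (STORE a) = insert 0 (operand_regs m a)"
| "instr_regs m (ADD a) = insert 0 (operand_regs m a)"
| "instr_regs m (SUB a) = insert 0 (operand_regs m a)"
| "instr_regs m (MULT a) = insert 0 (operand_regs m a)"
| "instr_regs m (DIV a) = insert 0 (operand_regs m a)"
| "instr_regs m (READ a) = operand_regs m a"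
| "instr_regs m (WRITE a) = operand_regs m a"
| "instr_regs m (JUMP l) = {}"
| "instr_regs m (JGTZ l) = {0}"
| "instr_regs m (JZERO l) = {0}"
| "instr_regs m HALT = {}"

definition set_reg :: "nat \<Rightarrow> int \<Rightarrow> config \<Rightarrow> config" where
  "set_reg r v c = c\<lparr>pc := pc c + 1, mem := (mem c)(r := v)\<rparr>"

definition jump_if :: "bool \<Rightarrow> nat \<Rightarrow> config \<Rightarrow> config" where
  "jump_if b l c = c\<lparr>pc := (if b then l else pc c + 1)\<rparr>"

text \<open>\<open>None\<close> means that there is no successor: the machine has reached \<open>HALT\<close>, or it is stuck
  (negative address, constant as target, division by zero, input exhausted). Leaving the program
  leaves the machine stuck as well.\<close>

fun exec :: "instr \<Rightarrow> config \<Rightarrow> config option" where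
  "exec (LOAD a) c = map_option (\<lambda>v. set_reg 0 v c) (fetch (mem c) a)"
| "exec (STORE a) c = map_option (\<lambda>r. set_reg r (mem c 0) c) (address (mem c) a)"
| "exec (ADD a) c = map_option (\<lambda>v. set_reg 0 (mem c 0 + v) c) (fetch (mem c) a)"
| "exec (SUB a) c = map_option (\<lambda>v. set_reg 0 (mem c 0 - v) c) (fetch (mem c) a)"
| "exec (MULT a) c = map_option (\<lambda>v. set_reg 0 (mem c 0 * v) c) (fetch (mem c) a)"
| "exec (DIV a) c =
     (case fetch (mem c) a of
        None \<Rightarrow> None
      | Some v \<Rightarrow> if v = 0 then None else Some (set_reg 0 (mem c 0 div v) c))"
| "exec (READ a) c =
     (case in_tape c of
        [] \<Rightarrow> None
      | x # xs \<Rightarrow> map_option (\<lambda>r. (set_reg r x c)\<lparr>in_tape := xs\<rparr>) (address (mem c) a))"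
| "exec (WRITE a) c =
     map_option (\<lambda>v. c\<lparr>pc := pc c + 1, out_tape := out_tape c @ [v]\<rparr>) (fetch (mem c) a)"
| "exec (JUMP l) c = Some (jump_if True l c)"
| "exec (JGTZ l) c = Some (jump_if (mem c 0 > 0) l c)"
| "exec (JZERO l) c = Some (jump_if (mem c 0 = 0) l c)"
| "exec HALT c = None"

definition ram_step :: "instr list \<Rightarrow> (config \<times> config) set" where
  "ram_step P = {(c, c'). pc c < length P \<and>
     (\<exists>d. exec (P ! pc c) c = Some d \<and>
          c' = d\<lparr>used := used c \<union> instr_regs (mem c) (P ! pc c)\<rparr>)}"

definition ram_init :: "int list \<Rightarrow> config" where
  "ram_init x = \<lparr>pc = 0, mem = (\<lambda>_. 0), in_tape = x, out_tape = [], used = {}\<rparr>"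

text \<open>The final \<open>HALT\<close> is counted as an executed instruction.\<close>

definition ram_computes ::
    "instr list \<Rightarrow> int list \<Rightarrow> int list \<Rightarrow> nat \<Rightarrow> nat \<Rightarrow> bool" where
  "ram_computes P x y time space \<longleftrightarrow>
     (\<exists>k c. (ram_init x, c) \<in> ram_step P ^^ k \<and>
            pc c < length P \<and> P ! pc c = HALT \<and> out_tape c = y \<and>
            k + 1 \<le> time \<and> card (used c) \<le> space)"

section \<open>Asymptotic worst-case complexity in the two parameters\<close>

text \<open>\<open>n\<close> tends to infinity, with \<open>t\<close> ranging arbitrarily over \<open>1 \<le> t \<le> n\<close>; so the constants
  in the O-bounds depend neither on \<open>n\<close> nor on \<open>t\<close>.\<close>

definition params :: "(nat \<times> nat) filter" where
  "params = inf (filtercomap fst at_top) (principal {(n, t). 1 \<le> t \<and> t \<le> n})"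

text \<open>A problem assigns to all parameters \<open>n\<close> and \<open>t\<close> a set of pairs of an input and the output
  required for it. One program must serve all parameters.\<close>

definition ram_solvable ::
    "(nat \<Rightarrow> nat \<Rightarrow> (int list \<times> int list) set) \<Rightarrow>
     (nat \<times> nat \<Rightarrow> real) \<Rightarrow> (nat \<times> nat \<Rightarrow> real) \<Rightarrow> bool" where
  "ram_solvable problem f g \<longleftrightarrow>
     (\<exists>P (T :: nat \<times> nat \<Rightarrow> nat) (S :: nat \<times> nat \<Rightarrow> nat).
        (\<forall>n t. 1 \<le> t \<longrightarrow> t \<le> n \<longrightarrow>
           (\<forall>(x, y) \<in> problem n t. ram_computes P x y (T (n, t)) (S (n, t)))) \<and>
        (\<lambda>p. real (T p)) \<in> O[params](f) \<and>
        (\<lambda>p. real (S p)) \<in> O[params](g))"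

text \<open>A subset is written on a tape as the increasing list of its elements.\<close>

definition encode_set :: "nat set \<Rightarrow> int list" where
  "encode_set s = map int (sorted_list_of_set s)"

definition ranking_problem ::
    "(nat \<Rightarrow> nat \<Rightarrow> nat list) \<Rightarrow> nat \<Rightarrow> nat \<Rightarrow> (int list \<times> int list) set" where
  "ranking_problem G n t =
     {(int n # int t # encode_set s, [int (rank t (G n t) s)]) | s. s \<in> Subset n t}"

definition unranking_problem ::
    "(nat \<Rightarrow> nat \<Rightarrow> nat list) \<Rightarrow> nat \<Rightarrow> nat \<Rightarrow> (int list \<times> int list) set" where
  "unranking_problem G n t =
     {([int n, int t, int i], encode_set (unrank n t (G n t) i)) | i. i \<in> {1..length (G n t)}}"

end

theory Submission
  imports Defs
begin

text \<open>
  After complementation the sequence lists, in decreasing order, the aperiodic prefixes of those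
  words of positive letters with length \<open>t\<close> and sum at most \<open>n\<close> that are the largest among their
  rotations. If \<open>p c 1\<^sup>r\<close> with \<open>c \<ge> 2\<close> is such a word then so is \<open>p (c - 1) 1\<^sup>r\<close>, so its successor in
  the list begins with \<open>p\<close>. Reading across the boundary of two blocks therefore yields either a
  rotation of the first word or a run of ones followed by a prefix of the second. As every word
  arises in this way and the length of the cycle is the number of words, each occurs once.

  The position of a word is thus a difference of numbers of words all of whose rotations are bounded
  by a prefix, and the prefix may be replaced by its Lyndon root, which Duval's algorithm computes.
  Words whose rotations are bounded by a Lyndon word label the closed walks of a deterministic
  automaton with one state per letter. Their weight enumerator, evaluated at one large integer
  \<open>X\<close>, takes \<open>O(t\<^sup>3 + n t)\<close> arithmetic operations, which leaves room to unrank by trying all values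
  of every letter. The programs use only loops of length \<open>n\<close> or \<open>t\<close>, so that the exponents in the
  running time are read off their syntax.
\<close>

section \<open>Necklaces and Lyndon words\<close>

text \<open>Positions are measured from the end of the cycle. A block is as long as the rotation
  class of its word, so the suffix starting with a block is as long as the number of words whose
  largest rotation does not exceed that of the block. A rank is therefore one count, corrected by
  the place inside the block or in the run of ones. The Lyndon root is needed because the automaton
  of a word without borders forgets its initial state: a run that survives as many letters as the
  word has ends where the run from state 0 ends. Hence each word labels at most one closed walk, and
  the counts may be added over all states. Bounding the weight by \<open>n\<close> through a table
  of coefficients would cost a further factor. With unit-cost arithmetic the enumerator is one
  integer, its value at \<open>X = n ^ t + 2\<close>; this exceeds the number of all words, so the
  coefficients do not overlap, and remainders modulo \<open>X ^ (n + 1)\<close> and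
  \<open>X - 1\<close> add up those of weight at most \<open>n\<close>. In unranking, a candidate
  letter below the one predicted by the period makes the prefix itself Lyndon, and the predicted
  letter is the largest possible, so no root has to be extracted during the search.\<close>

lemma append_less_same [simp]: "x @ u < x @ v \<longleftrightarrow> u < (v :: 'a :: linorder list)"
  by (induction x) auto

lemma append_le_same [simp]: "x @ u \<le> x @ v \<longleftrightarrow> u \<le> (v :: 'a :: linorder list)"
  by (induction x) auto

lemma le_append [simp]: "u \<le> u @ (v :: 'a :: linorder list)"
  by (induction u) auto

lemma take_mono_le: "u \<le> v \<Longrightarrow> take k u \<le> take k (v :: 'a :: linorder list)"
proof (induction k arbitrary: u v)
  case (Suc k)
  then show ?case by (cases u; cases v) auto
qed simp

lemma take_less_imp: "take k u < take k v \<Longrightarrow> u < (v :: 'a :: linorder list)"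
  by (meson leD leI take_mono_le)

lemma append_less_imp:
  "length u = length v \<Longrightarrow> u < v \<Longrightarrow> u @ x < v @ (y :: 'a :: linorder list)"
  by (rule take_less_imp[of "length u"]) simp

lemma replicate_one_le:
  "length w = r \<Longrightarrow> \<forall>x\<in>set w. 1 \<le> x \<Longrightarrow> replicate r (1::nat) \<le> w"
  by (induction w arbitrary: r) auto

section \<open>Lyndon prefixes, periods and Duval's algorithm\<close>

definition neck :: "nat list \<Rightarrow> bool" where
  "neck w \<longleftrightarrow> (\<forall>i. rotate i w \<le> w)"

text \<open>Since the paper's alphabet is complemented, largest rotations replace smallest ones throughout.
  A suffix is compared with a prefix of the same length because a proper border would count as
  smaller than the whole word in the list order.\<close>

definition lyndon :: "nat list \<Rightarrow> bool" where
  "lyndon z \<longleftrightarrow> z \<noteq> [] \<and> (\<forall>i. 0 < i \<longrightarrow> i < length z \<longrightarrow> drop i z < take (length z - i) z)"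

text \<open>A period need not divide the length. For \<open>p\<close> at least
  \<open>length x\<close> both sides are empty, so every word has its own length as a period; this
  is the period from which Duval's algorithm restarts.\<close>

definition periodic :: "nat \<Rightarrow> nat list \<Rightarrow> bool" where
  "periodic p x \<longleftrightarrow> drop p x = take (length x - p) x"

text \<open>For a word that is the largest of its rotations, this is the length of the longest
  Lyndon prefix of the first \<open>l\<close> letters and also a period of them. The guard
  \<open>0 < l\<close> covers the first letter, which has no predecessor; the value at 0 is a
  convention that matches the initial value in the programs.\<close>

fun duval_period :: "nat list \<Rightarrow> nat \<Rightarrow> nat" where
  "duval_period w 0 = 1"
| "duval_period w (Suc l) = (if 0 < l \<and> \<not> w ! l < w ! (l - duval_period w l) then duval_period w l else Suc l)"

lemma lynD: "lyndon z \<Longrightarrow> 0 < i \<Longrightarrow> i < length z \<Longrightarrow> drop i z < take (length z - i) z"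
  by (simp add: lyndon_def)

lemma lyndon_single [simp]: "lyndon [c]"
  by (simp add: lyndon_def)

text \<open>A suffix that starts inside the first period is decided there by the Lyndon property of
  the root; a later one is moved back by one period, which explains the strong induction.\<close>

lemma periodic_lyndon_le:
  assumes "lyndon (take p x)" "p \<le> length x" "0 < p" "periodic p x"
  shows "drop i x \<le> take (length x - i) x"
proof (induction i rule: less_induct)
  case (less i)
  consider "i = 0" | "0 < i" "i < p" | "p \<le> i" "i \<le> length x" | "length x < i" by linarith
  then show ?case
  proof cases
    case 2
    have "drop i (take p x) < take (p - i) (take p x)"
      using lynD[OF assms(1), of i] 2 assms(2) by simp
    moreover have "drop i (take p x) = take (p - i) (drop i x)" by (simp add: drop_take)
    moreover have "take (p - i) (take p x) = take (p - i) (take (length x - i) x)"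
      using 2 assms(2) by simp
    ultimately have "take (p - i) (drop i x) < take (p - i) (take (length x - i) x)" by simp
    then show ?thesis by (rule take_less_imp[THEN less_imp_le])
  next
    case 3
    have "drop i x = drop (i - p) (drop p x)" using 3 by simp
    also have "\<dots> = take (length x - i) (drop (i - p) x)"
      using assms(4) 3 unfolding periodic_def by (simp add: drop_take)
    also have "\<dots> \<le> take (length x - i) (take (length x - (i - p)) x)"
      by (rule take_mono_le, rule less) (use 3 assms in auto)
    also have "\<dots> = take (length x - i) x" by simp
    finally show ?thesis .
  qed auto
qed

lemma periodic_snoc:
  assumes "periodic p x" "0 < p" "p \<le> length x" "c = x ! (length x - p)"
  shows "periodic p (x @ [c])"
proof -
  have "drop p (x @ [c]) = take (length x - p) x @ [x ! (length x - p)]"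
    using assms(3,4) assms(1)[unfolded periodic_def] by simp
  also have "\<dots> = take (Suc (length x - p)) x"
    using assms(2,3) by (subst take_Suc_conv_app_nth) auto
  also have "\<dots> = take (length (x @ [c]) - p) (x @ [c])"
    using assms(2,3) by (simp add: Suc_diff_le)
  finally show ?thesis unfolding periodic_def .
qed

text \<open>With the predicted letter \<open>d\<close> at the end, all suffixes would be bounded by
  prefixes. Replacing \<open>d\<close> by a smaller letter lowers every proper suffix strictly, but
  leaves the prefixes it is compared with alone, since they stop before the last letter.\<close>

lemma lyndon_snoc_less:
  assumes "lyndon (take p x)" "p \<le> length x" "0 < p" "periodic p x" "c < x ! (length x - p)"
  shows "lyndon (x @ [c])"
  unfolding lyndon_def
proof (intro conjI allI impI)
  fix i assume i: "0 < i" "i < length (x @ [c])"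
  define d where "d = x ! (length x - p)"
  have per: "periodic p (x @ [d])"
    by (rule periodic_snoc[OF assms(4,3,2)]) (simp add: d_def)
  have "drop i (x @ [c]) = drop i x @ [c]" using i by simp
  also have "\<dots> < drop i x @ [d]" using assms(5) by (simp add: d_def)
  also have "\<dots> = drop i (x @ [d])" using i by simp
  also have "\<dots> \<le> take (length (x @ [d]) - i) (x @ [d])"
    by (rule periodic_lyndon_le[OF _ _ _ per]) (use assms in auto)
  also have "\<dots> = take (length (x @ [c]) - i) (x @ [c])" using i by simp
  finally show "drop i (x @ [c]) < take (length (x @ [c]) - i) (x @ [c])" .
qed simp

lemma take_rotate:
  "i + k \<le> length w \<Longrightarrow> take k (rotate i w) = take k (drop i w)"
  by (cases "i = length w") (auto simp: rotate_drop_take)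

lemma rotate_eq: "i \<le> length w \<Longrightarrow> rotate i w = drop i w @ take i w"
  by (cases "i = length w") (auto simp: rotate_drop_take)

text \<open>Rotating by \<open>p\<close> brings a copy of the beginning of \<open>w\<close> to the
  front, and the letter at \<open>l\<close> is the first place where this rotation can differ from
  \<open>w\<close>.\<close>

lemma neck_periodic_next_le:
  assumes "neck w" "periodic p (take l w)" "p \<le> l" "l < length w"
  shows "w ! l \<le> w ! (l - p)"
proof -
  have "take (l + 1 - p) (rotate p w) \<le> take (l + 1 - p) w"
    using assms(1) by (intro take_mono_le) (simp add: neck_def)
  moreover have "take (l + 1 - p) (rotate p w) = drop p (take (Suc l) w)"
    using assms by (subst take_rotate) (auto simp: take_drop Suc_diff_le)
  moreover have "drop p (take (Suc l) w) = take (l - p) w @ [w ! l]"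
    using assms by (simp add: take_Suc_conv_app_nth periodic_def)
  moreover have "take (l + 1 - p) w = take (l - p) w @ [w ! (l - p)]"
    using assms by (simp add: take_Suc_conv_app_nth Suc_diff_le)
  ultimately have "take (l - p) w @ [w ! l] \<le> take (l - p) w @ [w ! (l - p)]" by metis
  then show ?thesis unfolding append_le_same by auto
qed

text \<open>By \<open>neck_periodic_next_le\<close> the next letter never exceeds the predicted one.
  Equality continues the period (\<open>periodic_snoc\<close>), a smaller letter turns the whole
  prefix into a Lyndon word (\<open>lyndon_snoc_less\<close>).\<close>

lemma duval:
  assumes "neck w" "1 \<le> l" "l \<le> length w"
  shows "1 \<le> duval_period w l \<and> duval_period w l \<le> l \<and> lyndon (take (duval_period w l) w) \<and> periodic (duval_period w l) (take l w)"
  using assms(2,3)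
proof (induction l rule: dec_induct)
  case base
  have "duval_period w 1 = 1" by simp
  moreover have "lyndon (take 1 w)" using base by (cases w) auto
  moreover have "periodic 1 (take 1 w)" by (simp add: periodic_def)
  ultimately show ?case by simp
next
  case (step l)
  define p where "p = duval_period w l"
  define x where "x = take l w"
  have l: "l < length w" "1 \<le> l" using step by auto
  have lx: "length x = l" using l by (simp add: x_def)
  have snoc: "take (Suc l) w = x @ [w ! l]" using l by (simp add: take_Suc_conv_app_nth x_def)
  have IH: "1 \<le> p" "p \<le> l" "lyndon (take p w)" "periodic p x"
    using step.IH l unfolding p_def x_def by simp_all
  have tp: "take p w = take p x" unfolding x_def using IH(2) by (simp add: min_absorb1)
  have nth: "w ! (l - p) = x ! (length x - p)"
    using IH(1,2) l unfolding lx x_def by simp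
  have le: "w ! l \<le> w ! (l - p)"
    using neck_periodic_next_le[OF assms(1) IH(4)[unfolded x_def] IH(2) l(1)] .
  show ?case
  proof (cases "w ! l < w ! (l - p)")
    case True
    have "lyndon (x @ [w ! l])"
      by (rule lyndon_snoc_less[of p]) (use IH True in \<open>simp_all add: nth[unfolded lx] tp[symmetric] lx\<close>)
    then have "lyndon (take (Suc l) w)" unfolding snoc .
    moreover have "duval_period w (Suc l) = Suc l" using True l(2) by (simp add: p_def)
    moreover have "periodic (Suc l) (take (Suc l) w)" by (simp add: periodic_def)
    ultimately show ?thesis by simp
  next
    case False
    have "periodic p (take (Suc l) w)" unfolding snoc
      by (rule periodic_snoc) (use IH le False in \<open>simp_all add: lx nth[unfolded lx]\<close>)
    moreover have "duval_period w (Suc l) = p" using False l(2) by (simp add: p_def)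
    ultimately show ?thesis using IH(1-3) by (metis le_SucI)
  qed
qed

lemma periodic_drop_mult:
  assumes "periodic p x" "k * p \<le> length x"
  shows "drop (k * p) x = take (length x - k * p) x"
  using assms(2)
proof (induction k)
  case (Suc k)
  have "drop (Suc k * p) x = drop p (drop (k * p) x)" by (simp add: add.commute)
  also have "\<dots> = drop p (take (length x - k * p) x)" using Suc by simp
  also have "\<dots> = take (length x - Suc k * p) (drop p x)"
    by (simp add: drop_take algebra_simps)
  also have "\<dots> = take (length x - Suc k * p) x"
    using assms(1) Suc.prems by (simp add: periodic_def)
  finally show ?case .
qed simp

lemma periodic_concat_replicate:
  assumes "periodic p x" "length x = q * p"
  shows "x = concat (replicate q (take p x))"
  using assms
proof (induction q arbitrary: x)
  case (Suc q)
  let ?y = "drop p x"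
  have y: "?y = take (q * p) x" using Suc by (simp add: periodic_def)
  have "periodic p ?y"
  proof -
    have "drop p (take (q * p) x) = take (q * p - p) (drop p x)" by (simp add: drop_take)
    also have "\<dots> = take (q * p - p) x" using y by simp
    finally show ?thesis using Suc.prems(2) y by (simp add: periodic_def)
  qed
  then have "?y = concat (replicate q (take p ?y))" using Suc by simp
  moreover have "q \<noteq> 0 \<Longrightarrow> take p ?y = take p x" unfolding y by (simp add: min_def)
  ultimately have "?y = concat (replicate q (take p x))" by (cases "q = 0") auto
  then show ?case by (metis append_take_drop_id concat.simps(2) replicate_Suc)
qed simp

text \<open>A period shorter than the Lyndon prefix would give that prefix a suffix equal to its own
  beginning.\<close>

lemma lyndon_no_period:
  assumes "lyndon (take p w)" "p \<le> length w" "0 < d" "d < p" shows "\<not> periodic d w"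
proof
  assume "periodic d w"
  then have "take (p - d) (drop d w) = take (p - d) w" using assms by (simp add: periodic_def)
  then show False using lynD[OF assms(1), of d] assms by (simp add: drop_take)
qed

text \<open>If a remainder \<open>r\<close> were left, the last \<open>r\<close> letters would
  repeat the first \<open>r\<close>. Comparing \<open>w\<close> with the rotation that starts there
  cancels these letters and shows that the suffix \<open>drop r\<close> of the root is at least the
  prefix of the same length, against the Lyndon property.\<close>

lemma neck_duval_period_dvd:
  assumes "neck w" "w \<noteq> []" shows "duval_period w (length w) dvd length w"
proof (rule ccontr)
  define p where "p = duval_period w (length w)"
  assume "\<not> duval_period w (length w) dvd length w"
  then have nd: "\<not> p dvd length w" by (simp add: p_def)
  have d: "1 \<le> p" "p \<le> length w" "lyndon (take p w)" "periodic p w"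
    using duval[OF assms(1), of "length w"] assms(2) by (auto simp: Suc_le_eq p_def)
  define r where "r = length w mod p"
  define k where "k = length w div p"
  have r: "0 < r" "r < p" using nd d(1) by (auto simp: r_def mod_greater_zero_iff_not_dvd)
  have ti: "length w = k * p + r" by (simp add: k_def r_def)
  have "1 \<le> k" using d(1,2) by (simp add: k_def div_greater_zero_iff Suc_le_eq)
  then have ip: "p \<le> k * p" by simp
  have "drop (k * p) w = take r w"
    using periodic_drop_mult[OF d(4), of k] ti by simp
  then have "rotate (k * p) w = take r w @ take (k * p) w"
    using rotate_eq[of "k * p" w] ti by simp
  then have "take r w @ take (k * p) w \<le> take r w @ drop r w"
    using assms(1) unfolding neck_def by (metis append_take_drop_id)
  then have "take (k * p) w \<le> drop r w" unfolding append_le_same .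
  then have "take (p - r) (take (k * p) w) \<le> take (p - r) (drop r w)" by (rule take_mono_le)
  moreover have "take (p - r) (take (k * p) w) = take (p - r) (take p w)"
  proof -
    have "p - r \<le> k * p" "p - r \<le> p" using ip by linarith+
    then show ?thesis by (simp only: take_take min_absorb1)
  qed
  moreover have "take (p - r) (drop r w) = drop r (take p w)" by (simp only: drop_take)
  ultimately have le: "take (p - r) (take p w) \<le> drop r (take p w)" by (simp only:)
  have len: "length (take p w) = p" using d(2) by (simp only: length_take min_absorb2)
  have "drop r (take p w) < take (p - r) (take p w)"
    using lynD[OF d(3) r(1)] r(2) unfolding len by blast
  then show False using le leD by blast
qed

section \<open>Aperiodic roots\<close>

lemma ap_root:
  "w \<noteq> [] \<Longrightarrow> \<exists>j\<ge>1. w = concat (replicate j (ap w))"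
  and ap_least: "\<lbrakk>j \<ge> 1; w = concat (replicate j u)\<rbrakk> \<Longrightarrow> length (ap w) \<le> length u"
proof -
  let ?P = "\<lambda>u. \<exists>j\<ge>1. w = concat (replicate j u)"
  have P: "?P w" by (rule exI[of _ 1]) simp
  show "\<exists>j\<ge>1. w = concat (replicate j (ap w))"
    using arg_min_nat_lemma[of ?P w length, OF P] unfolding ap_def by blast
  show "\<lbrakk>j \<ge> 1; w = concat (replicate j u)\<rbrakk> \<Longrightarrow> length (ap w) \<le> length u"
    using arg_min_nat_lemma[of ?P w length, OF P] unfolding ap_def by blast
qed

lemma root_periodic:
  assumes "w = concat (replicate j u)" "j \<ge> 1"
  shows "periodic (length u) w \<and> take (length u) w = u"
proof -
  obtain k where "j = Suc k" using assms(2) by (cases j) auto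
  then have w: "w = u @ concat (replicate k u)" using assms(1) by simp
  have "concat (replicate k u) @ u = u @ concat (replicate k u)" by (induction k) auto
  then have "take (length w - length u) w = concat (replicate k u)"
    unfolding w by (metis append_eq_conv_conj diff_add_inverse length_append)
  then show ?thesis by (simp add: periodic_def w)
qed

text \<open>The Lyndon prefix is a root because its length divides that of \<open>w\<close>; a
  shorter root would be a shorter period, which \<open>lyndon_no_period\<close> excludes.\<close>

lemma ap_neck:
  assumes "neck w" "w \<noteq> []" shows "ap w = take (duval_period w (length w)) w"
proof -
  let ?t = "length w" let ?p = "duval_period w ?t"
  have d: "1 \<le> ?p" "?p \<le> ?t" "lyndon (take ?p w)" "periodic ?p w"
    using duval[OF assms(1), of ?t] assms(2) by (auto simp: Suc_le_eq)
  obtain q where q: "?t = q * ?p" using neck_duval_period_dvd[OF assms] by (metis dvd_def mult.commute)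
  then have "q \<ge> 1" using assms(2) by (cases q) auto
  then have le: "length (ap w) \<le> ?p"
    using ap_least[of q w "take ?p w"] periodic_concat_replicate[OF d(4) q] d(2) by simp
  obtain j where j: "j \<ge> 1" "w = concat (replicate j (ap w))" using ap_root[OF assms(2)] by blast
  have rp: "periodic (length (ap w)) w" "take (length (ap w)) w = ap w"
    using root_periodic[OF j(2,1)] by auto
  have "ap w \<noteq> []" using j assms(2) by (metis concat_replicate_trivial)
  then have "0 < length (ap w)" by simp
  then have "\<not> length (ap w) < ?p" using lyndon_no_period[OF d(3,2)] rp(1) by blast
  then have "length (ap w) = ?p" using le by linarith
  then show ?thesis using rp(2) by argo
qed

text \<open>This carries roots through the complement. The image of a root is a root; conversely a
  root of the image is the image of a prefix of \<open>w\<close>, and injectivity lifts the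
  repetition back.\<close>

lemma ap_map:
  assumes "inj_on f (set w)" "w \<noteq> []" shows "ap (map f w) = map f (ap w)"
proof -
  obtain j where j: "j \<ge> 1" "w = concat (replicate j (ap w))" using ap_root[OF assms(2)] by blast
  obtain k where k: "k \<ge> 1" "map f w = concat (replicate k (ap (map f w)))"
    using ap_root[of "map f w"] assms(2) by auto
  let ?b = "ap (map f w)"
  have "map f w = concat (replicate j (map f (ap w)))"
    by (subst j(2)) (simp add: map_concat)
  then have le: "length ?b \<le> length (ap w)" using ap_least[OF j(1)] by fastforce
  let ?u = "take (length ?b) w"
  have b: "?b = map f ?u" using root_periodic[OF k(2,1)] by (simp add: take_map)
  have "map f w = map f (concat (replicate k ?u))"
    using k(2) b by (simp add: map_concat)
  moreover have "set (concat (replicate k ?u)) \<subseteq> set w" using set_take_subset[of "length ?b" w] by (auto split: if_splits)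
  ultimately have "w = concat (replicate k ?u)"
    using assms(1) by (metis inj_on_map_eq_map sup.absorb1)
  then have "length (ap w) \<le> length ?u" using ap_least[OF k(1)] by blast
  then have "length (ap w) = length ?b" using le by simp
  moreover have "ap w = take (length (ap w)) w" using root_periodic[OF j(2,1)] by simp
  ultimately show ?thesis using b by simp
qed

section \<open>Counting words with bounded rotations\<close>

text \<open>The state is the length of the current match with \<open>z\<close>. A reset to 0 on a
  smaller letter, and the wrap to 0 on a complete match, are the correct transitions of a
  string-matching automaton only for Lyndon \<open>z\<close>: then no nonempty suffix of the text
  read, after such an event, is a proper prefix of \<open>z\<close>. A larger letter ends the
  run.\<close>

fun run :: "nat list \<Rightarrow> nat \<Rightarrow> nat list \<Rightarrow> nat option" where
  "run z j [] = Some j"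
| "run z j (c # w) =
     (if c < z ! j then run z 0 w
      else if c = z ! j then run z (Suc j mod length z) w else None)"

lemma run_append:
  "run z j (u @ v) = (case run z j u of None \<Rightarrow> None | Some i \<Rightarrow> run z i v)"
  by (induction u arbitrary: j) auto

lemma run_less: "run z j w = Some i \<Longrightarrow> j < length z \<Longrightarrow> i < length z"
proof (induction w arbitrary: j)
  case (Cons c w)
  have "0 < length z" using Cons.prems by linarith
  moreover from this have "Suc j mod length z < length z" by simp
  ultimately show ?case using Cons by (auto split: if_splits)
qed simp

text \<open>As long as the run survives, its first deviation from the expected rest of
  \<open>z\<close> is downwards.\<close>

lemma run_take_le:
  "run z j v \<noteq> None \<Longrightarrow> j < length z \<Longrightarrow> length z \<le> j + length v
    \<Longrightarrow> take (length z - j) v \<le> drop j z"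
proof (induction v arbitrary: j)
  case (Cons c v)
  have e: "length z - j = Suc (length z - Suc j)" using Cons.prems by linarith
  have d: "drop j z = z ! j # drop (Suc j) z" using Cons.prems by (simp add: Cons_nth_drop_Suc)
  consider "c < z ! j" | "c = z ! j" using Cons.prems by (cases "c < z ! j") (auto split: if_splits)
  then show ?case
  proof cases
    case 1
    then show ?thesis unfolding e d by simp
  next
    case 2
    show ?thesis
    proof (cases "Suc j < length z")
      case True
      have "run z (Suc j) v \<noteq> None" using Cons.prems(1) 2 True by simp
      then have "take (length z - Suc j) v \<le> drop (Suc j) z"
        using Cons.IH[of "Suc j"] Cons.prems True by simp
      then show ?thesis unfolding e d using 2 by simp
    next
      case False
      then have "length z - Suc j = 0" by simp
      then show ?thesis unfolding e d using 2 by simp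
    qed
  qed
qed simp

text \<open>In a state \<open>j > 0\<close> the coming letters are bounded by
  \<open>drop j z\<close>, which for Lyndon \<open>z\<close> is strictly below the prefix of
  \<open>z\<close> of that length; so windows are bounded wherever they start, not only at the
  beginning of a match.\<close>

lemma run_window_le:
  assumes "lyndon z" "run z j v \<noteq> None" "j < length z" "length z \<le> length v"
  shows "take (length z) v \<le> z"
proof -
  have le: "take (length z - j) v \<le> drop j z"
    using run_take_le[OF assms(2,3)] assms(4) by simp
  show ?thesis
  proof (cases "j = 0")
    case True
    then show ?thesis using le by simp
  next
    case False
    then have "take (length z - j) v < take (length z - j) z"
      using le lynD[OF assms(1), of j] assms(3) by (meson le_less_trans not_gr_zero)
    then have "take (length z - j) (take (length z) v) < take (length z - j) z" by simp
    then show ?thesis by (rule take_less_imp[THEN less_imp_le])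
  qed
qed

text \<open>A Lyndon word has no proper border, so two runs over the same word merge as soon as the
  state with the longer match is reset.\<close>

lemma run_merge:
  assumes "lyndon z"
  shows "a \<le> b \<Longrightarrow> b < length z \<Longrightarrow> take a z = drop (b - a) (take b z) \<Longrightarrow> run z b w = Some s
    \<Longrightarrow> a = b \<or> length z \<le> b + length w \<Longrightarrow> run z a w = Some s"
proof (induction w arbitrary: a b)
  case (Cons c w)
  show ?case
  proof (cases "a = b")
    case False
    then have ab: "a < b" using Cons.prems by simp
    have sa: "take (Suc a) z = take a z @ [z ! a]" and sb: "take (Suc b) z = take b z @ [z ! b]"
      using Cons.prems ab by (auto simp: take_Suc_conv_app_nth)
    have db: "drop (b - a) (take (Suc b) z) = take a z @ [z ! b]"
      unfolding sb Cons.prems(3) using Cons.prems(2) by simp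
    have ly: "drop (b - a) z < take (length z - (b - a)) z"
      using lynD[OF assms, of "b - a"] ab Cons.prems by simp
    \<comment> \<open>The first \<open>a\<close> letters of the shifted copy agree with
      \<open>z\<close>, so the Lyndon inequality is passed on to the next letters: the longer match
      never expects a larger letter than the shorter one.\<close>
    have "take (Suc a) (drop (b - a) z) \<le> take (Suc a) (take (length z - (b - a)) z)"
      using ly by (intro take_mono_le) simp
    moreover have "take (Suc a) (drop (b - a) z) = drop (b - a) (take (Suc b) z)"
      using ab by (simp add: drop_take Suc_diff_le)
    moreover have "take (Suc a) (take (length z - (b - a)) z) = take (Suc a) z"
    proof -
      have "Suc a \<le> length z - (b - a)" using ab Cons.prems(2) by linarith
      then show ?thesis by (simp add: min_absorb1)
    qed
    ultimately have "take a z @ [z ! b] \<le> take a z @ [z ! a]" unfolding db sa by simp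
    then have ba: "z ! b \<le> z ! a" unfolding append_le_same by auto
    consider "c < z ! b" | "c = z ! b" "z ! b < z ! a" | "c = z ! b" "z ! b = z ! a"
      using Cons.prems(4) ba by (cases "c < z ! b") (auto simp: le_less split: if_splits)
    then show ?thesis
    proof cases
      case 1
      then show ?thesis using Cons.prems(4) ba by simp
    next
      case 2
      \<comment> \<open>The shorter match sees a smaller letter and is reset, while the longer one
        continues. State 0 is a border of every state, so the induction hypothesis applies to
        it.\<close>
      show ?thesis
      proof (cases "Suc b < length z")
        case True
        have "run z 0 w = Some s"
          by (rule Cons.IH[of 0 "Suc b"]) (use Cons.prems 2 True ab in auto)
        then show ?thesis using 2 by simp
      next
        case False
        then have "Suc b = length z" using Cons.prems(2) by simp
        then show ?thesis using Cons.prems(4) 2 by simp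
      qed
    next
      case 3
      show ?thesis
      proof (cases "Suc b < length z")
        case True
        have "run z (Suc a) w = Some s"
        proof (rule Cons.IH[of "Suc a" "Suc b"])
          show "take (Suc a) z = drop (Suc b - Suc a) (take (Suc b) z)"
            using db sa 3 by simp
        qed (use Cons.prems 3 True ab in auto)
        then show ?thesis using 3 True ab by simp
      next
        case False
        then have m: "Suc b = length z" using Cons.prems(2) by simp
        \<comment> \<open>If both matches are extended and the longer one completes
          \<open>z\<close>, the shorter one would be a proper border of \<open>z\<close>.\<close>
        have "drop (b - a) z = take (Suc a) z" using db sa 3 m by simp
        moreover have "length z - (b - a) = Suc a" using m ab by simp
        ultimately show ?thesis using ly by simp
      qed
    qed
  qed (use Cons.prems in simp)
qed simp

text \<open>Synchronisation: 0 is a border of every state, and a word at least as long as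
  \<open>z\<close> leaves the longer match no room to stay ahead.\<close>

lemma run_from_zero:
  "lyndon z \<Longrightarrow> b < length z \<Longrightarrow> run z b w = Some s \<Longrightarrow> length z \<le> length w \<Longrightarrow> run z 0 w = Some s"
  using run_merge[of z 0 b w s] by simp

text \<open>A letter above the expected one would push the window at the start of the current match
  above \<open>z\<close>. The current match is therefore kept in front of the remaining text as
  \<open>take j z\<close>.\<close>

lemma windows_le_run:
  "(\<And>i. take (length z) (drop i (take j z @ v)) \<le> z) \<Longrightarrow> j < length z \<Longrightarrow> run z j v \<noteq> None"
proof (induction v arbitrary: j)
  case (Cons c v)
  have m: "0 < length z" using Cons.prems(2) by linarith
  have lj: "length (take j z) = j" using Cons.prems(2) by simp
  have "take (length z) (take j z @ c # v) \<le> z" using Cons.prems(1)[of 0] by simp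
  then have "take (Suc j) (take (length z) (take j z @ c # v)) \<le> take (Suc j) z" by (rule take_mono_le)
  moreover have "take (Suc j) (take (length z) (take j z @ c # v)) = take j z @ [c]"
    using Cons.prems(2) lj by (simp add: min_absorb1 Suc_le_eq)
  moreover have sj: "take (Suc j) z = take j z @ [z ! j]"
    using Cons.prems(2) by (simp add: take_Suc_conv_app_nth)
  ultimately have "take j z @ [c] \<le> take j z @ [z ! j]" by simp
  then have cz: "c \<le> z ! j" unfolding append_le_same by auto
  have v: "take (length z) (drop i v) \<le> z" for i
    using Cons.prems(1)[of "Suc j + i"] lj by simp
  have z0: "run z 0 v \<noteq> None" by (rule Cons.IH) (use v m in auto)
  have "run z (Suc j) v \<noteq> None" if "c = z ! j" "Suc j < length z"
    by (rule Cons.IH) (use Cons.prems(1) sj that in auto)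
  moreover have "Suc j < length z \<or> Suc j = length z" using Cons.prems(2) by auto
  ultimately show ?case using cz z0 by (auto simp: le_less)
qed simp

section \<open>Words with all rotations bounded by a given word\<close>

definition below :: "nat list \<Rightarrow> nat list \<Rightarrow> bool" where
  "below z w \<longleftrightarrow> (\<forall>i. take (length z) (rotate i w) \<le> z)"

text \<open>The word is read twice. The second pass starts in the state \<open>q\<close> where the
  first one ended, but by synchronisation it ends where a pass from 0 ends, namely in
  \<open>q\<close> again.\<close>

lemma below_run:
  assumes "lyndon z" "length z \<le> length w" "below z w"
  obtains q where "q < length z" "run z q w = Some q"
proof -
  let ?m = "length z" let ?t = "length w"
  have m: "0 < ?m" using assms(1) by (simp add: lyndon_def)
  have win: "take ?m (drop i (w @ w)) \<le> z" for i
  proof (cases "i < ?t")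
    case True
    then have "drop i (w @ w) = rotate i w @ drop i w"
      by (simp add: rotate_eq)
    then have "take ?m (drop i (w @ w)) = take ?m (rotate i w)" using assms(2) by simp
    then show ?thesis using assms(3) by (simp add: below_def)
  next
    case False
    then have "drop i (w @ w) = drop (i - ?t) w" by simp
    moreover have "take ?m (drop (i - ?t) w) \<le> z"
    proof (cases "i - ?t \<le> ?t")
      case True
      then have "take ?m (rotate (i - ?t) w) = take ?m (drop (i - ?t) w) @ take (?m - (?t - (i - ?t))) (take (i - ?t) w)"
        by (simp add: rotate_eq)
      then show ?thesis using assms(3) unfolding below_def by (metis le_append order_trans)
    qed simp
    ultimately show ?thesis by simp
  qed
  have "run z 0 (w @ w) \<noteq> None" by (rule windows_le_run) (use win m in auto)
  then obtain q s where q: "run z 0 w = Some q" "run z q w = Some s"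
    by (auto simp: run_append split: option.splits)
  have ql: "q < ?m" using run_less[OF q(1) m] .
  have "run z 0 w = Some s" using run_from_zero[OF assms(1) ql q(2) assms(2)] .
  then show ?thesis using that q ql by simp
qed

text \<open>A closed walk can be repeated, so every rotation of \<open>w\<close> is read from some
  state of a surviving run on \<open>w @ w\<close>, and \<open>run_window_le\<close>
  applies.\<close>

lemma run_below:
  assumes "lyndon z" "length z \<le> length w" "q < length z" "run z q w = Some q"
  shows "below z w"
  unfolding below_def
proof
  fix i
  have w: "w \<noteq> []" using assms(2,3) by auto
  define k where "k = i mod length w"
  have k: "k < length w" using w by (simp add: k_def)
  have "run z q (w @ w) = Some q" using assms(4) by (simp add: run_append)
  then have "run z q (take k w @ drop k w @ w) \<noteq> None" by (metis append_assoc append_take_drop_id option.distinct(1))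
  then obtain j where j: "run z q (take k w) = Some j" "run z j (drop k w @ w) \<noteq> None"
    unfolding run_append[of z q "take k w"] by (auto split: option.splits)
  have "take (length z) (drop k w @ w) \<le> z"
    by (rule run_window_le[OF assms(1) j(2) run_less[OF j(1) assms(3)]]) (use assms(2) in simp)
  moreover have "drop k w @ w = rotate k w @ drop k w" using k by (simp add: rotate_eq)
  then have "take (length z) (drop k w @ w) = take (length z) (rotate k w)"
    using assms(2) by simp
  moreover have "rotate i w = rotate k w" unfolding k_def by (rule rotate_conv_mod)
  ultimately show "take (length z) (rotate i w) \<le> z" by simp
qed

text \<open>The sets of closed walks at different states are disjoint: the state of a closed walk is
  the one reached from 0.\<close>

lemma sum_below:
  fixes f :: "nat list \<Rightarrow> int"
  assumes "lyndon z" "finite W" "\<And>w. w \<in> W \<Longrightarrow> length z \<le> length w"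
  shows "(\<Sum>w\<in>{w \<in> W. below z w}. f w) = (\<Sum>q<length z. \<Sum>w\<in>{w \<in> W. run z q w = Some q}. f w)"
proof -
  let ?R = "\<lambda>q. {w \<in> W. run z q w = Some q}"
  have "{w \<in> W. below z w} = (\<Union>q\<in>{..<length z}. ?R q)"
  proof (intro equalityI subsetI)
    fix w assume "w \<in> {w \<in> W. below z w}"
    then have w: "w \<in> W" "below z w" by simp_all
    obtain q where "q < length z" "run z q w = Some q"
      using below_run[OF assms(1) assms(3)[OF w(1)] w(2)] .
    then show "w \<in> (\<Union>q\<in>{..<length z}. ?R q)" using w(1) by blast
  next
    fix w assume "w \<in> (\<Union>q\<in>{..<length z}. ?R q)"
    then obtain q where "w \<in> W" "q < length z" "run z q w = Some q" by fastforce
    then show "w \<in> {w \<in> W. below z w}"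
      using run_below[OF assms(1) assms(3)] by simp
  qed
  moreover have "(\<Sum>w\<in>(\<Union>q\<in>{..<length z}. ?R q). f w) = (\<Sum>q<length z. \<Sum>w\<in>?R q. f w)"
  proof (rule sum.UNION_disjoint)
    show "\<forall>q\<in>{..<length z}. \<forall>q'\<in>{..<length z}. q \<noteq> q' \<longrightarrow> ?R q \<inter> ?R q' = {}"
    proof (intro ballI impI, rule ccontr)
      fix q q' assume q: "q \<in> {..<length z}" "q' \<in> {..<length z}" "q \<noteq> q'"
        and "?R q \<inter> ?R q' \<noteq> {}"
      then obtain w where w: "w \<in> W" "run z q w = Some q" "run z q' w = Some q'" by blast
      have "run z 0 w = Some q" "run z 0 w = Some q'"
        using run_from_zero[OF assms(1) _ w(2)] run_from_zero[OF assms(1) _ w(3)]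
          assms(3)[OF w(1)] q by simp_all
      then show False using q(3) by simp
    qed
  qed (use assms(2) in simp_all)
  ultimately show ?thesis by simp
qed

section \<open>The weight enumerator of closed walks\<close>

lemma strings_0 [simp]: "strings n 0 = {[]}"
  by (auto simp: strings_def)

lemma strings_Suc: "strings n (Suc l) = (\<lambda>(c, w). c # w) ` ({1..n} \<times> strings n l)"
  by (auto simp: strings_def length_Suc_conv image_iff)

lemma sum_strings_Suc:
  "(\<Sum>w\<in>strings n (Suc l). f w) = (\<Sum>c=1..n. \<Sum>w\<in>strings n l. f (c # w))"
  unfolding strings_Suc by (subst sum.reindex) (auto simp: inj_on_def sum.cartesian_product case_prod_unfold)

lemma finite_strings [simp]: "finite (strings n l)"
  by (induction l) (simp_all add: strings_Suc)

lemma card_strings: "card (strings n l) = n ^ l"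
  by (induction l) (simp_all add: strings_Suc card_image inj_on_def card_cartesian_product)

text \<open>The sum of \<open>X ^ sum_list w\<close> over the words \<open>w\<close> of length \<open>l\<close> that lead from \<open>j\<close> to \<open>q\<close>; the
  division is exact and yields \<open>X + \<dots> + X ^ (z ! j - 1)\<close>, the letters that reset the automaton.\<close>

fun run_gf :: "int \<Rightarrow> nat list \<Rightarrow> nat \<Rightarrow> nat \<Rightarrow> nat \<Rightarrow> int" where
  "run_gf X z q 0 j = (if j = q then 1 else 0)"
| "run_gf X z q (Suc l) j =
     ((X ^ (z ! j) - X) div (X - 1)) * run_gf X z q l 0 + X ^ (z ! j) * run_gf X z q l (Suc j mod length z)"

lemma geometric_div:
  assumes "1 \<le> a" "1 < (X :: int)"
  shows "(X ^ a - X) div (X - 1) = (\<Sum>c=1..<a. X ^ c)"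
proof -
  have "(X - 1) * (\<Sum>c=1..<a. X ^ c) = X ^ a - X"
    using assms(1) by (induction a rule: dec_induct) (simp_all add: algebra_simps)
  then show ?thesis using assms(2) by (metis nonzero_mult_div_cancel_left right_minus_eq less_irrefl)
qed

text \<open>Split off the first letter. All letters below \<open>z ! j\<close> share the
  continuation from state 0 and contribute a geometric sum, those above contribute nothing.\<close>

lemma run_gf_sum:
  assumes "set z \<subseteq> {1..n}" "1 < X" "z \<noteq> []"
  shows "j < length z \<Longrightarrow> run_gf X z q l j = (\<Sum>w\<in>strings n l. if run z j w = Some q then X ^ sum_list w else 0)"
proof (induction l arbitrary: j)
  case (Suc l)
  let ?f = "\<lambda>j w. if run z j w = Some q then X ^ sum_list w else 0"
  let ?a = "z ! j" let ?j' = "Suc j mod length z"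
  have a: "1 \<le> ?a" "?a \<le> n" using assms(1) Suc.prems nth_mem by fastforce+
  have j': "?j' < length z" using assms(3) by simp
  have step: "?f j (c # w) = (if c < ?a then X ^ c * ?f 0 w else if c = ?a then X ^ ?a * ?f ?j' w else 0)" for c w
    by (auto simp: power_add)
  have "(\<Sum>w\<in>strings n (Suc l). ?f j w) =
      (\<Sum>c=1..n. if c < ?a then X ^ c * run_gf X z q l 0 else if c = ?a then X ^ ?a * run_gf X z q l ?j' else 0)"
    unfolding sum_strings_Suc step
    by (rule sum.cong[OF refl]) (use Suc.IH[of 0] Suc.IH[OF j'] assms(3) in \<open>simp add: sum_distrib_left\<close>)
  also have "{1..n} = {1..<?a} \<union> ({?a} \<union> {?a<..n})" using a by auto
  also have "(\<Sum>c\<in>{1..<?a} \<union> ({?a} \<union> {?a<..n}).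
      if c < ?a then X ^ c * run_gf X z q l 0 else if c = ?a then X ^ ?a * run_gf X z q l ?j' else 0)
    = (\<Sum>c=1..<?a. X ^ c * run_gf X z q l 0) + X ^ ?a * run_gf X z q l ?j'"
    by (subst sum.union_disjoint) auto
  also have "\<dots> = run_gf X z q (Suc l) j"
    using geometric_div[OF a(1) assms(2)] by (simp add: sum_distrib_right)
  finally show ?case by simp
qed simp

text \<open>The coefficients of a polynomial are the digits of its value at a large \<open>X\<close>: reducing modulo \<open>X - 1\<close>
  adds them up.\<close>

lemma sum_powers_extract:
  fixes X :: int
  assumes "finite S" "int (card S) + 1 < X"
  shows "(\<Sum>w\<in>S. X ^ f w) mod X ^ Suc n mod (X - 1) = int (card {w \<in> S. f w \<le> (n::nat)})"
proof -
  let ?A = "{w \<in> S. f w \<le> n}" let ?B = "{w \<in> S. \<not> f w \<le> n}"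
  have X: "1 < X" using assms(2) by linarith
  have fin: "finite ?A" "finite ?B" using assms(1) by auto
  have cA: "int (card ?A) \<le> int (card S)" using assms(1) by (simp add: card_mono)
  have "(\<Sum>w\<in>?A \<union> ?B. X ^ f w) = (\<Sum>w\<in>?A. X ^ f w) + (\<Sum>w\<in>?B. X ^ f w)"
    by (rule sum.union_disjoint[OF fin]) blast
  moreover have "?A \<union> ?B = S" by blast
  ultimately have s: "(\<Sum>w\<in>S. X ^ f w) = (\<Sum>w\<in>?A. X ^ f w) + (\<Sum>w\<in>?B. X ^ f w)" by simp
  have "X ^ Suc n dvd X ^ f w" if "w \<in> ?B" for w
    using that by (intro le_imp_power_dvd) simp
  then have "X ^ Suc n dvd (\<Sum>w\<in>?B. X ^ f w)" by (rule dvd_sum)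
  then obtain k where k: "(\<Sum>w\<in>?B. X ^ f w) = X ^ Suc n * k" by (rule dvdE)
  have "(\<Sum>w\<in>S. X ^ f w) mod X ^ Suc n = (\<Sum>w\<in>?A. X ^ f w) mod X ^ Suc n"
    unfolding s k by (rule mod_mult_self2)
  also have "\<dots> = (\<Sum>w\<in>?A. X ^ f w)"
  \<comment> \<open>Fewer than \<open>X\<close> words have weight at most \<open>n\<close>, and each
    contributes at most \<open>X ^ n\<close>, so their total stays below the modulus.\<close>
  proof (rule mod_pos_pos_trivial)
    show "0 \<le> (\<Sum>w\<in>?A. X ^ f w)" using X by (intro sum_nonneg) simp
    have "(\<Sum>w\<in>?A. X ^ f w) \<le> (\<Sum>w\<in>?A. X ^ n)"
      by (intro sum_mono power_increasing) (use X in auto)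
    also have "\<dots> = int (card ?A) * X ^ n" by simp
    also have "\<dots> < X * X ^ n" using X cA assms(2) by (intro mult_strict_right_mono) auto
    finally show "(\<Sum>w\<in>?A. X ^ f w) < X ^ Suc n" by simp
  qed
  finally have "(\<Sum>w\<in>S. X ^ f w) mod X ^ Suc n = (\<Sum>w\<in>?A. X ^ f w)" .
  moreover have "X - 1 dvd X ^ k - 1" for k
  proof (induction k)
    case (Suc k)
    have "X ^ Suc k - 1 = X * (X ^ k - 1) + (X - 1)" by (simp add: algebra_simps)
    moreover have "X - 1 dvd X * (X ^ k - 1) + (X - 1)"
      by (rule dvd_add[OF dvd_mult[OF Suc] dvd_refl])
    ultimately show ?case by (simp only:)
  qed simp
  then have "X - 1 dvd (\<Sum>w\<in>?A. X ^ f w - 1)" by (intro dvd_sum) simp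
  then have "X - 1 dvd (\<Sum>w\<in>?A. X ^ f w) - int (card ?A)" by (simp add: sum_subtractf)
  then have "(\<Sum>w\<in>?A. X ^ f w) mod (X - 1) = int (card ?A) mod (X - 1)"
    by (simp add: mod_eq_dvd_iff)
  \<comment> \<open>Here the hypothesis is used with its summand 1: the cardinality has to be less
    than \<open>X - 1\<close>.\<close>
  moreover have "int (card ?A) mod (X - 1) = int (card ?A)"
    using cA assms(2) by (intro mod_pos_pos_trivial) auto
  ultimately show ?thesis by simp
qed

text \<open>The difference representatives, as \<open>diff_rep_bij\<close> shows. The alphabet is
  \<open>{1..n}\<close> instead of \<open>{1..n - t + 1}\<close>; positivity and the bound on the
  sum already keep the letters in the smaller range when \<open>1 <= t <= n\<close>.\<close>

definition diff_words :: "nat \<Rightarrow> nat \<Rightarrow> nat list set" where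
  "diff_words n t = {w \<in> strings n t. sum_list w \<le> n}"

definition count_below :: "nat \<Rightarrow> nat \<Rightarrow> nat list \<Rightarrow> nat" where
  "count_below n t z = card {w \<in> diff_words n t. below z w}"

text \<open>There are \<open>n ^ t\<close> strings in all; the summand 2 provides the strict
  inequality \<open>card + 1 < X\<close> required by \<open>sum_powers_extract\<close>.\<close>

lemma count_below_run_gf:
  assumes "lyndon z" "length z \<le> t" "set z \<subseteq> {1..n}" "X = int n ^ t + 2"
  shows "(\<Sum>q<length z. run_gf X z q t q) mod X ^ Suc n mod (X - 1) = int (count_below n t z)"
proof -
  let ?S = "{w \<in> strings n t. below z w}"
  have z: "z \<noteq> []" using assms(1) by (simp add: lyndon_def)
  have X: "1 < X" unfolding assms(4) by (smt (verit) of_nat_0_le_iff zero_le_power)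
  have "(\<Sum>q<length z. run_gf X z q t q) = (\<Sum>q<length z. \<Sum>w\<in>{w \<in> strings n t. run z q w = Some q}. X ^ sum_list w)"
    by (rule sum.cong[OF refl]) (simp add: run_gf_sum[OF assms(3) X z] sum.inter_filter)
  also have "\<dots> = (\<Sum>w\<in>?S. X ^ sum_list w)"
    by (rule sum_below[OF assms(1) finite_strings, symmetric]) (use assms(2) in \<open>simp add: strings_def\<close>)
  finally have eq: "(\<Sum>q<length z. run_gf X z q t q) = (\<Sum>w\<in>?S. X ^ sum_list w)" .
  have "card ?S \<le> n ^ t" using card_mono[OF finite_strings, of ?S n t] by (simp add: card_strings)
  then have "int (card ?S) \<le> int n ^ t" by (metis of_nat_le_iff of_nat_power)
  then have "int (card ?S) + 1 < X" using assms(4) by linarith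
  then have "(\<Sum>w\<in>?S. X ^ sum_list w) mod X ^ Suc n mod (X - 1) = int (card {w \<in> ?S. sum_list w \<le> n})"
    by (intro sum_powers_extract) simp_all
  moreover have "{w \<in> ?S. sum_list w \<le> n} = {w \<in> diff_words n t. below z w}" by (auto simp: diff_words_def)
  ultimately show ?thesis using eq by (simp add: count_below_def)
qed

section \<open>The necklace cycle\<close>

lemma rotate_in_diff_words: "w \<in> diff_words n t \<Longrightarrow> rotate i w \<in> diff_words n t"
proof -
  have "sum_list (rotate i w) = sum_list (drop (i mod length w) w) + sum_list (take (i mod length w) w)"
    by (simp add: rotate_drop_take)
  also have "\<dots> = sum_list (take (i mod length w) w @ drop (i mod length w) w)" by (simp only: sum_list_append add.commute)
  finally show "w \<in> diff_words n t \<Longrightarrow> rotate i w \<in> diff_words n t" by (simp add: diff_words_def strings_def)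
qed

lemma diff_words_length: "w \<in> diff_words n t \<Longrightarrow> length w = t"
  by (simp add: diff_words_def strings_def)

lemma diff_words_ge: "w \<in> diff_words n t \<Longrightarrow> x \<in> set w \<Longrightarrow> 1 \<le> x"
  by (auto simp: diff_words_def strings_def)

lemma finite_diff_words [simp]: "finite (diff_words n t)"
  by (simp add: diff_words_def)

text \<open>Rotating by \<open>i\<close> and then by \<open>i * (length w - 1)\<close> makes
  \<open>i\<close> full turns, so rotation is invertible.\<close>

lemma rotate_reach: "w \<noteq> [] \<Longrightarrow> \<exists>k'. rotate k w = rotate k' (rotate i w)"
proof (rule exI[of _ "k + i * (length w - 1)"])
  assume "w \<noteq> []"
  then obtain m where "length w = Suc m" by (cases w) auto
  then have "k + i * (length w - 1) + i = k + i * length w" by simp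
  then have "rotate (k + i * (length w - 1)) (rotate i w) = rotate (k + i * length w) w"
    by (simp only: rotate_rotate)
  also have "\<dots> = rotate k w" by (metis mod_mult_self1 rotate_conv_mod)
  finally show "rotate k w = rotate (k + i * (length w - 1)) (rotate i w)" by simp
qed

section \<open>Largest rotations and rotation classes\<close>

definition max_rotation :: "nat list \<Rightarrow> nat list" where
  "max_rotation w = Max ((\<lambda>i. rotate i w) ` {..<length w})"

lemma max_rotation_rotation:
  assumes "w \<noteq> []" obtains i where "i < length w" "max_rotation w = rotate i w"
proof -
  have "max_rotation w \<in> (\<lambda>i. rotate i w) ` {..<length w}"
    unfolding max_rotation_def using assms by (intro Max_in) auto
  then show ?thesis using that by auto
qed

lemma rotate_le_max_rotation: "w \<noteq> [] \<Longrightarrow> rotate i w \<le> max_rotation w"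
  unfolding max_rotation_def by (subst rotate_conv_mod) (auto intro!: Max_ge)

lemma neck_max_rotation: "w \<noteq> [] \<Longrightarrow> neck (max_rotation w)"
  unfolding neck_def by (metis max_rotation_rotation rotate_le_max_rotation rotate_rotate)

lemma max_rotation_neck: "neck w \<Longrightarrow> w \<noteq> [] \<Longrightarrow> max_rotation w = w"
  using rotate_le_max_rotation[of w 0] max_rotation_rotation[of w] unfolding neck_def by (metis antisym id_apply rotate0)

lemma max_rotation_rotate:
  assumes "w \<noteq> []" shows "max_rotation (rotate i w) = max_rotation w"
proof (rule antisym)
  have "rotate i w \<noteq> []" using assms by simp
  then obtain j where "max_rotation (rotate i w) = rotate j (rotate i w)" by (rule max_rotation_rotation)
  then show "max_rotation (rotate i w) \<le> max_rotation w" using rotate_le_max_rotation[OF assms] by (simp add: rotate_rotate)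
  obtain k where "max_rotation w = rotate k w" using assms by (rule max_rotation_rotation)
  then show "max_rotation w \<le> max_rotation (rotate i w)"
    using rotate_reach[OF assms, of k i] rotate_le_max_rotation[of "rotate i w"] assms by auto
qed

lemma max_rotation_in_diff_words: "w \<in> diff_words n t \<Longrightarrow> w \<noteq> [] \<Longrightarrow> max_rotation w \<in> diff_words n t"
  by (metis max_rotation_rotation rotate_in_diff_words)

text \<open>Truncation is monotone, so the largest rotation decides. This links the automaton counts
  with the order of the necklaces.\<close>

lemma below_max_rotation: "w \<noteq> [] \<Longrightarrow> below z w \<longleftrightarrow> take (length z) (max_rotation w) \<le> z"
  unfolding below_def by (metis max_rotation_rotation order_trans rotate_le_max_rotation take_mono_le)

text \<open>This is what allows a prefix to be replaced by its root. If the first \<open>p\<close>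
  letters of a rotation are smaller than those of \<open>x\<close>, the comparison is over. If they
  agree, they are moved to the end by a further rotation and, \<open>x\<close> being periodic, the
  remaining comparison is again one with a prefix of \<open>x\<close>; hence the induction over its
  length for all rotations at once.\<close>

lemma below_periodic:
  assumes "periodic p x" "0 < p" "p \<le> length x" "length x \<le> length w"
  shows "below x w \<longleftrightarrow> below (take p x) w"
proof
  assume x: "below x w"
  show "below (take p x) w" unfolding below_def
  proof
    fix i
    have "take p (take (length x) (rotate i w)) \<le> take p x"
      using x unfolding below_def by (intro take_mono_le) simp
    then show "take (length (take p x)) (rotate i w) \<le> take p x"
      using assms(3) by (simp add: min_absorb1)
  qed
next
  assume b: "below (take p x) w"
  have bp: "take p (rotate i w) \<le> take p x" for i
    using b assms(3) unfolding below_def by (simp add: min_absorb2)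
  have "k \<le> length x \<Longrightarrow> take k (rotate i w) \<le> take k x" for k i
  proof (induction k arbitrary: i rule: less_induct)
    case (less k)
    show ?case
    proof (cases "k \<le> p")
      case True
      have "take k (take p (rotate i w)) \<le> take k (take p x)" by (rule take_mono_le[OF bp])
      then show ?thesis using True by (simp add: min_absorb1)
    next
      case False
      have w0: "w \<noteq> []" using assms by auto
      let ?u = "rotate i w"
      have split: "take k v = take p v @ take (k - p) (drop p v)" for v :: "nat list"
        using False by (metis le_add_diff_inverse nat_le_linear take_add)
      have dx: "take (k - p) (drop p x) = take (k - p) x"
      proof -
        have "k - p \<le> length x - p" using less.prems by simp
        then show ?thesis using assms(1) unfolding periodic_def by (simp add: min_absorb1)
      qed
      have "p + (k - p) \<le> length ?u" using less.prems False assms(4) by simp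
      then have "take (k - p) (drop p ?u) = take (k - p) (rotate p ?u)" by (simp only: take_rotate)
      also have "\<dots> = take (k - p) (rotate (p + i) w)" by (simp add: rotate_rotate)
      also have "\<dots> \<le> take (k - p) x" by (rule less.IH) (use False less.prems assms(2) in auto)
      finally have le: "take (k - p) (drop p ?u) \<le> take (k - p) x" .
      have len: "length (take p ?u) = length (take p x)" using assms by simp
      show ?thesis
      proof (cases "take p ?u = take p x")
        case True
        then show ?thesis unfolding split[of ?u] split[of x] dx using le by simp
      next
        case False
        then have "take p ?u < take p x" using bp[of i] by simp
        then show ?thesis unfolding split[of ?u] split[of x]
          by (intro less_imp_le append_less_imp[OF len])
      qed
    qed
  qed
  then show "below x w" unfolding below_def by (metis order_refl take_all_iff)
qed

lemma ap_facts:
  assumes "neck w" "w \<noteq> []"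
  shows "ap w = take (duval_period w (length w)) w" "length (ap w) = duval_period w (length w)"
    "1 \<le> length (ap w)" "length (ap w) \<le> length w" "lyndon (ap w)" "periodic (length (ap w)) w"
    "take (length (ap w)) w = ap w"
proof -
  have d: "1 \<le> duval_period w (length w)" "duval_period w (length w) \<le> length w" "lyndon (take (duval_period w (length w)) w)"
    "periodic (duval_period w (length w)) w"
    using duval[OF assms(1), of "length w"] assms(2) by (auto simp: Suc_le_eq)
  show a: "ap w = take (duval_period w (length w)) w" by (rule ap_neck[OF assms])
  show l: "length (ap w) = duval_period w (length w)" unfolding a using d by simp
  show "1 \<le> length (ap w)" "length (ap w) \<le> length w" "lyndon (ap w)" "periodic (length (ap w)) w"
    unfolding l using d a by simp_all
  show "take (length (ap w)) w = ap w" unfolding l by (rule a[symmetric])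
qed

lemma ap_split:
  assumes "w \<noteq> []"
  obtains x where "w = ap w @ x" "w = x @ ap w" "x = [] \<or> set x = set (ap w)" "set (ap w) = set w"
proof -
  obtain j where j: "j \<ge> 1" "w = concat (replicate j (ap w))" using ap_root[OF assms] by blast
  define a where "a = ap w"
  define x where "x = concat (replicate (j - 1) a)"
  obtain k where k: "j = Suc k" using j(1) by (cases j) auto
  have c: "concat (replicate k a) @ a = a @ concat (replicate k a)" for k by (induction k) auto
  have w1: "w = a @ x" using j(2) k unfolding a_def[symmetric] x_def by simp
  have w2: "w = x @ a" using w1 c[of k] k unfolding x_def by simp
  have "x = [] \<or> set x = set a" unfolding x_def by (cases "j - 1 = 0") auto
  moreover from this have "set a = set w" using w1 by auto
  ultimately show ?thesis using that w1 w2 unfolding a_def by blast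
qed

lemma rotate_ap_mult: "w \<noteq> [] \<Longrightarrow> rotate (k * length (ap w)) w = w"
proof (induction k)
  case (Suc k)
  obtain x where x: "w = ap w @ x" "w = x @ ap w" using ap_split[OF Suc.prems] by metis
  have "rotate (length (ap w)) w = w"
    using rotate_append[of "ap w" x] x by metis
  then show ?case using Suc by (simp add: rotate_rotate[symmetric])
qed simp

lemma neck_rotate_neq:
  assumes "neck w" "w \<noteq> []" "0 < d" "d < length (ap w)"
  shows "rotate d w \<noteq> w"
proof
  assume eq: "rotate d w = w"
  have d: "d \<le> length w" using ap_facts(4)[OF assms(1,2)] assms(4) by simp
  have "drop d w = take (length w - d) (rotate d w)" using d by (simp add: rotate_eq)
  then have "periodic d w" unfolding periodic_def eq .
  then show False
    using lyndon_no_period[of "length (ap w)" w d] ap_facts[OF assms(1,2)] assms(3,4) by simp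
qed

text \<open>The rotations by less than the length of the root are distinct and exhaust the class. So
  the block that a necklace contributes to the cycle has one position for each word of its
  class.\<close>

lemma card_class:
  assumes "neck a" "a \<noteq> []" "a \<in> diff_words n t"
  shows "card {w \<in> diff_words n t. max_rotation w = a} = length (ap a)"
proof -
  let ?q = "length (ap a)"
  have q: "1 \<le> ?q" by (rule ap_facts(3)[OF assms(1,2)])
  have red: "rotate i a = rotate (i mod ?q) a" for i
  proof -
    have "rotate i a = rotate (i mod ?q) (rotate (i div ?q * ?q) a)" by (simp add: rotate_rotate)
    then show ?thesis using rotate_ap_mult[OF assms(2)] by simp
  qed
  have "{w \<in> diff_words n t. max_rotation w = a} = (\<lambda>i. rotate i a) ` {..<?q}"
  proof (intro equalityI subsetI)
    fix w assume w: "w \<in> {w \<in> diff_words n t. max_rotation w = a}"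
    then have "w \<in> diff_words n t" by simp
    then have "length w = length a" using diff_words_length diff_words_length[OF assms(3)] by simp
    then have w0: "w \<noteq> []" using assms(2) by auto
    then obtain i where i: "a = rotate i w" using w max_rotation_rotation[OF w0] by auto
    then obtain k where "w = rotate k a" using rotate_reach[OF w0, of 0 i] by auto
    then have "w = rotate (k mod ?q) a" using red by simp
    moreover have "k mod ?q < ?q" by (rule mod_less_divisor) (use q in linarith)
    ultimately show "w \<in> (\<lambda>i. rotate i a) ` {..<?q}" by blast
  next
    fix w assume "w \<in> (\<lambda>i. rotate i a) ` {..<?q}"
    then show "w \<in> {w \<in> diff_words n t. max_rotation w = a}"
      using rotate_in_diff_words[OF assms(3)] max_rotation_rotate[OF assms(2)] max_rotation_neck[OF assms(1,2)] by auto
  qed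
  moreover have "inj_on (\<lambda>i. rotate i a) {..<?q}"
  proof (rule linorder_inj_onI)
    fix i j assume ij: "i < j" "i \<in> {..<?q}" "j \<in> {..<?q}"
    have il: "i \<le> length a" using ij ap_facts(4)[OF assms(1,2)] by simp
    show "rotate i a \<noteq> rotate j a"
    proof
      assume eq: "rotate i a = rotate j a"
      have "a = rotate (length a - i) (rotate i a)" using il by (simp add: rotate_rotate)
      also have "\<dots> = rotate (length a - i + j) a" unfolding eq by (simp add: rotate_rotate)
      also have "length a - i + j = length a + (j - i)" using ij il by simp
      also have "rotate \<dots> a = rotate (j - i) a" by (metis mod_add_self1 rotate_conv_mod)
      finally have "rotate (j - i) a = a" by simp
      moreover have "0 < j - i" "j - i < ?q" using ij by auto
      ultimately show False using neck_rotate_neq[OF assms(1,2)] by blast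
    qed
  qed auto
  ultimately show ?thesis by (simp add: card_image)
qed

lemma neck_hd:
  assumes "neck w" "c \<in> set w" shows "c \<le> hd w"
proof -
  obtain u v where w: "w = u @ c # v" using assms(2) by (meson split_list)
  have "rotate (length u) w = (c # v) @ u" unfolding w by (rule rotate_append)
  moreover have "rotate (length u) w \<le> w" using assms(1) by (simp add: neck_def)
  ultimately show ?thesis unfolding w by (cases u) auto
qed

lemma rotate_replicate: "rotate k (replicate r c) = replicate r c"
proof -
  have "replicate (length (rotate k (replicate r c))) c = rotate k (replicate r c)"
    by (rule replicate_length_same) auto
  then show ?thesis by simp
qed

text \<open>A rotation that starts in \<open>p\<close> or at the lowered letter, but not at the
  front, reaches that letter while the prefix it is compared with is still inside \<open>p\<close>,
  so it only gets smaller. A rotation that starts in \<open>zs\<close> begins with 1, whereas the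
  word begins with a larger letter; the sole exception, \<open>p = []\<close> and
  \<open>c = 2\<close>, gives the word of ones.\<close>

lemma neck_decrement:
  assumes "neck (p @ c # zs)" "2 \<le> c" "\<forall>z\<in>set zs. z = 1"
  shows "neck (p @ (c - 1) # zs)"
  unfolding neck_def
proof
  fix i
  let ?a = "p @ c # zs" and ?b = "p @ (c - 1) # zs"
  define k where "k = i mod length ?b"
  have k: "k < length ?b" unfolding k_def by (rule mod_less_divisor) simp
  have "rotate k ?b \<le> ?b"
  proof -
    consider "k = 0" | "0 < k" "k \<le> length p" | "length p < k" by linarith
    then show ?thesis
    proof cases
      case 2
      let ?m = "Suc (length p - k)"
      have "take ?m (rotate k ?b) = drop k p @ [c - 1]" using 2 by (simp add: rotate_eq)
      also have "\<dots> < drop k p @ [c]" using assms(2) by simp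
      also have "\<dots> = take ?m (rotate k ?a)" using 2 by (simp add: rotate_eq)
      also have "\<dots> \<le> take ?m ?a" using assms(1) by (intro take_mono_le) (simp add: neck_def)
      also have "\<dots> = take ?m ?b" using 2 by simp
      finally show ?thesis by (rule take_less_imp[THEN less_imp_le])
    next
      case 3
      obtain j where j: "k = Suc (length p + j)" using 3 less_iff_Suc_add by auto
      have "j < length zs" using k j by simp
      then have "drop k ?b = 1 # drop (Suc j) zs"
        using j assms(3) by (simp add: Cons_nth_drop_Suc[symmetric])
      then have r: "rotate k ?b = 1 # drop (Suc j) zs @ take k ?b" using k by (simp only: rotate_eq less_imp_le append_Cons)
      show ?thesis
      proof (cases p)
        case Nil
        show ?thesis
        proof (cases "c = 2")
          case True
          then have "?b = replicate (Suc (length zs)) 1"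
            using Nil assms(3) by (simp add: replicate_length_same)
          then show ?thesis by (metis order_refl rotate_replicate)
        next
          case False
          then have "1 < c - 1" using assms(2) by linarith
          then show ?thesis unfolding r using Nil by simp
        qed
      next
        case (Cons x p')
        have "c \<le> x" using neck_hd[OF assms(1), of c] Cons by simp
        then show ?thesis unfolding r using Cons assms(2) by simp
      qed
    qed simp
  qed
  then show "rotate i ?b \<le> ?b" unfolding k_def using rotate_conv_mod[of i ?b] by simp
qed

text \<open>The root is a suffix of \<open>w\<close> with the same letters as \<open>w\<close>. If
  it were shorter than the run of ones at the end, \<open>w\<close> would consist of ones.\<close>

lemma ap_trailing_ones:
  assumes "w \<noteq> []" "w = x @ replicate b 1" "\<exists>c\<in>set w. c \<noteq> (1::nat)"
  obtains a where "ap w = a @ replicate b 1"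
proof -
  obtain y where y: "w = y @ ap w" "set (ap w) = set w" using ap_split[OF assms(1)] by metis
  have "x @ replicate b 1 = y @ ap w" using y(1) assms(2) by simp
  then obtain us where "x = y @ us \<and> us @ replicate b 1 = ap w \<or> x @ us = y \<and> replicate b 1 = us @ ap w"
    unfolding append_eq_append_conv2 by blast
  then show ?thesis
  proof
    assume "x @ us = y \<and> replicate b 1 = us @ ap w"
    then have "set (ap w) \<subseteq> set (replicate b 1)" by (metis Un_upper2 set_append)
    then have "set w \<subseteq> {1}" using y(2) by (auto split: if_splits)
    then show ?thesis using assms(3) by blast
  qed (use that in metis)
qed

definition necklace_list :: "nat \<Rightarrow> nat \<Rightarrow> nat list list" where
  "necklace_list n t = rev (sorted_list_of_set {w \<in> diff_words n t. neck w})"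

definition necklace_cycle :: "nat \<Rightarrow> nat \<Rightarrow> nat list" where
  "necklace_cycle n t = concat (map ap (necklace_list n t))"

section \<open>Reading words off the cycle\<close>

lemma cyclic_substring_inner:
  "length w = t \<Longrightarrow> cyclic_substring (u @ w @ v) (length u) t = w"
  unfolding cyclic_substring_def by (rule nth_equalityI) (auto simp: nth_append)

lemma cyclic_substring_wrap:
  assumes "c = u @ v" "c = w @ r" "length v + length w = t" "c \<noteq> []"
  shows "cyclic_substring c (length u) t = v @ w"
  unfolding cyclic_substring_def
proof (rule nth_equalityI)
  fix j assume "j < length (map (\<lambda>j. c ! ((length u + j) mod length c)) [0..<t])"
  then have j: "j < t" by simp
  have "c ! ((length u + j) mod length c) = (v @ w) ! j"
  proof (cases "j < length v")
    case True
    then have "(length u + j) mod length c = length u + j" using assms(1) by simp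
    then show ?thesis using True assms(1) by (simp add: nth_append)
  next
    case False
    have l: "length u + j = length c + (j - length v)" using False assms(1) by simp
    have "j - length v < length w" using j False assms(3) by simp
    moreover from this have "j - length v < length c" using assms(2) by simp
    ultimately have "(length u + j) mod length c = j - length v" "c ! (j - length v) = w ! (j - length v)"
      unfolding l using assms(2) by (simp_all add: nth_append)
    then show ?thesis using False by (simp add: nth_append)
  qed
  then show "map (\<lambda>j. c ! ((length u + j) mod length c)) [0..<t] ! j = (v @ w) ! j" using j by simp
qed (use assms(3) in simp)


locale params_ok =
  fixes n t :: nat
  assumes t1: "1 \<le> t" and tn: "t \<le> n"
begin

abbreviation "L \<equiv> necklace_list n t"
abbreviation "C \<equiv> necklace_cycle n t"
abbreviation "ones \<equiv> replicate t (1::nat)"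

text \<open>Suffixes of the cycle are used because their lengths are the numbers that the counts
  deliver; see \<open>length_tl_from\<close>.\<close>

definition tl_from :: "nat \<Rightarrow> nat list" where
  "tl_from i = concat (map ap (drop i L))"

lemma finite_necks: "finite {w \<in> diff_words n t. neck w}"
  by simp

lemma set_L: "set L = {w \<in> diff_words n t. neck w}"
  unfolding necklace_list_def by (simp only: set_rev set_sorted_list_of_set[OF finite_necks])

lemma sorted_L: "sorted_wrt (>) L"
  unfolding necklace_list_def by (simp add: sorted_wrt_rev)

lemma distinct_L: "distinct L"
  unfolding necklace_list_def by simp

lemma L_less: "i < j \<Longrightarrow> j < length L \<Longrightarrow> L ! j < L ! i"
  using sorted_L by (simp add: sorted_wrt_iff_nth_less)

lemma L_le: "i \<le> j \<Longrightarrow> j < length L \<Longrightarrow> L ! j \<le> L ! i"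
  using L_less by (cases "i = j") (auto intro: less_imp_le)

lemma L_nth:
  assumes "i < length L"
  shows "L ! i \<in> diff_words n t" "neck (L ! i)" "L ! i \<noteq> []" "length (L ! i) = t"
proof -
  have "L ! i \<in> set L" using assms by simp
  then show "L ! i \<in> diff_words n t" "neck (L ! i)" unfolding set_L by auto
  then show "length (L ! i) = t" by (simp add: diff_words_length)
  then show "L ! i \<noteq> []" using t1 by auto
qed

lemma ones_le: "w \<in> diff_words n t \<Longrightarrow> ones \<le> w"
  using replicate_one_le[of w t] diff_words_length diff_words_ge by blast

lemma ones_in_L: "ones \<in> set L"
proof -
  have "ones \<in> diff_words n t" using t1 tn by (auto simp: diff_words_def strings_def sum_list_replicate)
  moreover have "neck ones" by (simp add: neck_def rotate_replicate)
  ultimately show ?thesis unfolding set_L by simp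
qed

lemma L_nonempty: "0 < length L"
  using ones_in_L by (cases L) auto

lemma L_last: "L ! (length L - 1) = ones"
proof -
  obtain i where i: "i < length L" "L ! i = ones" using ones_in_L by (metis in_set_conv_nth)
  have "L ! (length L - 1) \<le> ones" using L_le[of i "length L - 1"] i by auto
  moreover have "ones \<le> L ! (length L - 1)" using ones_le[OF L_nth(1)] L_nonempty by simp
  ultimately show ?thesis by simp
qed

lemma not_ones_iff: "length w = t \<Longrightarrow> w \<noteq> ones \<longleftrightarrow> (\<exists>c\<in>set w. c \<noteq> 1)"
  by (metis in_set_replicate replicate_length_same)

lemma L_not_ones:
  assumes "Suc i < length L" shows "\<exists>c\<in>set (L ! i). c \<noteq> 1"
proof -
  have "i < length L - 1" "length L - 1 < length L" "i < length L" using assms by auto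
  then show ?thesis
    using L_less[of i "length L - 1"] L_last not_ones_iff[OF L_nth(4)[of i]] by auto
qed

lemma L_index_not_last:
  assumes "i < length L" "\<exists>c\<in>set (L ! i). c \<noteq> 1" shows "Suc i < length L"
proof (rule ccontr)
  assume "\<not> Suc i < length L"
  then have "i = length L - 1" using assms(1) by simp
  then show False using L_last assms(2) by auto
qed

lemma neck_hd_not_one:
  assumes "neck w" "\<exists>c\<in>set w. c \<noteq> (1::nat)" "\<forall>c\<in>set w. 1 \<le> c" shows "1 < hd w"
proof -
  obtain c where c: "c \<in> set w" "c \<noteq> 1" using assms(2) by blast
  then have "1 < c" using assms(3) by (simp add: le_neq_implies_less)
  then show ?thesis using neck_hd[OF assms(1) c(1)] by simp
qed

text \<open>Lowering the last letter of \<open>y\<close> different from 1 gives a smaller necklace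
  that still begins with \<open>x\<close>. The successor lies between this one and
  \<open>L ! i\<close>, so it begins with \<open>x\<close> too.\<close>

lemma succ_prefix:
  assumes "Suc i < length L" "L ! i = x @ y" "\<exists>c\<in>set y. c \<noteq> 1"
  shows "take (length x) (L ! Suc i) = x"
proof -
  obtain y1 c zs where y: "y = y1 @ c # zs" "c \<noteq> 1" "\<forall>z\<in>set zs. z = 1"
    using split_list_last_prop[OF assms(3)] by blast
  let ?p = "x @ y1"
  have a: "L ! i = ?p @ c # zs" using assms(2) y(1) by simp
  have Li: "L ! i \<in> diff_words n t" "neck (L ! i)" using L_nth assms(1) by simp_all
  have c1: "1 \<le> c" using diff_words_ge[OF Li(1), of c] a by simp
  then have c2: "2 \<le> c" using y(2) by simp
  let ?b = "?p @ (c - 1) # zs"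
  have nb: "neck ?b" by (rule neck_decrement[OF Li(2)[unfolded a] c2 y(3)])
  have "?b \<in> diff_words n t" using Li(1) c2 unfolding a diff_words_def strings_def by auto
  then have "?b \<in> set L" using nb unfolding set_L by simp
  then obtain j where j: "j < length L" "L ! j = ?b" by (metis in_set_conv_nth)
  have "L ! j < L ! i" unfolding j(2) a using c2 by simp
  then have "i < j" using L_le[of j i] assms(1) j(1) by (meson Suc_lessD leD not_le_imp_less)
  then have ge: "?b \<le> L ! Suc i" using L_le[of "Suc i" j] j by simp
  have le: "L ! Suc i \<le> L ! i" by (rule L_le) (use assms(1) in simp_all)
  have "take (length x) ?b \<le> take (length x) (L ! Suc i)" by (rule take_mono_le[OF ge])
  moreover have "take (length x) (L ! Suc i) \<le> take (length x) (L ! i)" by (rule take_mono_le[OF le])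
  ultimately show ?thesis unfolding a by simp
qed

lemma tl_from_Suc: "i < length L \<Longrightarrow> tl_from i = ap (L ! i) @ tl_from (Suc i)"
  unfolding tl_from_def by (simp add: Cons_nth_drop_Suc[symmetric])

lemma tl_from_0: "tl_from 0 = C"
  by (simp add: tl_from_def necklace_cycle_def)

lemma C_split: obtains u where "C = u @ tl_from i" "length u = length C - length (tl_from i)"
proof -
  have "C = concat (map ap (take i L)) @ tl_from i"
    unfolding necklace_cycle_def tl_from_def by (metis append_take_drop_id concat_append map_append)
  then show ?thesis using that by (metis add_diff_cancel_right' length_append)
qed

lemma length_tl_from_le: "length (tl_from i) \<le> length C"
  using C_split[of i] by (metis le_add2 length_append)

text \<open>The block contributes the root of \<open>L ! i\<close>, and by
  \<open>succ_prefix\<close> the next word begins with the rest \<open>x\<close>, so the induction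
  continues from the end of the list. The last block is excluded, being a single letter. If it comes
  next, \<open>x\<close> is a prefix of the word of ones; a nonempty \<open>x\<close> has all
  letters of the root, so it is empty.\<close>

lemma tl_from_prefix: "Suc i < length L \<Longrightarrow> \<exists>r. tl_from i = L ! i @ r"
proof (induction "length L - i" arbitrary: i rule: less_induct)
  case less
  have i: "i < length L" using less.prems by simp
  obtain x where x: "L ! i = ap (L ! i) @ x" "L ! i = x @ ap (L ! i)" "x = [] \<or> set x = set (ap (L ! i))"
    "set (ap (L ! i)) = set (L ! i)" using ap_split[OF L_nth(3)[OF i]] by metis
  have t: "tl_from i = ap (L ! i) @ tl_from (Suc i)" by (rule tl_from_Suc[OF i])
  have non: "\<exists>c\<in>set (ap (L ! i)). c \<noteq> 1" using L_not_ones[OF less.prems] x(4) by simp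
  have sp: "take (length x) (L ! Suc i) = x" by (rule succ_prefix[OF less.prems x(2) non])
  show ?case
  proof (cases "Suc (Suc i) < length L")
    case True
    moreover have "length L - Suc i < length L - i" using i by simp
    ultimately obtain r where "tl_from (Suc i) = L ! Suc i @ r" using less.hyps[of "Suc i"] by auto
    then have "tl_from i = ap (L ! i) @ x @ drop (length x) (L ! Suc i) @ r"
      unfolding t using sp by (metis append_assoc append_take_drop_id)
    then show ?thesis by (metis append_assoc x(1))
  next
    case False
    then have "Suc i = length L - 1" using less.prems by simp
    then have "take (length x) ones = x" using sp L_last by simp
    then have "\<forall>c\<in>set x. c = 1" by (metis in_set_replicate in_set_takeD)
    then have "x = []" using x(3) non by blast
    then show ?thesis using t x(1) by simp
  qed
qed

text \<open>While the unread part of the root contains a letter above 1, that letter can be lowered,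
  so the successor begins with everything in front of it: the repetitions \<open>x\<close> and the
  part \<open>take k\<close> of the root already passed. Reading on therefore completes a
  rotation.\<close>

lemma read_rotation:
  assumes "Suc i < length L" "\<exists>c\<in>set (drop k (ap (L ! i))). c \<noteq> 1"
  shows "cyclic_substring C (length C - length (tl_from i) + k) t = rotate k (L ! i)"
proof -
  let ?a = "ap (L ! i)"
  have i: "i < length L" using assms(1) by simp
  have kl: "k < length ?a" using assms(2) by (cases "k < length ?a") auto
  obtain x where x: "L ! i = ?a @ x" "L ! i = x @ ?a" using ap_split[OF L_nth(3)[OF i]] by metis
  let ?y = "drop k ?a" let ?z = "x @ take k ?a"
  have a: "?a = take k ?a @ ?y" by simp
  have Lz: "L ! i = ?z @ ?y" using x(2) by simp
  have sp: "take (length ?z) (L ! Suc i) = ?z" by (rule succ_prefix[OF assms(1) Lz assms(2)])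
  have "\<exists>r. tl_from (Suc i) = ?z @ r"
  proof (cases "Suc (Suc i) < length L")
    case True
    then obtain r where "tl_from (Suc i) = L ! Suc i @ r" using tl_from_prefix by blast
    then show ?thesis using sp by (metis append_assoc append_take_drop_id)
  next
    case False
    then have "Suc i = length L - 1" using assms(1) by simp
    then have "take (length ?z) ones = ?z" using sp L_last by simp
    then have z1: "\<forall>c\<in>set ?z. c = 1" by (metis in_set_replicate in_set_takeD)
    \<comment> \<open>A nonempty \<open>?z\<close> would be a prefix of \<open>L ! i\<close> made of
      ones, but a necklace other than the word of ones starts with a larger letter.\<close>
    have "1 < hd (L ! i)"
      by (rule neck_hd_not_one[OF L_nth(2)[OF i] L_not_ones[OF assms(1)]]) (use diff_words_ge L_nth(1)[OF i] in blast)
    have "?z = []"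
    proof (rule ccontr)
      assume nz: "?z \<noteq> []"
      have "hd ?z = 1" by (rule bspec[OF z1 hd_in_set[OF nz]])
      moreover have "hd (L ! i) = hd (?z @ ?y)" by (rule arg_cong[OF Lz])
      moreover have "hd (?z @ ?y) = hd ?z" by (rule hd_append2[OF nz])
      ultimately show False using \<open>1 < hd (L ! i)\<close> by linarith
    qed
    then show ?thesis by (intro exI[of _ "tl_from (Suc i)"]) (simp only: append_Nil)
  qed
  then obtain r where r: "tl_from (Suc i) = ?z @ r" by blast
  obtain u where u: "C = u @ tl_from i" "length u = length C - length (tl_from i)" by (rule C_split)
  have "tl_from i = take k ?a @ (?y @ ?z) @ r"
    unfolding tl_from_Suc[OF i] r using a by (metis append_assoc)
  then have c: "C = (u @ take k ?a) @ (?y @ ?z) @ r" using u(1) by simp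
  have len: "length (?y @ ?z) = t" using Lz L_nth(4)[OF i] by (metis length_append add.commute)
  have lu: "length (u @ take k ?a) = length C - length (tl_from i) + k" using u(2) kl by simp
  have "cyclic_substring C (length (u @ take k ?a)) t = ?y @ ?z"
    by (subst c) (rule cyclic_substring_inner[OF len])
  moreover have "rotate k (L ! i) = ?y @ ?z"
  proof -
    have "k \<le> length (L ! i)" using kl x(1) by (metis le_add1 length_append less_imp_le order_trans)
    then have "rotate k (L ! i) = drop k (L ! i) @ take k (L ! i)" by (rule rotate_eq)
    also have "drop k (L ! i) = ?y @ x" using kl by (subst x(1)) simp
    also have "take k (L ! i) = take k ?a" using kl by (subst x(1)) simp
    finally show ?thesis by simp
  qed
  ultimately show ?thesis using lu by simp
qed

text \<open>This serves the other case, where the rest of the root consists of ones and the reading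
  runs into the next word.\<close>

lemma read_next:
  assumes "Suc (Suc i) < length L" "k \<le> length (ap (L ! i))"
  shows "cyclic_substring C (length C - length (tl_from i) + k) t =
    drop k (ap (L ! i)) @ take (t - (length (ap (L ! i)) - k)) (L ! Suc i)"
proof -
  let ?a = "ap (L ! i)" let ?y = "drop k ?a" let ?m = "t - (length ?a - k)"
  have i: "i < length L" using assms(1) by simp
  have al: "length ?a \<le> t" using ap_facts(4)[OF L_nth(2,3)[OF i]] L_nth(4)[OF i] by simp
  obtain r where r: "tl_from (Suc i) = L ! Suc i @ r" using tl_from_prefix[OF assms(1)] by blast
  obtain u where u: "C = u @ tl_from i" "length u = length C - length (tl_from i)" by (rule C_split)
  have "tl_from i = take k ?a @ ?y @ take ?m (L ! Suc i) @ drop ?m (L ! Suc i) @ r"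
    unfolding tl_from_Suc[OF i] r by (metis append_assoc append_take_drop_id)
  then have c: "C = (u @ take k ?a) @ (?y @ take ?m (L ! Suc i)) @ (drop ?m (L ! Suc i) @ r)" using u(1) by simp
  have len: "length (?y @ take ?m (L ! Suc i)) = t"
    using al L_nth(4)[OF Suc_lessD[OF assms(1)]] assms(2) by simp
  have lu: "length (u @ take k ?a) = length C - length (tl_from i) + k" using u(2) assms(2) by simp
  have "cyclic_substring C (length (u @ take k ?a)) t = ?y @ take ?m (L ! Suc i)"
    by (subst c) (rule cyclic_substring_inner[OF len])
  then show ?thesis unfolding lu .
qed

lemma ap_ones: "ap ones = [1]"
proof -
  have "ones \<noteq> []" using t1 by auto
  have "concat (replicate t [1]) = ones" by (induction t) auto
  then have "length (ap ones) \<le> length [1::nat]" using ap_least[of t ones "[1]"] t1 by simp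
  moreover have "neck ones" using ones_in_L set_L by simp
  then have "1 \<le> length (ap ones)" "ap ones = take (length (ap ones)) ones"
    using ap_facts[of ones] \<open>ones \<noteq> []\<close> by simp_all
  ultimately have "length (ap ones) = 1" by simp
  then have "ap ones = take 1 ones" using \<open>ap ones = take (length (ap ones)) ones\<close> by metis
  then show ?thesis using t1 by (cases t) auto
qed

lemma tl_from_last: "tl_from (length L - 1) = [1]"
proof -
  have "tl_from (length L) = []" by (simp add: tl_from_def)
  then show ?thesis using tl_from_Suc[of "length L - 1"] L_nonempty L_last ap_ones by simp
qed

text \<open>The last word but one must be \<open>c\<close> followed by ones: by
  \<open>succ_prefix\<close> the letters before its last letter above 1 form a prefix of the word of
  ones, while its first letter is above 1. Its root ends in \<open>t - 1\<close> ones, and the final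
  block adds one more.\<close>

lemma C_ends_ones:
  assumes "2 \<le> length L" obtains g where "C = g @ ones"
proof -
  define i where "i = length L - 2"
  have i: "Suc i < length L" "Suc i = length L - 1" "i < length L" using assms by (auto simp: i_def)
  obtain x c zs where a: "L ! i = x @ c # zs" "c \<noteq> 1" "\<forall>z\<in>set zs. z = 1"
    using split_list_last_prop[OF L_not_ones[OF i(1)]] by blast
  have "take (length x) (L ! Suc i) = x" by (rule succ_prefix[OF i(1) a(1)]) (use a(2) in simp)
  then have "take (length x) ones = x" using i(2) L_last by simp
  then have x1: "\<forall>c\<in>set x. c = 1" by (metis in_set_replicate in_set_takeD)
  have "1 < hd (L ! i)"
    by (rule neck_hd_not_one[OF L_nth(2)[OF i(3)] L_not_ones[OF i(1)]]) (use diff_words_ge L_nth(1)[OF i(3)] in blast)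
  then have "x = []" using x1 a(1) by (cases x) auto
  then have "L ! i = [c] @ zs" "length zs = t - 1" using a(1) L_nth(4)[OF i(3)] by auto
  then have "L ! i = [c] @ replicate (t - 1) 1" using a(3) replicate_length_same[of zs 1] by simp
  then obtain a where a: "ap (L ! i) = a @ replicate (t - 1) 1"
    using ap_trailing_ones[OF L_nth(3)[OF i(3)] _ L_not_ones[OF i(1)]] by blast
  have "replicate (t - 1) 1 @ [1] = ones" using t1 by (metis Suc_diff_1 Suc_le_eq One_nat_def replicate_Suc replicate_append_same)
  then have "tl_from i = a @ ones"
    using tl_from_Suc[OF i(3)] tl_from_last a unfolding i(2) by simp
  moreover obtain u where "C = u @ tl_from i" using C_split by metis
  ultimately show ?thesis using that by (metis append_assoc)
qed

lemma length_C_ge: "2 \<le> length L \<Longrightarrow> t \<le> length C"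
  by (erule C_ends_ones) simp

lemma read_wrap:
  assumes "2 \<le> length L" "b \<le> t"
  shows "cyclic_substring C (length C - b) t = replicate b 1 @ take (t - b) (L ! 0)"
proof -
  obtain g where g: "C = g @ ones" using C_ends_ones[OF assms(1)] .
  have ob: "ones = replicate (t - b) 1 @ replicate b 1" using assms(2) by (simp add: replicate_add[symmetric])
  have c1: "C = (g @ replicate (t - b) 1) @ replicate b 1" using g ob by simp
  obtain r where "tl_from 0 = L ! 0 @ r" using tl_from_prefix[of 0] assms(1) by auto
  then have c2: "C = take (t - b) (L ! 0) @ drop (t - b) (L ! 0) @ r"
    unfolding tl_from_0 by (metis append_assoc append_take_drop_id)
  have l0: "length (L ! 0) = t" by (rule L_nth(4)[OF L_nonempty])
  have "cyclic_substring C (length (g @ replicate (t - b) 1)) t = replicate b 1 @ take (t - b) (L ! 0)"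
    by (rule cyclic_substring_wrap[OF c1 c2]) (use l0 assms(2) g t1 in auto)
  moreover have "length (g @ replicate (t - b) 1) = length C - b" using g assms(2) by simp
  ultimately show ?thesis by simp
qed

text \<open>The blocks from \<open>k\<close> on are those of the classes satisfying
  \<open>P\<close>, and each is as long as its class (\<open>card_class\<close>). Keeping
  \<open>P\<close> general serves the bounds \<open><=\<close> and \<open><\<close> as well as
  prefix bounds.\<close>

lemma length_tl_from:
  assumes "k \<le> length L" "\<And>j. j < k \<Longrightarrow> \<not> P (L ! j)" "\<And>j. k \<le> j \<Longrightarrow> j < length L \<Longrightarrow> P (L ! j)"
  shows "length (tl_from k) = card {w \<in> diff_words n t. P (max_rotation w)}"
proof -
  have sd: "set (drop k L) = {a \<in> set L. P a}"
  proof (intro equalityI subsetI)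
    fix a assume "a \<in> set (drop k L)"
    then obtain j where j: "j < length (drop k L)" "a = drop k L ! j" by (metis in_set_conv_nth)
    then have "k + j < length L" "a = L ! (k + j)" by auto
    then show "a \<in> {a \<in> set L. P a}" using assms(3)[of "k + j"] by simp
  next
    fix a assume "a \<in> {a \<in> set L. P a}"
    then obtain j where j: "j < length L" "L ! j = a" "P a" by (metis (mono_tags) in_set_conv_nth mem_Collect_eq)
    then have "k \<le> j" using assms(2) by (meson not_le_imp_less)
    then have "a = drop k L ! (j - k)" "j - k < length (drop k L)" using j by auto
    then show "a \<in> set (drop k L)" by (metis nth_mem)
  qed
  have w0: "w \<noteq> []" if "w \<in> diff_words n t" for w using diff_words_length[OF that] t1 by auto
  have "{w \<in> diff_words n t. P (max_rotation w)} = (\<Union>a\<in>set (drop k L). {w \<in> diff_words n t. max_rotation w = a})"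
  proof (intro equalityI subsetI)
    fix w assume "w \<in> {w \<in> diff_words n t. P (max_rotation w)}"
    then have w: "w \<in> diff_words n t" "P (max_rotation w)" by simp_all
    have "max_rotation w \<in> set (drop k L)"
      unfolding sd set_L using max_rotation_in_diff_words[OF w(1) w0[OF w(1)]] neck_max_rotation[OF w0[OF w(1)]] w(2) by simp
    then show "w \<in> (\<Union>a\<in>set (drop k L). {w \<in> diff_words n t. max_rotation w = a})" using w(1) by blast
  next
    fix w assume "w \<in> (\<Union>a\<in>set (drop k L). {w \<in> diff_words n t. max_rotation w = a})"
    then have "w \<in> diff_words n t" "max_rotation w \<in> set (drop k L)" by blast+
    then show "w \<in> {w \<in> diff_words n t. P (max_rotation w)}" unfolding sd by simp
  qed
  also have "card \<dots> = (\<Sum>a\<in>set (drop k L). card {w \<in> diff_words n t. max_rotation w = a})"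
    by (rule card_UN_disjoint) auto
  also have "\<dots> = (\<Sum>a\<in>set (drop k L). length (ap a))"
  proof (rule sum.cong[OF refl])
    fix a assume "a \<in> set (drop k L)"
    then have a: "a \<in> diff_words n t" "neck a" unfolding sd set_L by auto
    show "card {w \<in> diff_words n t. max_rotation w = a} = length (ap a)"
      by (rule card_class[OF a(2) w0[OF a(1)] a(1)])
  qed
  also have "\<dots> = length (tl_from k)"
    unfolding tl_from_def length_concat
    using sum_list_distinct_conv_sum_set[OF distinct_drop[OF distinct_L], of "\<lambda>a. length (ap a)" k]
    by (simp add: o_def)
  finally show ?thesis by simp
qed

lemma length_C: "length C = card (diff_words n t)"
  using length_tl_from[of 0 "\<lambda>_. True"] tl_from_0 by simp

lemma length_tl_from_le_card:
  assumes "i < length L" shows "length (tl_from i) = card {w \<in> diff_words n t. max_rotation w \<le> L ! i}"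
  by (rule length_tl_from) (use assms L_less L_le in \<open>auto simp: not_le\<close>)

lemma length_tl_from_less_card:
  assumes "i < length L" shows "length (tl_from (Suc i)) = card {w \<in> diff_words n t. max_rotation w < L ! i}"
  by (rule length_tl_from) (use assms L_less L_le in \<open>auto simp: not_less less_Suc_eq_le\<close>)

end

section \<open>Ranks and blocks\<close>

lemma sum_list_ge:
  "\<forall>c\<in>set w. (1::nat) \<le> c \<Longrightarrow> x \<in> set w \<Longrightarrow> x + (length w - 1) \<le> sum_list w"
proof (induction w)
  case (Cons a w)
  have "length w \<le> sum_list w" using Cons.prems(1) by (induction w) auto
  then show ?case using Cons by (cases "x = a") (fastforce, cases w, auto)
qed simp

lemma sum_list_eq_length:
  assumes "\<forall>c\<in>set w. (1::nat) \<le> c"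
  shows "sum_list w = length w \<longleftrightarrow> w = replicate (length w) 1"
proof
  assume eq: "sum_list w = length w"
  have "x = 1" if "x \<in> set w" for x
  proof -
    have "0 < length w" using that by (cases w) auto
    then show ?thesis using sum_list_ge[OF assms that] eq assms that by fastforce
  qed
  then show "w = replicate (length w) 1" by (metis replicate_length_same)
next
  assume "w = replicate (length w) 1"
  then have "sum_list w = sum_list (replicate (length w) (1::nat))" by (rule arg_cong)
  then show "sum_list w = length w" by (simp add: sum_list_replicate)
qed

lemma int_diff_mod: "1 \<le> r \<Longrightarrow> r \<le> c \<Longrightarrow> int (c - r) = (int c - int r) mod int c"
  by (subst mod_pos_pos_trivial) (simp_all add: of_nat_diff)

text \<open>The position \<open>K\<close> places before the end of the cycle lies in the block of \<open>a\<close>.\<close>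

definition is_block :: "nat \<Rightarrow> nat \<Rightarrow> nat \<Rightarrow> nat list \<Rightarrow> bool" where
  "is_block n t K a \<longleftrightarrow> a \<in> diff_words n t \<and> neck a \<and>
     card {w \<in> diff_words n t. max_rotation w < a} < K \<and> K \<le> card {w \<in> diff_words n t. max_rotation w \<le> a}"

text \<open>The occurrence of the all-ones word starts \<open>t - 1\<close> places before the last block, whence the
  exceptional value of \<open>k\<close>.\<close>

definition rank_pos :: "nat \<Rightarrow> nat \<Rightarrow> nat list \<Rightarrow> int" where
  "rank_pos n t s =
     (let k = (if sum_list s = t then t - 1 else LEAST k. rotate k s = max_rotation s);
          b = (\<forall>j<k. s ! j = 1);
          q = duval_period (max_rotation s) (if b then t - k else t)
      in (int (card (diff_words n t)) - int (count_below n t (take q (max_rotation s))) - int k + (if b then 0 else int q))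
           mod int (card (diff_words n t)))"

context params_ok
begin

lemma diff_words_nonempty: "w \<in> diff_words n t \<Longrightarrow> w \<noteq> []"
  using diff_words_length t1 by fastforce

lemma length_max_rotation: "w \<in> diff_words n t \<Longrightarrow> length (max_rotation w) = t"
  using max_rotation_in_diff_words diff_words_nonempty diff_words_length by blast

lemma index_of: "a \<in> diff_words n t \<Longrightarrow> neck a \<Longrightarrow> \<exists>i<length L. L ! i = a"
  using set_L by (metis (mono_tags, lifting) in_set_conv_nth mem_Collect_eq)

text \<open>The program counts for the root \<open>take q x\<close>, but the answer is the count for
  the whole prefix \<open>x\<close>.\<close>

lemma count_below_prefix:
  assumes "periodic q x" "0 < q" "q \<le> length x" "length x \<le> t"
  shows "count_below n t (take q x) = card {w \<in> diff_words n t. take (length x) (max_rotation w) \<le> x}"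
proof -
  have "below (take q x) w \<longleftrightarrow> take (length x) (max_rotation w) \<le> x" if "w \<in> diff_words n t" for w
    using below_periodic[OF assms(1-3), of w] below_max_rotation[OF diff_words_nonempty[OF that], of x] assms(4) diff_words_length[OF that]
    by simp
  then show ?thesis unfolding count_below_def by (metis (mono_tags, lifting))
qed

lemma count_below_ap:
  assumes "i < length L" shows "count_below n t (ap (L ! i)) = length (tl_from i)"
proof -
  note f = ap_facts[OF L_nth(2,3)[OF assms]]
  have l: "length (L ! i) = t" by (rule L_nth(4)[OF assms])
  have "count_below n t (take (length (ap (L ! i))) (L ! i)) =
      card {w \<in> diff_words n t. take (length (L ! i)) (max_rotation w) \<le> L ! i}"
    by (rule count_below_prefix) (use f l in auto)
  also have "{w \<in> diff_words n t. take (length (L ! i)) (max_rotation w) \<le> L ! i} = {w \<in> diff_words n t. max_rotation w \<le> L ! i}"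
    using length_max_rotation l by auto
  finally show ?thesis using length_tl_from_le_card[OF assms] f(7) by simp
qed

lemma ap_duval_period: "i < length L \<Longrightarrow> take (duval_period (L ! i) t) (L ! i) = ap (L ! i) \<and> duval_period (L ! i) t = length (ap (L ! i))"
  using ap_facts[OF L_nth(2,3)] L_nth(4) by simp

text \<open>The part of \<open>s\<close> before its largest rotation contains a letter above 1, so
  \<open>s\<close> is read by \<open>read_rotation\<close> from inside the block of its own
  necklace, \<open>k\<close> places before the end of that block.\<close>

lemma rank_inside:
  assumes "s \<in> diff_words n t" "k < t" "rotate k s = max_rotation s" "\<And>j. j < k \<Longrightarrow> rotate j s \<noteq> max_rotation s"
    and "\<exists>c\<in>set (take k s). c \<noteq> 1"
  defines "q \<equiv> duval_period (max_rotation s) t"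
  defines "r \<equiv> count_below n t (take q (max_rotation s))"
  shows "k < q" "q \<le> r" "r \<le> length C" "cyclic_substring C (length C - r + (q - k)) t = s"
proof -
  have s0: "s \<noteq> []" and ls: "length s = t" using assms(1) diff_words_nonempty diff_words_length by auto
  obtain i where i: "i < length L" "L ! i = max_rotation s"
    using index_of[OF max_rotation_in_diff_words[OF assms(1) s0] neck_max_rotation[OF s0]] by blast
  have q: "take q (max_rotation s) = ap (L ! i)" "q = length (ap (L ! i))"
    using ap_duval_period[OF i(1)] unfolding q_def i(2)[symmetric] by auto
  have r: "r = length (tl_from i)" unfolding r_def q(1) by (rule count_below_ap[OF i(1)])
  have tl: "tl_from i = ap (L ! i) @ tl_from (Suc i)" by (rule tl_from_Suc[OF i(1)])
  show qr: "q \<le> r" unfolding r tl q(2) by simp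
  show rC: "r \<le> length C" unfolding r by (rule length_tl_from_le)
  have rq: "rotate q (max_rotation s) = max_rotation s" using rotate_ap_mult[OF L_nth(3)[OF i(1)], of 1] unfolding q(2) i(2) by simp
  obtain m where m: "s = rotate m (max_rotation s)" using rotate_reach[OF s0, of 0 k] assms(3) by auto
  have rqs: "rotate q s = s"
    by (subst (2) m, subst m) (simp add: rotate_rotate add.commute[of q], simp add: rotate_rotate[symmetric] rq)
  \<comment> \<open>Rotation by \<open>q\<close> fixes \<open>s\<close>, so a larger
    \<open>k\<close> could be lowered by \<open>q\<close>, against its minimality.\<close>
  show kq: "k < q"
  proof (rule ccontr)
    assume "\<not> k < q"
    then have "k = (k - q) + q" by simp
    then have "rotate (k - q) (rotate q s) = rotate k s" by (simp add: rotate_rotate)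
    then have "rotate (k - q) s = max_rotation s" unfolding rqs assms(3) .
    moreover have "k - q < k" using \<open>\<not> k < q\<close> q(2) ap_facts(3)[OF L_nth(2,3)[OF i(1)]] by simp
    ultimately show False using assms(4) by blast
  qed
  have lm: "length (L ! i) = t" by (rule L_nth(4)[OF i(1)])
  obtain x where x: "L ! i = x @ ap (L ! i)" using ap_split[OF L_nth(3)[OF i(1)]] by metis
  have Li: "L ! i = drop k s @ take k s" unfolding i(2) assms(3)[symmetric] using assms(2) ls by (simp add: rotate_eq)
  have "drop (q - k) (ap (L ! i)) = drop (length x + (q - k)) (x @ ap (L ! i))" by simp
  also have "length x + (q - k) = t - k" using arg_cong[OF x, of length] lm kq q(2) by simp
  also have "drop (t - k) (x @ ap (L ! i)) = drop (t - k) (L ! i)" using x by simp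
  also have "\<dots> = take k s" unfolding Li using ls by simp
  finally have y: "drop (q - k) (ap (L ! i)) = take k s" .
  have "\<exists>c\<in>set (L ! i). c \<noteq> 1" using assms(5) unfolding Li by auto
  then have si: "Suc i < length L" by (rule L_index_not_last[OF i(1)])
  have "cyclic_substring C (length C - length (tl_from i) + (q - k)) t = rotate (q - k) (L ! i)"
    by (rule read_rotation[OF si]) (use assms(5) y in simp)
  moreover have "rotate (q - k) (L ! i) = s"
  proof -
    \<comment> \<open>Since \<open>q\<close> divides \<open>t\<close> and fixes the necklace under
      rotation, turning back by \<open>k\<close> is the same as turning forward by
      \<open>q - k\<close>.\<close>
    have "q dvd t" using neck_duval_period_dvd[OF L_nth(2,3)[OF i(1)]] lm unfolding q_def i(2) by simp
    then obtain c where c: "t = q * c" by (rule dvdE)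
    obtain d where d: "c = Suc d" using c t1 by (cases c) auto
    have "t = (q - k + k) + d * q" using c d kq by (simp add: mult.commute)
    then have e: "t = q - k + (c - 1) * q + k" using d by simp
    have "s = rotate t s" using ls by simp
    also have "\<dots> = rotate (q - k) (rotate ((c - 1) * q) (rotate k s))"
      by (subst e) (simp only: rotate_rotate add.assoc)
    also have "rotate k s = L ! i" using assms(3) i(2) by simp
    also have "rotate ((c - 1) * q) (L ! i) = L ! i" unfolding q(2) by (rule rotate_ap_mult[OF L_nth(3)[OF i(1)]])
    finally show ?thesis by simp
  qed
  ultimately show "cyclic_substring C (length C - r + (q - k)) t = s" unfolding r by simp
qed

text \<open>Here \<open>s\<close> is a run of \<open>k\<close> ones followed by \<open>x\<close>,
  and it ends with the beginning of a block: the first block in the list whose word has a prefix at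
  most \<open>x\<close>. The previous block, or the end of the cycle, supplies the ones.\<close>

lemma rank_border:
  assumes "s \<in> diff_words n t" "s \<noteq> ones" "k < t" "rotate k s = max_rotation s" "\<forall>c\<in>set (take k s). c = 1"
  defines "q \<equiv> duval_period (max_rotation s) (t - k)"
  defines "r \<equiv> count_below n t (take q (max_rotation s))"
  shows "\<exists>p. p < length C \<and> cyclic_substring C p t = s \<and>
    int p = (int (length C) - int r - int k) mod int (length C)"
proof -
  have s0: "s \<noteq> []" and ls: "length s = t" using assms(1) diff_words_nonempty diff_words_length by auto
  define x where "x = drop k s"
  have tk: "take k s = replicate k 1" using assms(3,5) ls
    by (metis length_take min.absorb4 replicate_length_same)
  have sx: "s = replicate k 1 @ x" unfolding x_def tk[symmetric] by simp
  have mxs: "max_rotation s = x @ replicate k 1" using assms(3,4) ls unfolding x_def tk[symmetric]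
    by (simp add: rotate_eq)
  have lx: "length x = t - k" "1 \<le> length x" using assms(3) ls by (auto simp: x_def)
  have nm: "neck (max_rotation s)" by (rule neck_max_rotation[OF s0])
  have lms: "length (max_rotation s) = t" by (rule length_max_rotation[OF assms(1)])
  have tx: "take (t - k) (max_rotation s) = x" using lx by (simp add: mxs)
  have du: "1 \<le> q" "q \<le> t - k" "periodic q x"
    using duval[OF nm, of "t - k"] lx assms(3) lms unfolding q_def tx by auto
  have "take q (max_rotation s) = take q x" using du lx by (simp add: mxs)
  then have r: "r = card {w \<in> diff_words n t. take (length x) (max_rotation w) \<le> x}"
    unfolding r_def using count_below_prefix[OF du(3)] du lx by simp
  let ?P = "\<lambda>a. take (length x) a \<le> x"
  define i where "i = length (takeWhile (\<lambda>a. \<not> ?P a) L)"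
  obtain m where m: "m < length L" "L ! m = max_rotation s"
    using index_of[OF max_rotation_in_diff_words[OF assms(1) s0] nm] by blast
  have Pm: "?P (L ! m)" unfolding m(2) mxs by simp
  have il: "i < length L"
  proof (rule ccontr)
    assume "\<not> i < length L"
    then have "takeWhile (\<lambda>a. \<not> ?P a) L = L"
      unfolding i_def by (metis length_takeWhile_le linorder_not_less nat_less_le takeWhile_eq_take take_all_iff)
    then have "\<forall>a\<in>set L. \<not> ?P a" by (simp only: takeWhile_eq_all_conv)
    then show False using Pm m(1) by simp
  qed
  have nP: "\<not> ?P (L ! j)" if "j < i" for j
    using that unfolding i_def by (metis nth_mem set_takeWhileD takeWhile_nth)
  have Pi: "?P (L ! i)" using nth_length_takeWhile[of "\<lambda>a. \<not> ?P a" L] il unfolding i_def by simp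
  have Pj: "?P (L ! j)" if "i \<le> j" "j < length L" for j
    using take_mono_le[OF L_le[OF that]] Pi by (rule order_trans)
  have ri: "r = length (tl_from i)" unfolding r
    by (rule length_tl_from[symmetric]) (use il nP Pj in auto)
  have "i \<le> m" using nP Pm by (meson not_le_imp_less)
  then have "L ! m \<le> L ! i" by (rule L_le[OF _ m(1)])
  then have "take (length x) (L ! m) \<le> take (length x) (L ! i)" by (rule take_mono_le)
  \<comment> \<open>The necklace of \<open>s\<close> begins with \<open>x\<close> and comes no
    earlier than block \<open>i\<close>, which gives the other inequality for the prefix of
    \<open>L ! i\<close>.\<close>
  then have Lix: "take (length x) (L ! i) = x" using Pi unfolding m(2) mxs by simp
  have "\<exists>c\<in>set s. c \<noteq> 1" using assms(2) not_ones_iff[OF ls] by blast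
  then have xn: "\<exists>c\<in>set x. c \<noteq> 1" unfolding sx by auto
  then have "\<exists>c\<in>set (L ! i). c \<noteq> 1" using Lix by (metis in_set_takeD)
  then have si: "Suc i < length L" by (rule L_index_not_last[OF il])
  have L2: "2 \<le> length L" using si by simp
  have C0: "0 < length C" using length_C_ge[OF L2] t1 by linarith
  consider "k = 0" | "0 < k" "i = 0" | "0 < k" "0 < i" by blast
  then show ?thesis
  proof cases
    case 1
    then have sxx: "s = x" "length x = t" using sx ls by auto
    then have Lis: "L ! i = s" using Lix L_nth(4)[OF il] by simp
    obtain y where "set (ap (L ! i)) = set (L ! i)" using ap_split[OF L_nth(3)[OF il]] by metis
    then have "cyclic_substring C (length C - length (tl_from i) + 0) t = rotate 0 (L ! i)"
      by (intro read_rotation[OF si]) (use xn sxx Lis in simp)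
    then have c: "cyclic_substring C (length C - r) t = s" unfolding ri Lis by simp
    have "1 \<le> r" unfolding ri tl_from_Suc[OF il] using ap_facts(3)[OF L_nth(2,3)[OF il]] by simp
    moreover have "r \<le> length C" unfolding ri by (rule length_tl_from_le)
    ultimately show ?thesis using c 1 C0 int_diff_mod[of r "length C"]
      by (intro exI[of _ "length C - r"]) simp
  next
    \<comment> \<open>The first block begins with \<open>x\<close>, so the ones are the last letters
      of the cycle. The count is the whole length, and the remainder turns \<open>- k\<close> into
      \<open>length C - k\<close>.\<close>
    case 2
    have "cyclic_substring C (length C - k) t = replicate k 1 @ take (t - k) (L ! i)"
      unfolding 2(2) by (rule read_wrap[OF L2]) (use assms(3) in simp)
    then have c: "cyclic_substring C (length C - k) t = s" using Lix lx(1) sx by simp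
    have rC: "r = length C" unfolding ri 2(2) tl_from_0 ..
    have kC: "k < length C" using length_C_ge[OF L2] assms(3) by simp
    have "(int (length C) - int r - int k) mod int (length C) = (int (length C) + (- int k)) mod int (length C)"
      unfolding rC by simp
    also have "\<dots> = (int (length C) - int k) mod int (length C)" by simp
    also have "\<dots> = int (length C) - int k" using kC 2(1) by (intro mod_pos_pos_trivial) auto
    finally show ?thesis using c kC 2(1) by (intro exI[of _ "length C - k"]) (auto simp: of_nat_diff)
  next
    case 3
    define h where "h = i - 1"
    have h: "Suc h = i" "h < length L" "Suc h < length L" "Suc (Suc h) < length L" using 3 il si by (auto simp: h_def)
    obtain x' c zs where d: "L ! h = x' @ c # zs" "c \<noteq> 1" "\<forall>z\<in>set zs. z = 1"
      using split_list_last_prop[OF L_not_ones[OF h(3)]] by blast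
    have sp: "take (length x') (L ! i) = x'"
      unfolding h(1)[symmetric] by (rule succ_prefix[OF h(3) d(1)]) (use d(2) in simp)
    \<comment> \<open>The predecessor exceeds \<open>x\<close> on the first \<open>length x\<close>
      letters, where \<open>L ! i\<close> agrees with \<open>x\<close>. As both words share
      \<open>x'\<close>, the last letter above 1 of the predecessor lies in that range, and its last
      \<open>k\<close> letters are ones.\<close>
    have lt: "length x' < length x"
    proof (rule ccontr)
      assume "\<not> length x' < length x"
      then have le: "length x \<le> length x'" by simp
      have "take (length x) (L ! h) = take (length x) x'" using le d(1) by simp
      also have "\<dots> = take (length x) (L ! i)" using le sp by (metis min.absorb1 take_take)
      finally show False using nP[of h] Pi h(1) by simp
    qed
    have lh: "length (L ! h) = t" by (rule L_nth(4)[OF h(2)])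
    then have kz: "k \<le> length zs" using lt d(1) lx assms(3) by simp
    have "zs = replicate (length zs) 1" using d(3) by (metis replicate_length_same)
    also have "\<dots> = replicate (length zs - k) 1 @ replicate k 1" using kz by (simp add: replicate_add[symmetric])
    finally have "L ! h = (x' @ c # replicate (length zs - k) 1) @ replicate k 1" using d(1) by simp
    then obtain a where a: "ap (L ! h) = a @ replicate k 1"
      using ap_trailing_ones[OF L_nth(3)[OF h(2)] _ L_not_ones[OF h(3)]] by blast
    have tlh: "length (tl_from h) = length a + k + r"
      unfolding tl_from_Suc[OF h(2)] h(1) ri a by simp
    have "length (tl_from h) \<le> length C" by (rule length_tl_from_le)
    then have e: "length C - length (tl_from h) + length a = length C - r - k" "r + k \<le> length C" using tlh by auto
    have "cyclic_substring C (length C - length (tl_from h) + length a) t =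
        drop (length a) (ap (L ! h)) @ take (t - (length (ap (L ! h)) - length a)) (L ! Suc h)"
      by (rule read_next[OF h(4)]) (simp add: a)
    also have "\<dots> = s" unfolding a h(1) using Lix lx(1) sx by simp
    finally have c: "cyclic_substring C (length C - r - k) t = s" unfolding e(1) .
    have "(int (length C) - int r - int k) mod int (length C) = int (length C - r - k)"
      using e(2) 3 by (simp add: of_nat_diff)
    then show ?thesis using c e(2) 3 C0 by (intro exI[of _ "length C - r - k"]) auto
  qed
qed

text \<open>This is the case \<open>t = n\<close>, in which a substring of length \<open>t\<close>
  goes round the one-letter cycle \<open>t\<close> times.\<close>

lemma length_L_1:
  assumes "length L < 2" shows "L = [ones]" "C = [1]"
proof -
  have l: "length L = 1" using assms L_nonempty by linarith
  then have "L ! 0 = ones" using L_last by simp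
  then show L: "L = [ones]" using l by (metis length_0_conv length_Suc_conv nth_Cons_0 One_nat_def)
  show "C = [1]" unfolding necklace_cycle_def L using ap_ones by simp
qed

lemma cyclic_substring_single: "cyclic_substring [1] p t = ones"
  by (simp add: cyclic_substring_def map_replicate_trivial replicate_length_same[symmetric])

lemma rank_all_ones:
  "\<exists>p. p < length C \<and> cyclic_substring C p t = ones \<and>
    int p = (int (length C) - int t) mod int (length C)"
proof (cases "2 \<le> length L")
  case True
  have c: "cyclic_substring C (length C - t) t = ones" using read_wrap[OF True order_refl] by simp
  have "t \<le> length C" by (rule length_C_ge[OF True])
  then have "length C - t < length C" using t1 by linarith
  then show ?thesis
    by (intro exI[of _ "length C - t"] conjI c int_diff_mod[OF t1 \<open>t \<le> length C\<close>])
next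
  case False
  then have "C = [1]" by (intro length_L_1) simp
  then show ?thesis using cyclic_substring_single by (intro exI[of _ 0]) simp
qed

lemma count_below_one: "count_below n t [1] = 1"
proof -
  have "below [1] w \<longleftrightarrow> w = ones" if w: "w \<in> diff_words n t" for w
  proof -
    have w0: "w \<noteq> []" by (rule diff_words_nonempty[OF w])
    have m0: "max_rotation w \<noteq> []" using length_max_rotation[OF w] t1 by auto
    have ge: "\<forall>c\<in>set (max_rotation w). 1 \<le> c" using diff_words_ge[OF max_rotation_in_diff_words[OF w w0]] by blast
    have sw: "set (max_rotation w) = set w" using max_rotation_rotation[OF w0] by (metis set_rotate)
    have "below [1] w \<longleftrightarrow> take 1 (max_rotation w) \<le> [1]" using below_max_rotation[OF w0, of "[1]"] by simp
    also have "\<dots> \<longleftrightarrow> hd (max_rotation w) \<le> 1" using m0 by (cases "max_rotation w") auto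
    also have "\<dots> \<longleftrightarrow> (\<forall>c\<in>set w. c = 1)"
      using neck_hd[OF neck_max_rotation[OF w0]] ge m0 sw by (metis hd_in_set le_antisym order_trans order_refl)
    also have "\<dots> \<longleftrightarrow> w = ones" using not_ones_iff[OF diff_words_length[OF w]] by blast
    finally show ?thesis .
  qed
  then have "{w \<in> diff_words n t. below [1] w} = {ones}" using ones_in_L set_L by auto
  then show ?thesis by (simp add: count_below_def)
qed

theorem rank_pos_correct:
  assumes "s \<in> diff_words n t"
  shows "0 \<le> rank_pos n t s \<and> nat (rank_pos n t s) < length C \<and>
    cyclic_substring C (nat (rank_pos n t s)) t = s"
proof -
  have s0: "s \<noteq> []" and ls: "length s = t" using assms diff_words_nonempty diff_words_length by auto
  have "\<exists>p. p < length C \<and> cyclic_substring C p t = s \<and> int p = rank_pos n t s"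
  proof (cases "s = ones")
    case True
    then have "sum_list s = t" by (simp add: sum_list_replicate)
    moreover have "neck ones" using ones_in_L set_L by simp
    then have "max_rotation s = ones" using max_rotation_neck True s0 by simp
    moreover have "\<forall>j<t - 1. s ! j = 1" using True by simp
    moreover have "take 1 ones = [1]" using t1 by (cases t) auto
    ultimately have "rank_pos n t s = (int (length C) - int 1 - int (t - 1)) mod int (length C)"
      unfolding rank_pos_def Let_def length_C using t1 count_below_one by simp
    also have "int (length C) - int 1 - int (t - 1) = int (length C) - int t" using t1 by (simp add: of_nat_diff)
    finally show ?thesis using rank_all_ones True by simp
  next
    case False
    have "sum_list s \<noteq> t" using sum_list_eq_length[of s] diff_words_ge[OF assms] ls False by auto
    define k where "k = (LEAST k. rotate k s = max_rotation s)"
    obtain m where m: "m < t" "rotate m s = max_rotation s" using max_rotation_rotation[OF s0] ls by metis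
    have k: "rotate k s = max_rotation s" "k \<le> m" "\<And>j. j < k \<Longrightarrow> rotate j s \<noteq> max_rotation s"
      unfolding k_def using LeastI[of "\<lambda>k. rotate k s = max_rotation s", OF m(2)] Least_le[of "\<lambda>k. rotate k s = max_rotation s", OF m(2)]
        not_less_Least[of _ "\<lambda>k. rotate k s = max_rotation s"] by auto
    have kt: "k < t" using k(2) m(1) by simp
    have b: "(\<forall>j<k. s ! j = 1) \<longleftrightarrow> (\<forall>c\<in>set (take k s). c = 1)"
      using kt ls by (auto simp: all_set_conv_all_nth)
    show ?thesis
    proof (cases "\<forall>c\<in>set (take k s). c = 1")
      case True
      then have "\<forall>j<k. s ! j = 1" using b by blast
      then have "rank_pos n t s = (int (length C) - int (count_below n t (take (duval_period (max_rotation s) (t - k)) (max_rotation s))) - int k) mod int (length C)"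
        unfolding rank_pos_def Let_def length_C using \<open>sum_list s \<noteq> t\<close> by (simp add: k_def[symmetric])
      then show ?thesis using rank_border[OF assms False kt k(1) True] by simp
    next
      case nT: False
      then have ex: "\<exists>c\<in>set (take k s). c \<noteq> 1" by blast
      let ?q = "duval_period (max_rotation s) t" let ?r = "count_below n t (take ?q (max_rotation s))"
      note ri = rank_inside[OF assms kt k(1) k(3) ex]
      have "0 < k" using ex by (cases k) auto
      then have lt: "length C - ?r + (?q - k) < length C" using ri(1-3) by linarith
      have nb: "(\<forall>j<k. s ! j = 1) = False" using nT b by blast
      have "rank_pos n t s = (int (length C) - int ?r - int k + int ?q) mod int (length C)"
        unfolding rank_pos_def Let_def if_not_P[OF \<open>sum_list s \<noteq> t\<close>] k_def[symmetric] nb if_False length_C ..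
      also have "int (length C) - int ?r - int k + int ?q = int (length C - ?r + (?q - k))"
        using ri(1-3) by (simp add: of_nat_diff)
      also have "\<dots> mod int (length C) = int (length C - ?r + (?q - k))"
        using lt by (intro mod_pos_pos_trivial) auto
      finally show ?thesis using lt ri(4) by (intro exI[of _ "length C - ?r + (?q - k)"]) simp
    qed
  qed
  then obtain p where "p < length C" "cyclic_substring C p t = s" "int p = rank_pos n t s" by blast
  then show ?thesis by (metis nat_int of_nat_0_le_iff)
qed

lemma cyclic_substring_bij: "bij_betw (\<lambda>p. cyclic_substring C p t) {..<length C} (diff_words n t)"
proof -
  let ?f = "\<lambda>p. cyclic_substring C p t"
  have sub: "diff_words n t \<subseteq> ?f ` {..<length C}"
  proof
    fix s assume "s \<in> diff_words n t"
    from rank_pos_correct[OF this] show "s \<in> ?f ` {..<length C}"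
      by (intro image_eqI[of _ _ "nat (rank_pos n t s)"]) auto
  qed
  have "card (?f ` {..<length C}) \<le> card (diff_words n t)" using card_image_le[of "{..<length C}" ?f] length_C by simp
  then have eq: "diff_words n t = ?f ` {..<length C}" using card_subset_eq[OF _ sub] card_mono[OF _ sub] by simp
  have "card (?f ` {..<length C}) = card {..<length C}" using eq length_C by simp
  then have "inj_on ?f {..<length C}" by (intro eq_card_imp_inj_on) auto
  then show ?thesis using eq by (simp add: bij_betw_def)
qed

section \<open>Blocks determined by counts\<close>

lemma is_block_index: "is_block n t K a \<longleftrightarrow> (\<exists>i<length L. a = L ! i \<and> length (tl_from (Suc i)) < K \<and> K \<le> length (tl_from i))"
proof
  assume a: "is_block n t K a"
  then obtain i where "i < length L" "L ! i = a" using index_of unfolding is_block_def by blast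
  then show "\<exists>i<length L. a = L ! i \<and> length (tl_from (Suc i)) < K \<and> K \<le> length (tl_from i)"
    using a length_tl_from_le_card[of i] length_tl_from_less_card[of i] unfolding is_block_def by auto
next
  assume "\<exists>i<length L. a = L ! i \<and> length (tl_from (Suc i)) < K \<and> K \<le> length (tl_from i)"
  then show "is_block n t K a"
    using length_tl_from_le_card length_tl_from_less_card L_nth(1,2) unfolding is_block_def by auto
qed

lemma is_block_exists:
  assumes "1 \<le> K" "K \<le> length C" shows "\<exists>a. is_block n t K a"
proof -
  define m where "m = (LEAST m. length (tl_from m) < K)"
  have "length (tl_from (length L)) < K" using assms(1) by (simp add: tl_from_def)
  then have m: "length (tl_from m) < K" "m \<le> length L" unfolding m_def by (rule LeastI, rule Least_le)
  have "m \<noteq> 0"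
  proof
    assume "m = 0"
    then show False using m(1) assms(2) by (simp add: tl_from_0)
  qed
  then obtain i where i: "m = Suc i" by (cases m) auto
  have "\<not> length (tl_from i) < K" using not_less_Least[of i "\<lambda>m. length (tl_from m) < K"] i unfolding m_def by simp
  then show ?thesis unfolding is_block_index using m i by (intro exI[of _ "L ! i"] exI[of _ i]) auto
qed

lemma tl_from_antimono: "i \<le> j \<Longrightarrow> length (tl_from j) \<le> length (tl_from i)"
proof (induction j rule: dec_induct)
  case (step j)
  have "length (tl_from (Suc j)) \<le> length (tl_from j)"
    by (cases "j < length L") (simp_all add: tl_from_Suc, simp add: tl_from_def)
  then show ?case using step by simp
qed simp

text \<open>Blocks are nonempty, so the suffix lengths decrease strictly and the value of
  \<open>K\<close> determines the block.\<close>

lemma is_block_tl: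
  assumes "i < length L" "is_block n t (length (tl_from i)) a" shows "a = L ! i"
proof -
  obtain j where j: "j < length L" "a = L ! j" "length (tl_from (Suc j)) < length (tl_from i)"
    "length (tl_from i) \<le> length (tl_from j)" using assms(2) is_block_index by blast
  have "i \<le> j" using tl_from_antimono[of "Suc j" i] j(3) by (meson not_less_eq_eq leD)
  moreover have "j \<le> i"
  proof (rule ccontr)
    assume "\<not> j \<le> i"
    then have "length (tl_from j) \<le> length (tl_from (Suc i))" by (intro tl_from_antimono) simp
    moreover have "length (tl_from (Suc i)) < length (tl_from i)"
      unfolding tl_from_Suc[OF assms(1)] length_append using ap_facts(3)[OF L_nth(2,3)[OF assms(1)]] by linarith
    ultimately show False using j(4) by simp
  qed
  ultimately show ?thesis using j(2) by simp
qed

text \<open>Together with \<open>is_block_prefix_ge\<close> this makes \<open>a ! l\<close> the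
  least letter whose count reaches \<open>K\<close>, which is the test of the letter search.\<close>

lemma is_block_prefix_less:
  assumes "is_block n t K a" "l < t" "c < a ! l" shows "count_below n t (take l a @ [c]) < K"
proof -
  have la: "length a = t" using assms(1) diff_words_length unfolding is_block_def by blast
  let ?z = "take l a @ [c]"
  have lz: "length ?z = Suc l" using la assms(2) by simp
  have "{w \<in> diff_words n t. below ?z w} \<subseteq> {w \<in> diff_words n t. max_rotation w < a}"
  proof
    fix w assume "w \<in> {w \<in> diff_words n t. below ?z w}"
    then have w: "w \<in> diff_words n t" "take (Suc l) (max_rotation w) \<le> ?z"
      using below_max_rotation[OF diff_words_nonempty, of w ?z] lz by auto
    have "?z < take (Suc l) a" using assms(2,3) la by (simp add: take_Suc_conv_app_nth)
    then have "take (Suc l) (max_rotation w) < take (Suc l) a" using w(2) by (rule le_less_trans[rotated])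
    then show "w \<in> {w \<in> diff_words n t. max_rotation w < a}" using w(1) take_less_imp by blast
  qed
  then have "count_below n t ?z \<le> card {w \<in> diff_words n t. max_rotation w < a}" unfolding count_below_def by (intro card_mono) auto
  then show ?thesis using assms(1) unfolding is_block_def by simp
qed

lemma is_block_prefix_ge:
  assumes "is_block n t K a" "l < t" shows "K \<le> count_below n t (take l a @ [a ! l])"
proof -
  have la: "length a = t" using assms(1) diff_words_length unfolding is_block_def by blast
  have z: "take l a @ [a ! l] = take (Suc l) a" using assms(2) la by (simp add: take_Suc_conv_app_nth)
  have "{w \<in> diff_words n t. max_rotation w \<le> a} \<subseteq> {w \<in> diff_words n t. below (take (Suc l) a) w}"
  proof
    fix w assume w: "w \<in> {w \<in> diff_words n t. max_rotation w \<le> a}"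
    have "below (take (Suc l) a) w \<longleftrightarrow> take (length (take (Suc l) a)) (max_rotation w) \<le> take (Suc l) a"
      by (rule below_max_rotation) (use w diff_words_nonempty in blast)
    moreover have "take (Suc l) (max_rotation w) \<le> take (Suc l) a" using w by (intro take_mono_le) simp
    ultimately show "w \<in> {w \<in> diff_words n t. below (take (Suc l) a) w}" using w assms(2) la by simp
  qed
  then have "card {w \<in> diff_words n t. max_rotation w \<le> a} \<le> count_below n t (take (Suc l) a)" unfolding count_below_def by (intro card_mono) auto
  then show ?thesis using assms(1) unfolding is_block_def z by simp
qed

text \<open>The last block is the single letter 1, so a word of ones that runs into it continues with the
  first block; hence the case distinction in \<open>e\<close>.\<close>

theorem unrank_correct:
  assumes "p < length C" "is_block n t (length C - p) a"
  defines "q \<equiv> duval_period a t"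
  defines "st \<equiv> length C - count_below n t (take q a)"
  defines "e \<equiv> if length C < st + q + 2 then length C else st + q"
  shows "count_below n t (take q a) \<le> length C" "st \<le> p" "p < st + q" "st + q \<le> length C"
    and "\<exists>j. p - st \<le> j \<and> j < q \<and> a ! j \<noteq> 1 \<Longrightarrow> cyclic_substring C p t = rotate (p - st) a"
    and "\<not> (\<exists>j. p - st \<le> j \<and> j < q \<and> a ! j \<noteq> 1) \<Longrightarrow>
      is_block n t (if e < length C then length C - e else length C) a' \<Longrightarrow>
      e - p \<le> t \<and> cyclic_substring C p t = replicate (e - p) 1 @ take (t - (e - p)) a'"
proof -
  obtain i where i: "i < length L" "a = L ! i" "length (tl_from (Suc i)) < length C - p"
    "length C - p \<le> length (tl_from i)" using assms(2) is_block_index by blast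
  have q: "take q a = ap a" "q = length (ap a)" using ap_duval_period[OF i(1)] unfolding q_def i(2) by auto
  have c: "count_below n t (take q a) = length (tl_from i)" using count_below_ap[OF i(1)] q(1) unfolding i(2) by simp
  have tl: "length (tl_from i) = q + length (tl_from (Suc i))" unfolding tl_from_Suc[OF i(1)] q(2) i(2) by simp
  have le: "length (tl_from i) \<le> length C" by (rule length_tl_from_le)
  have st: "st = length C - length (tl_from i)" unfolding st_def c ..
  show "count_below n t (take q a) \<le> length C" unfolding c by (rule le)
  show sp: "st \<le> p" using st i(4) assms(1) by linarith
  show pq: "p < st + q" using st i(3) tl le by linarith
  show "st + q \<le> length C" using st tl le by linarith
  have la: "length a = t" unfolding i(2) by (rule L_nth(4)[OF i(1)])
  have qt: "q \<le> t" using ap_facts(4)[OF L_nth(2,3)[OF i(1)]] la unfolding q(2) i(2) by simp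
  have apj: "ap a ! j = a ! j" if "j < q" for j unfolding q(1)[symmetric] using that by simp
  have ps: "length C - length (tl_from i) + (p - st) = p" using sp st by simp
  show "cyclic_substring C p t = rotate (p - st) a" if ex: "\<exists>j. p - st \<le> j \<and> j < q \<and> a ! j \<noteq> 1"
  proof -
    obtain j where j: "p - st \<le> j" "j < q" "a ! j \<noteq> 1" using ex by blast
    have "a ! j \<in> set a" using j(2) qt la by simp
    then have si: "Suc i < length L" using L_index_not_last[OF i(1)] j(3) unfolding i(2) by blast
    have "drop (p - st) (ap a) ! (j - (p - st)) = a ! j" using j q(2) apj by simp
    then have "a ! j \<in> set (drop (p - st) (ap a))" using j q(2)
      by (metis diff_less_mono length_drop nth_mem)
    then have "cyclic_substring C (length C - length (tl_from i) + (p - st)) t = rotate (p - st) a"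
      unfolding i(2) by (intro read_rotation[OF si]) (use j(3) i(2) in blast)
    then show ?thesis unfolding ps .
  qed
  assume no: "\<not> (\<exists>j. p - st \<le> j \<and> j < q \<and> a ! j \<noteq> 1)"
    and blk: "is_block n t (if e < length C then length C - e else length C) a'"
  have y: "drop (p - st) (ap a) = replicate (q - (p - st)) 1"
  proof (rule nth_equalityI)
    fix j assume "j < length (drop (p - st) (ap a))"
    then have "j + (p - st) < q" using q(2) by simp
    then show "drop (p - st) (ap a) ! j = replicate (q - (p - st)) 1 ! j"
      using no apj q(2) by (simp add: add.commute)
  qed (use q(2) in simp)
  have a'0: "e = length C \<Longrightarrow> a' = L ! 0"
    using blk is_block_tl[of 0 a'] L_nonempty by (simp add: tl_from_0)
  show "e - p \<le> t \<and> cyclic_substring C p t = replicate (e - p) 1 @ take (t - (e - p)) a'"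
  proof (cases "2 \<le> length L")
    case False
    then have LC: "L = [ones]" "C = [1]" using length_L_1 by auto
    have "p = 0" using assms(1) LC by simp
    moreover have eC: "e = 1" "e = length C" using LC pq unfolding e_def by (auto split: if_splits)
    ultimately have ep: "e - p = 1" by simp
    have a': "a' = ones" using a'0[OF eC(2)] LC(1) by simp
    have "ones = replicate 1 1 @ replicate (t - 1) 1" using t1 unfolding replicate_add[symmetric] by simp
    moreover have "take (t - 1) ones = replicate (t - 1) 1" by simp
    ultimately show ?thesis unfolding ep a' LC(2) cyclic_substring_single using t1 by metis
  next
    case L2: True
    show ?thesis
    proof (cases "Suc (Suc i) < length L")
      case True
      \<comment> \<open>At least two blocks follow, hence at least two letters, and \<open>e\<close>
        is the end of the current block.\<close>
      have "2 \<le> length (tl_from (Suc i))"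
      proof -
        have s1: "Suc i < length L" using True by simp
        have "length (tl_from (length L - 1)) \<le> length (tl_from (Suc (Suc i)))"
          by (rule tl_from_antimono) (use True in simp)
        then have "1 \<le> length (tl_from (Suc (Suc i)))" unfolding tl_from_last by simp
        then show ?thesis unfolding tl_from_Suc[OF s1] length_append using ap_facts(3)[OF L_nth(2,3)[OF s1]] by linarith
      qed
      then have e: "e = st + q" "e < length C" "length C - e = length (tl_from (Suc i))"
        unfolding e_def using st tl le by auto
      have "a' = L ! Suc i" using is_block_tl[of "Suc i" a'] blk e True by simp
      moreover have "cyclic_substring C (length C - length (tl_from i) + (p - st)) t =
          drop (p - st) (ap (L ! i)) @ take (t - (length (ap (L ! i)) - (p - st))) (L ! Suc i)"
        by (rule read_next[OF True]) (use pq sp q(2) i(2) in simp)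
      moreover have "q - (p - st) = e - p" using e pq sp by simp
      ultimately show ?thesis unfolding ps using y q(2) i(2) qt sp e by simp
    next
      case False
      have "length (tl_from (Suc i)) \<le> 1"
      proof -
        have "length (tl_from (Suc i)) \<le> length (tl_from (length L - 1))"
          by (rule tl_from_antimono) (use False in simp)
        then show ?thesis unfolding tl_from_last by simp
      qed
      \<comment> \<open>At most the final letter 1 is left after this block, so the run of ones
        extends to the end of the cycle.\<close>
      then have "length C < st + q + 2" using st tl le by linarith
      then have e: "e = length C" unfolding e_def by simp
      have bt: "length C - p \<le> t"
      proof (cases "Suc i < length L")
        case True
        then have "Suc i = length L - 1" using False by simp
        then have l1: "length (tl_from (Suc i)) = 1" using tl_from_last by simp
        \<comment> \<open>The root of the last block but one contains a letter above 1, but only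
          ones from \<open>p\<close> on, so \<open>p\<close> is not its start. At most
          \<open>q - 1\<close> ones of it and the final letter are read, which fits into
          \<open>t\<close>.\<close>
        have "\<exists>c\<in>set (ap (L ! i)). c \<noteq> 1" using ap_split[OF L_nth(3)[OF i(1)]] L_not_ones[OF True] by metis
        then have "drop 0 (ap a) \<noteq> replicate (q - 0) 1" using i(2) by auto
        then have "p - st \<noteq> 0" using y by metis
        then show ?thesis using st tl l1 le qt by linarith
      next
        case False
        then have "length (tl_from (Suc i)) = 0" by (simp add: tl_from_def)
        then show ?thesis using i(4) tl qt by linarith
      qed
      have "cyclic_substring C (length C - (length C - p)) t = replicate (length C - p) 1 @ take (t - (length C - p)) (L ! 0)"
        by (rule read_wrap[OF L2 bt])
      then show ?thesis using e bt a'0 assms(1) by simp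
    qed
  qed
qed

end

section \<open>Difference representatives\<close>

lemma length_comp [simp]: "length (comp k w) = length w"
  by (simp add: comp_def)

lemma comp_strings: "w \<in> strings k m \<Longrightarrow> comp k w \<in> strings k m"
proof -
  assume w: "w \<in> strings k m"
  then have "\<forall>x\<in>set w. 1 \<le> k - x + 1 \<and> k - x + 1 \<le> k" unfolding strings_def by fastforce
  then show ?thesis using w by (auto simp: strings_def comp_def)
qed

lemma comp_comp: "w \<in> strings k m \<Longrightarrow> comp k (comp k w) = w"
proof -
  assume "w \<in> strings k m"
  then have "\<forall>x\<in>set w. 1 \<le> x \<and> x \<le> k" by (auto simp: strings_def)
  then have "map (\<lambda>x. k - (k - x + 1) + 1) w = w" by (intro map_idI) auto
  then show ?thesis by (simp add: comp_def o_def)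
qed

lemma comp_less:
  "u \<in> strings k m \<Longrightarrow> v \<in> strings k m \<Longrightarrow> u < v \<Longrightarrow> comp k v < comp k u"
proof (induction u arbitrary: v m)
  case (Cons a u)
  then obtain b v' where v: "v = b # v'" by (cases v) auto
  have l: "u \<in> strings k (m - 1)" "v' \<in> strings k (m - 1)" "a \<in> {1..k}" "b \<in> {1..k}"
    using Cons.prems unfolding v strings_def by auto
  show ?case
  proof (cases "a = b")
    case True
    then have "comp k v' < comp k u" using Cons.IH[OF l(1,2)] Cons.prems(3) v by simp
    then show ?thesis unfolding v using True by (simp add: comp_def)
  next
    case False
    then have "a < b" using Cons.prems(3) v by simp
    then show ?thesis unfolding v using l(3,4) by (simp add: comp_def) linarith
  qed
qed (auto simp: strings_def)

lemma sum_list_comp: "w \<in> strings k m \<Longrightarrow> sum_list w + sum_list (comp k w) = m * (k + 1)"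
proof (induction w arbitrary: m)
  case (Cons a w)
  then obtain m' where m: "m = Suc m'" "w \<in> strings k m'" "a \<le> k" by (cases m) (auto simp: strings_def)
  then show ?case using Cons.IH[OF m(2)] by (simp add: comp_def)
qed (simp add: strings_def comp_def)

lemma comp_concat: "comp k (concat ws) = concat (map (comp k) ws)"
  by (induction ws) (simp_all add: comp_def)

lemma comp_rotate: "comp k (rotate i w) = rotate i (comp k w)"
  by (simp add: comp_def rotate_map)

lemma rotate_strings: "w \<in> strings k m \<Longrightarrow> rotate i w \<in> strings k m"
  by (simp add: strings_def)

lemma necklace_comp:
  assumes "w \<in> strings k m" shows "necklace w \<longleftrightarrow> neck (comp k w)"
proof -
  have "w \<le> rotate i w \<longleftrightarrow> rotate i (comp k w) \<le> comp k w" for i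
  proof
    assume "w \<le> rotate i w"
    then show "rotate i (comp k w) \<le> comp k w"
      using comp_less[OF assms rotate_strings[OF assms], of i] unfolding comp_rotate[symmetric] le_less by metis
  next
    assume le: "rotate i (comp k w) \<le> comp k w"
    show "w \<le> rotate i w"
    proof (rule ccontr)
      assume "\<not> w \<le> rotate i w"
      then have "comp k w < comp k (rotate i w)" using comp_less[OF rotate_strings[OF assms] assms] by simp
      then show False using le by (simp add: comp_rotate)
    qed
  qed
  then show ?thesis by (simp add: necklace_def neck_def)
qed

lemma ap_comp: "w \<in> strings k m \<Longrightarrow> w \<noteq> [] \<Longrightarrow> ap (comp k w) = comp k (ap w)"
  unfolding comp_def
proof (rule ap_map, rule inj_onI)
  fix x y assume "w \<in> strings k m" "x \<in> set w" "y \<in> set w" "k - x + 1 = k - y + 1"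
  moreover from this have "x \<in> {1..k}" "y \<in> {1..k}" unfolding strings_def by blast+
  ultimately show "x = y" by simp linarith
qed

text \<open>Recursive forms of differences and partial sums. The first argument is the element
  preceding the list, 0 at the start.\<close>

fun diffs :: "nat \<Rightarrow> nat list \<Rightarrow> nat list" where
  "diffs p [] = []"
| "diffs p (x # xs) = (x - p) # diffs x xs"

fun psums :: "nat \<Rightarrow> nat list \<Rightarrow> nat list" where
  "psums p [] = []"
| "psums p (d # ds) = (p + d) # psums (p + d) ds"

lemma map2_diffs: "map2 (-) xs (p # butlast xs) = diffs p xs"
proof (induction xs arbitrary: p)
  case (Cons x xs)
  then show ?case using Cons[of x] by (cases xs) auto
qed simp

lemma diff_rep_diffs: "diff_rep s = diffs 0 (sorted_list_of_set s)"
  unfolding diff_rep_def Let_def by (rule map2_diffs)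

lemma diffs_psums: "diffs p (psums p ds) = ds"
  by (induction ds arbitrary: p) auto

lemma psums_diffs: "sorted_wrt (<) (p # xs) \<Longrightarrow> psums p (diffs p xs) = xs"
  by (induction xs arbitrary: p) auto

lemma length_diffs [simp]: "length (diffs p xs) = length xs"
  by (induction xs arbitrary: p) auto

lemma length_psums [simp]: "length (psums p ds) = length ds"
  by (induction ds arbitrary: p) auto

lemma psums_sorted: "\<forall>d\<in>set ds. 1 \<le> d \<Longrightarrow> sorted_wrt (<) (p # psums p ds)"
proof (induction ds arbitrary: p)
  case (Cons d ds)
  have s: "sorted_wrt (<) ((p + d) # psums (p + d) ds)" using Cons by simp
  moreover have "p < p + d" using Cons.prems by simp
  ultimately show ?case by fastforce
qed simp

lemma psums_le: "x \<in> set (psums p ds) \<Longrightarrow> x \<le> p + sum_list ds"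
proof (induction ds arbitrary: p)
  case (Cons d ds)
  then show ?case using Cons.IH[of "p + d"] by (auto simp: add.assoc)
qed simp

lemma sum_diffs: "sorted_wrt (<) (p # xs) \<Longrightarrow> \<forall>x\<in>set (p # xs). x \<le> n \<Longrightarrow> p + sum_list (diffs p xs) \<le> n"
proof (induction xs arbitrary: p)
  case (Cons x xs)
  have "x + sum_list (diffs x xs) \<le> n" using Cons by auto
  then show ?case using Cons.prems by simp
qed simp

lemma diffs_pos: "sorted_wrt (<) (p # xs) \<Longrightarrow> \<forall>d\<in>set (diffs p xs). 1 \<le> d"
  by (induction xs arbitrary: p) (auto simp: Suc_le_eq)

lemma mem_strings_bound: "w \<in> diff_words n t \<longleftrightarrow> length w = t \<and> (\<forall>c\<in>set w. 1 \<le> c) \<and> sum_list w \<le> n"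
proof
  assume w: "length w = t \<and> (\<forall>c\<in>set w. 1 \<le> c) \<and> sum_list w \<le> n"
  have "c \<le> n" if "c \<in> set w" for c
    using sum_list_ge[of w c] that w by linarith
  then show "w \<in> diff_words n t" using w by (auto simp: diff_words_def strings_def)
qed (auto simp: diff_words_def strings_def)

lemma Subset_sorted:
  assumes "s \<in> Subset n t"
  shows "sorted_wrt (<) (0 # sorted_list_of_set s)" "length (sorted_list_of_set s) = t"
    "set (sorted_list_of_set s) = s" "finite s"
proof -
  have s: "s \<subseteq> {1..n}" "card s = t" using assms by (auto simp: Subset_def)
  then show f: "finite s" using finite_subset by blast
  show "set (sorted_list_of_set s) = s" using f by simp
  show "length (sorted_list_of_set s) = t" using f s(2) by simp
  show "sorted_wrt (<) (0 # sorted_list_of_set s)"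
    using s(1) f by (auto simp: strict_sorted_list_of_set)
qed

lemma psums_diff_rep: "s \<in> Subset n t \<Longrightarrow> psums 0 (diff_rep s) = sorted_list_of_set s"
  unfolding diff_rep_diffs by (rule psums_diffs[OF Subset_sorted(1)])

lemma diff_rep_in_diff_words:
  assumes "s \<in> Subset n t" shows "diff_rep s \<in> diff_words n t"
proof -
  note S = Subset_sorted[OF assms]
  have "\<forall>x\<in>set (0 # sorted_list_of_set s). x \<le> n" using assms S(3) by (auto simp: Subset_def)
  from sum_diffs[OF S(1) this] diffs_pos[OF S(1)] S(2)
  show ?thesis unfolding mem_strings_bound diff_rep_diffs by simp
qed

lemma diff_rep_psums:
  assumes "d \<in> diff_words n t"
  shows "set (psums 0 d) \<in> Subset n t" "diff_rep (set (psums 0 d)) = d"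
    "sorted_list_of_set (set (psums 0 d)) = psums 0 d"
proof -
  have d: "length d = t" "\<forall>c\<in>set d. 1 \<le> c" "sum_list d \<le> n" using assms mem_strings_bound by auto
  have s: "sorted_wrt (<) (0 # psums 0 d)" by (rule psums_sorted[OF d(2)])
  then have st: "sorted_wrt (<) (psums 0 d)" "\<forall>x\<in>set (psums 0 d). 1 \<le> x" by (auto simp: Suc_le_eq)
  then have so: "sorted (psums 0 d)" "distinct (psums 0 d)" by (auto simp: strict_sorted_iff)
  have "x \<le> n" if "x \<in> set (psums 0 d)" for x using psums_le[OF that] d(3) by simp
  then show "set (psums 0 d) \<in> Subset n t"
    using st(2) distinct_card[OF so(2)] d(1) by (auto simp: Subset_def)
  show e: "sorted_list_of_set (set (psums 0 d)) = psums 0 d"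
    using so by (simp add: sorted_list_of_set.idem_if_sorted_distinct)
  show "diff_rep (set (psums 0 d)) = d" unfolding diff_rep_diffs e by (rule diffs_psums)
qed

lemma diff_rep_bij: "bij_betw diff_rep (Subset n t) (diff_words n t)"
proof (rule bij_betw_imageI)
  show "inj_on diff_rep (Subset n t)"
  proof (rule inj_onI)
    fix s s' assume s: "s \<in> Subset n t" "s' \<in> Subset n t" "diff_rep s = diff_rep s'"
    then have "sorted_list_of_set s = sorted_list_of_set s'" using psums_diff_rep by metis
    then show "s = s'" using Subset_sorted(3) s(1,2) by metis
  qed
  show "diff_rep ` Subset n t = diff_words n t"
  proof (intro equalityI subsetI)
    fix d assume "d \<in> diff_words n t"
    from diff_rep_psums[OF this] show "d \<in> diff_rep ` Subset n t" by (metis imageI)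
  qed (use diff_rep_in_diff_words in blast)
qed

lemma card_diff_words: "card (diff_words n t) = n choose t"
proof -
  have "card (diff_words n t) = card (Subset n t)" using bij_betw_same_card[OF diff_rep_bij] by simp
  then show ?thesis using n_subsets[of "{1..n}" t] by (simp add: Subset_def)
qed

context params_ok
begin

text \<open>The complement reverses the lexicographic order, exchanges smallest and largest
  rotations, commutes with taking roots, and turns the lower weight bound into the upper bound
  \<open>n\<close>, since a letter and its complement add up to \<open>k + 1\<close>.\<close>

lemma G_down_necklace_cycle: "G_down (n - t + 1) t n = C"
proof -
  define k where "k = n - t + 1"
  define v where "v = k * t - n + t"
  define A where "A = {w \<in> strings_up k t v. necklace w}"
  let ?B = "{w \<in> diff_words n t. neck w}"
  \<comment> \<open>This makes the truncated subtraction in the weight bound exact. With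
    \<open>n = t + r\<close> and \<open>k = r + 1\<close> the product is \<open>t + r * t\<close>,
    and \<open>t\<close> is positive.\<close>
  have kt: "n \<le> k * t"
  proof -
    obtain r s where "n = t + r" "t = Suc s" using tn t1 by (metis le_add_diff_inverse Suc_le_D One_nat_def)
    then show ?thesis by (simp add: k_def)
  qed
  have dws: "diff_words n t = {w \<in> strings k t. sum_list w \<le> n}"
  proof (intro equalityI subsetI)
    fix w assume w: "w \<in> diff_words n t"
    have "c \<le> k" if "c \<in> set w" for c
      using sum_list_ge[of w c] that w tn t1 by (auto simp: mem_strings_bound k_def)
    then show "w \<in> {w \<in> strings k t. sum_list w \<le> n}" using w by (auto simp: diff_words_def strings_def)
  next
    fix w assume "w \<in> {w \<in> strings k t. sum_list w \<le> n}"
    then show "w \<in> diff_words n t" unfolding mem_strings_bound by (auto simp: strings_def)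
  qed
  have v: "v \<le> sum_list w \<longleftrightarrow> sum_list (comp k w) \<le> n" if "w \<in> strings k t" for w
  proof -
    have "sum_list w + sum_list (comp k w) = k * t + t" using sum_list_comp[OF that] by (simp add: algebra_simps)
    then show ?thesis unfolding v_def using kt by linarith
  qed
  have AB: "comp k w \<in> ?B" if "w \<in> A" for w
    using that v necklace_comp comp_strings unfolding A_def strings_up_def dws by blast
  have BA: "comp k w \<in> A" if "w \<in> ?B" for w
  proof -
    have w: "w \<in> strings k t" "sum_list w \<le> n" "neck w" using that unfolding dws by auto
    have "comp k w \<in> strings k t" by (rule comp_strings[OF w(1)])
    then show ?thesis using v[of "comp k w"] necklace_comp[of "comp k w"] w comp_comp[OF w(1)]
      unfolding A_def strings_up_def by simp
  qed
  have As: "A \<subseteq> strings k t" unfolding A_def strings_up_def by auto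
  have finA: "finite A" using As finite_subset[OF _ finite_strings] by blast
  have necklace_list: "necklaces_up k t v = sorted_list_of_set A" unfolding necklaces_up_def A_def ..
  let ?M = "map (comp k) (sorted_list_of_set A)"
  have setM: "set ?M = ?B"
  proof -
    have "comp k ` A = ?B"
    proof (intro equalityI subsetI)
      fix w assume w: "w \<in> ?B"
      then have "comp k (comp k w) = w" using comp_comp[of w k t] unfolding dws by simp
      then show "w \<in> comp k ` A" using BA[OF w] by (metis imageI)
    qed (use AB in auto)
    then show ?thesis using finA by simp
  qed
  have "sorted_wrt (<) (sorted_list_of_set A)" by simp
  then have "sorted_wrt (\<lambda>u v. comp k v < comp k u) (sorted_list_of_set A)"
    by (rule sorted_wrt_mono_rel[rotated]) (rule comp_less[of _ k t], use As finA in auto)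
  then have "sorted_wrt (>) ?M" by (simp add: sorted_wrt_map)
  then have "sorted_wrt (<) (rev ?M)" by (simp only: sorted_wrt_rev)
  then have "sorted (rev ?M)" "distinct (rev ?M)" by (simp_all only: strict_sorted_iff)
  then have "sorted_list_of_set (set (rev ?M)) = rev ?M" by (simp only: sorted_list_of_set.idem_if_sorted_distinct)
  then have M: "?M = L" unfolding necklace_list_def set_rev setM by (metis rev_rev_ident)
  have "comp k (ap w) = ap (comp k w)" if "w \<in> A" for w
  proof -
    have "w \<in> strings k t" using that As by blast
    moreover from this have "w \<noteq> []" using t1 by (auto simp: strings_def)
    ultimately show ?thesis using ap_comp[of w k t] by simp
  qed
  then have "map (comp k) (map ap (sorted_list_of_set A)) = map ap ?M" using finA by simp
  then have "G_down k t n = C"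
    unfolding G_down_def G_up_def necklace_cycle_def v_def[symmetric] necklace_list M[symmetric]
    unfolding comp_concat by (rule arg_cong)
  then show "G_down (n - t + 1) t n = C" unfolding k_def .
qed

lemma universal_cycle_G_down: "universal_cycle n t (G_down (n - t + 1) t n)"
  unfolding universal_cycle_def G_down_necklace_cycle
proof (intro conjI ballI)
  show "length C = n choose t" by (simp add: length_C card_diff_words)
  fix s assume "s \<in> Subset n t"
  then have "diff_rep s \<in> diff_words n t" by (rule diff_rep_in_diff_words)
  then have "diff_rep s \<in> (\<lambda>p. cyclic_substring C p t) ` {..<length C}"
    using bij_betw_imp_surj_on[OF cyclic_substring_bij] by (simp only:)
  then obtain p where p: "p < length C" "cyclic_substring C p t = diff_rep s" by force
  show "\<exists>!p. p < length C \<and> cyclic_substring C p t = diff_rep s"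
  proof (rule ex1I)
    show "p < length C \<and> cyclic_substring C p t = diff_rep s" using p by (rule conjI)
    fix p' assume p': "p' < length C \<and> cyclic_substring C p' t = diff_rep s"
    show "p' = p"
      by (rule inj_onD[OF bij_betw_imp_inj_on[OF cyclic_substring_bij]]) (use p p' in simp_all)
  qed
qed

lemma rank_G_down:
  assumes "s \<in> Subset n t"
  shows "int (rank t (G_down (n - t + 1) t n) s) = rank_pos n t (diff_rep s) + 1"
proof -
  let ?d = "diff_rep s" let ?p = "nat (rank_pos n t ?d)"
  have p: "0 \<le> rank_pos n t ?d" "?p < length C" "cyclic_substring C ?p t = ?d"
    using rank_pos_correct[OF diff_rep_in_diff_words[OF assms]] by auto
  have "rank t C s = ?p + 1"
    unfolding rank_def
  proof (rule the_equality)
    show "?p + 1 \<in> {1..length C} \<and> cyclic_substring C (?p + 1 - 1) t = ?d" using p by simp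
    fix i assume i: "i \<in> {1..length C} \<and> cyclic_substring C (i - 1) t = ?d"
    then have "i - 1 \<in> {..<length C}" "?p \<in> {..<length C}" using p by auto
    then have "i - 1 = ?p"
      by (intro inj_onD[OF bij_betw_imp_inj_on[OF cyclic_substring_bij]]) (use i p(3) in simp_all)
    then show "i = ?p + 1" using i by auto
  qed
  then show ?thesis unfolding G_down_necklace_cycle using p(1) by simp
qed

lemma unrank_G_down:
  assumes "i \<in> {1..length (G_down (n - t + 1) t n)}"
  shows "encode_set (unrank n t (G_down (n - t + 1) t n) i) = map int (psums 0 (cyclic_substring C (i - 1) t))"
proof -
  let ?d = "cyclic_substring C (i - 1) t"
  have "i - 1 < length C" using assms unfolding G_down_necklace_cycle by auto
  then have d: "?d \<in> diff_words n t" using bij_betwE[OF cyclic_substring_bij] by simp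
  note S = diff_rep_psums[OF d]
  have "unrank n t C i = set (psums 0 ?d)"
    unfolding unrank_def
  proof (rule the_equality)
    show "set (psums 0 ?d) \<in> Subset n t \<and> diff_rep (set (psums 0 ?d)) = ?d" using S by simp
    fix s assume "s \<in> Subset n t \<and> diff_rep s = ?d"
    then show "s = set (psums 0 ?d)" using psums_diff_rep Subset_sorted(3) by metis
  qed
  then show ?thesis unfolding G_down_necklace_cycle encode_set_def using S(3) by simp
qed

end

section \<open>A loop language with syntactic running time\<close>

datatype bop = Plus | Minus | Times

datatype ex = Cn int | Vr nat | Ar nat ex | Bin bop ex ex | Dv ex ex

abbreviation "Pl \<equiv> Bin Plus"
abbreviation "Mi \<equiv> Bin Minus"
abbreviation "Ti \<equiv> Bin Times"

datatype cm = Skp | Asg nat ex | ASt nat ex ex | Sq cm cm | Ifp ex cm cm | Fr nat nat cm | Rd nat | Wr ex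

text \<open>The input is never shortened; \<open>rdn\<close> counts the cells read. That no read
  fails thus becomes an inequality between \<open>rdn\<close> and the length of the input.\<close>

record st =
  va :: "nat \<Rightarrow> int"
  ar :: "nat \<Rightarrow> nat \<Rightarrow> int"
  inp :: "int list"
  rdn :: nat
  outp :: "int list"

abbreviation (input) "vN \<equiv> (0::nat)"
abbreviation (input) "vT \<equiv> (1::nat)"

text \<open>Reducing the index modulo \<open>t + 2\<close> makes every array access legal.\<close>

definition ix :: "st \<Rightarrow> int \<Rightarrow> nat" where
  "ix s z = nat (z mod (va s vT + 2))"

fun bop_fun :: "bop \<Rightarrow> int \<Rightarrow> int \<Rightarrow> int" where
  "bop_fun Plus x y = x + y"
| "bop_fun Minus x y = x - y"
| "bop_fun Times x y = x * y"

fun bop_instr :: "bop \<Rightarrow> operand \<Rightarrow> instr" where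
  "bop_instr Plus = ADD"
| "bop_instr Minus = SUB"
| "bop_instr Times = MULT"

fun ev :: "st \<Rightarrow> ex \<Rightarrow> int" where
  "ev s (Cn z) = z"
| "ev s (Vr x) = va s x"
| "ev s (Ar a e) = ar s a (ix s (ev s e))"
| "ev s (Bin b e1 e2) = bop_fun b (ev s e1) (ev s e2)"
| "ev s (Dv e1 e2) = ev s e1 div ev s e2"

definition setv :: "nat \<Rightarrow> int \<Rightarrow> st \<Rightarrow> st" where
  "setv x v s = s\<lparr>va := (va s)(x := v)\<rparr>"

definition seta :: "nat \<Rightarrow> nat \<Rightarrow> int \<Rightarrow> st \<Rightarrow> st" where
  "seta a j v s = s\<lparr>ar := (ar s)(a := (ar s a)(j := v))\<rparr>"

fun sem :: "cm \<Rightarrow> st \<Rightarrow> st" where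
  "sem Skp s = s"
| "sem (Asg x e) s = setv x (ev s e) s"
| "sem (ASt a i e) s = seta a (ix s (ev s i)) (ev s e) s"
| "sem (Sq c1 c2) s = sem c2 (sem c1 s)"
| "sem (Ifp e c1 c2) s = (if 0 < ev s e then sem c1 s else sem c2 s)"
| "sem (Fr x b c) s = ((\<lambda>u. setv x (va u x + 1) (sem c u)) ^^ nat (va s b)) (setv x 0 s)"
| "sem (Rd x) s = (setv x (inp s ! rdn s) s)\<lparr>rdn := Suc (rdn s)\<rparr>"
| "sem (Wr e) s = s\<lparr>outp := outp s @ [ev s e]\<rparr>"

fun mods :: "cm \<Rightarrow> nat set" where
  "mods Skp = {}"
| "mods (Asg x e) = {x}"
| "mods (ASt a i e) = {}"
| "mods (Sq c1 c2) = mods c1 \<union> mods c2"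
| "mods (Ifp e c1 c2) = mods c1 \<union> mods c2"
| "mods (Fr x b c) = insert x (mods c)"
| "mods (Rd x) = {x}"
| "mods (Wr e) = {}"

fun amods :: "cm \<Rightarrow> nat set" where
  "amods (ASt a i e) = {a}"
| "amods (Sq c1 c2) = amods c1 \<union> amods c2"
| "amods (Ifp e c1 c2) = amods c1 \<union> amods c2"
| "amods (Fr x b c) = amods c"
| "amods _ = {}"

fun pure :: "cm \<Rightarrow> bool" where
  "pure (Sq c1 c2) \<longleftrightarrow> pure c1 \<and> pure c2"
| "pure (Ifp e c1 c2) \<longleftrightarrow> pure c1 \<and> pure c2"
| "pure (Fr x b c) \<longleftrightarrow> pure c"
| "pure (Rd x) \<longleftrightarrow> False"
| "pure (Wr e) \<longleftrightarrow> False"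
| "pure _ \<longleftrightarrow> True"

lemma setv_simps [simp]:
  "va (setv x v s) y = (if y = x then v else va s y)" "ar (setv x v s) = ar s"
  "inp (setv x v s) = inp s" "rdn (setv x v s) = rdn s" "outp (setv x v s) = outp s"
  by (auto simp: setv_def)

lemma seta_simps [simp]:
  "va (seta a j v s) = va s" "ar (seta a j v s) b = (if b = a then (ar s a)(j := v) else ar s b)"
  "inp (seta a j v s) = inp s" "rdn (seta a j v s) = rdn s" "outp (seta a j v s) = outp s"
  by (auto simp: seta_def)

lemma sem_va: "x \<notin> mods c \<Longrightarrow> va (sem c s) x = va s x"
proof (induction c arbitrary: s)
  case (Fr y b c)
  have "va (((\<lambda>u. setv y (va u y + 1) (sem c u)) ^^ k) u) x = va u x" for k u
    by (induction k) (use Fr in auto)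
  then show ?case using Fr.prems by simp
qed auto

lemma sem_ar: "a \<notin> amods c \<Longrightarrow> ar (sem c s) a = ar s a"
proof (induction c arbitrary: s)
  case (Fr y b c)
  have "ar (((\<lambda>u. setv y (va u y + 1) (sem c u)) ^^ k) u) a = ar u a" for k u
    by (induction k) (use Fr in auto)
  then show ?case by simp
qed auto

lemma sem_inp [simp]: "inp (sem c s) = inp s"
proof (induction c arbitrary: s)
  case (Fr y b c)
  have "inp (((\<lambda>u. setv y (va u y + 1) (sem c u)) ^^ k) u) = inp u" for k u
    by (induction k) (use Fr in auto)
  then show ?case by simp
qed auto

lemma sem_pure: "pure c \<Longrightarrow> rdn (sem c s) = rdn s \<and> outp (sem c s) = outp s"
proof (induction c arbitrary: s)
  case (Fr y b c)
  have "rdn (((\<lambda>u. setv y (va u y + 1) (sem c u)) ^^ k) u) = rdn u \<and>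
      outp (((\<lambda>u. setv y (va u y + 1) (sem c u)) ^^ k) u) = outp u" for k u
    by (induction k) (use Fr in auto)
  then show ?case by simp
qed auto

lemma funpow_rdn:
  "(\<And>s. rdn s \<le> rdn (sem c s)) \<Longrightarrow> rdn u \<le> rdn (((\<lambda>u. setv y (va u y + 1) (sem c u)) ^^ k) u)"
proof (induction k)
  case (Suc k)
  then show ?case by simp (meson order_trans)
qed simp

text \<open>Because of this monotonicity it suffices to bound the number of cells read at the end of
  a program.\<close>

lemma sem_rdn: "rdn s \<le> rdn (sem c s)"
proof (induction c arbitrary: s)
  case (Sq c1 c2)
  then show ?case by simp (meson order_trans)
next
  case (Fr y b c)
  have "rdn (setv y 0 s) \<le> rdn (sem (Fr y b c) s)"
    unfolding sem.simps by (rule funpow_rdn) (rule Fr.IH)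
  then show ?case by simp
qed auto

text \<open>The loop rule. In the step, the value of the counter and the values of all variables and
  arrays that the body does not write come for free, so an invariant mentions only what
  changes.\<close>

lemma Fr_invariant [consumes 4, case_names init step]:
  assumes "va s b = int k" "x \<notin> mods c" "b \<notin> mods c" "x \<noteq> b"
    and "I 0 (setv x 0 s)"
    and "\<And>i u. i < k \<Longrightarrow> va u x = int i \<Longrightarrow> I i u
      \<Longrightarrow> (\<And>y. y \<noteq> x \<Longrightarrow> y \<notin> mods c \<Longrightarrow> va u y = va s y)
      \<Longrightarrow> (\<And>a. a \<notin> amods c \<Longrightarrow> ar u a = ar s a) \<Longrightarrow> inp u = inp s
      \<Longrightarrow> I (Suc i) (setv x (int (Suc i)) (sem c u))"
  shows "I k (sem (Fr x b c) s)"
proof -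
  let ?f = "\<lambda>u. setv x (va u x + 1) (sem c u)"
  have "i \<le> k \<Longrightarrow> I i ((?f ^^ i) (setv x 0 s)) \<and> va ((?f ^^ i) (setv x 0 s)) x = int i \<and>
      (\<forall>y. y \<noteq> x \<longrightarrow> y \<notin> mods c \<longrightarrow> va ((?f ^^ i) (setv x 0 s)) y = va s y) \<and>
      (\<forall>a. a \<notin> amods c \<longrightarrow> ar ((?f ^^ i) (setv x 0 s)) a = ar s a) \<and>
      inp ((?f ^^ i) (setv x 0 s)) = inp s" for i
  proof (induction i)
    case 0
    then show ?case using assms(5) by simp
  next
    case (Suc i)
    let ?u = "(?f ^^ i) (setv x 0 s)"
    have u: "I i ?u" "va ?u x = int i" "\<And>y. y \<noteq> x \<Longrightarrow> y \<notin> mods c \<Longrightarrow> va ?u y = va s y"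
      "\<And>a. a \<notin> amods c \<Longrightarrow> ar ?u a = ar s a" "inp ?u = inp s"
      using Suc by auto
    have "I (Suc i) (setv x (int (Suc i)) (sem c ?u))"
      by (rule assms(6)) (use Suc.prems u in auto)
    moreover have "?f ?u = setv x (int (Suc i)) (sem c ?u)" using u(2) by (simp add: add.commute)
    ultimately show ?case using u by (simp add: sem_va sem_ar)
  qed
  from this[of k] show ?thesis using assms(1) by simp
qed

section \<open>Compilation\<close>

text \<open>Register layout: 0 is the accumulator, 1 to 16 hold temporaries, 20 to 63 the variables,
  and from 64 on eight arrays are interleaved, so that the addresses do not depend on
  \<open>t\<close>. This is the origin of the bounds 44 and 8, and of 15 for the stack level
  \<open>d\<close>, at which \<open>1 + d\<close> and \<open>2 + d\<close> are in use.\<close>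

abbreviation (input) "rV x \<equiv> (20::nat) + x"
abbreviation (input) "rA a j \<equiv> (64::nat) + 8 * j + a"

text \<open>There is no remainder instruction, so the index is reduced by subtracting quotient times
  divisor. The address ends up in register \<open>1 + d\<close>, ready for indirect access.\<close>

definition adr :: "nat \<Rightarrow> nat \<Rightarrow> instr list" where
  "adr a d = [STORE (Reg (1 + d)), LOAD (Reg (rV vT)), ADD (Const 2), STORE (Reg (2 + d)),
     LOAD (Reg (1 + d)), DIV (Reg (2 + d)), MULT (Reg (2 + d)), STORE (Reg (2 + d)),
     LOAD (Reg (1 + d)), SUB (Reg (2 + d)), MULT (Const 8), ADD (Const (64 + int a)),
     STORE (Reg (1 + d))]"

fun elen :: "ex \<Rightarrow> nat" where
  "elen (Cn z) = 1"
| "elen (Vr x) = 1"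
| "elen (Ar a e) = elen e + 14"
| "elen (Bin b e1 e2) = elen e1 + elen e2 + 2"
| "elen (Dv e1 e2) = elen e1 + elen e2 + 3"

text \<open>The right operand is evaluated first, so that the left one is in the accumulator when a
  subtraction or division is executed. For a zero divisor the division is skipped: the accumulator
  then holds 0, which is the value of \<open>x div 0\<close> in the logic.\<close>

fun cex :: "ex \<Rightarrow> nat \<Rightarrow> nat \<Rightarrow> instr list" where
  "cex (Cn z) d p = [LOAD (Const z)]"
| "cex (Vr x) d p = [LOAD (Reg (rV x))]"
| "cex (Ar a e) d p = cex e d p @ adr a d @ [LOAD (Ind (1 + d))]"
| "cex (Bin b e1 e2) d p = cex e2 d p @ [STORE (Reg (1 + d))] @ cex e1 (d + 1) (p + elen e2 + 1) @ [bop_instr b (Reg (1 + d))]"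
| "cex (Dv e1 e2) d p = cex e2 d p @ [STORE (Reg (1 + d)), JZERO (p + elen e1 + elen e2 + 3)] @
     cex e1 (d + 1) (p + elen e2 + 2) @ [DIV (Reg (1 + d))]"

fun wfe :: "ex \<Rightarrow> nat \<Rightarrow> bool" where
  "wfe (Cn z) d \<longleftrightarrow> True"
| "wfe (Vr x) d \<longleftrightarrow> x < 44"
| "wfe (Ar a e) d \<longleftrightarrow> a < 8 \<and> d < 15 \<and> wfe e d"
| "wfe (Bin b e1 e2) d \<longleftrightarrow> d < 15 \<and> wfe e2 d \<and> wfe e1 (d + 1)"
| "wfe (Dv e1 e2) d \<longleftrightarrow> d < 15 \<and> wfe e2 d \<and> wfe e1 (d + 1)"

lemma length_cex [simp]: "length (cex e d p) = elen e"
  by (induction e arbitrary: d p) (simp_all add: adr_def)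

definition placed :: "instr list \<Rightarrow> nat \<Rightarrow> instr list \<Rightarrow> bool" where
  "placed P p cs \<longleftrightarrow> (\<forall>j<length cs. p + j < length P \<and> P ! (p + j) = cs ! j)"

lemma placed_Nil [simp]: "placed P p []"
  by (simp add: placed_def)

lemma placed_Cons [simp]: "placed P p (c # cs) \<longleftrightarrow> p < length P \<and> P ! p = c \<and> placed P (Suc p) cs"
  unfolding placed_def by (auto simp: All_less_Suc2)

lemma placed_append [simp]: "placed P p (xs @ ys) \<longleftrightarrow> placed P p xs \<and> placed P (p + length xs) ys"
  by (induction xs arbitrary: p) auto

type_synonym conf = "nat \<times> (nat \<Rightarrow> int) \<times> int list \<times> int list"

section \<open>Execution with bounds on time and registers\<close>

fun cfg :: "conf \<Rightarrow> nat set \<Rightarrow> config" where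
  "cfg (p, m, i, out) u = \<lparr>pc = p, mem = m, in_tape = i, out_tape = out, used = u\<rparr>"

text \<open>\<open>k\<close> bounds the time and \<open>B\<close> the addresses. Quantifying over
  all sets of previously used registers below \<open>B\<close> lets such statements be
  composed.\<close>

definition go :: "instr list \<Rightarrow> nat \<Rightarrow> nat \<Rightarrow> conf \<Rightarrow> conf \<Rightarrow> bool" where
  "go P B k c c' \<longleftrightarrow> (\<forall>u \<subseteq> {..<B}. \<exists>u' \<subseteq> {..<B}. \<exists>j\<le>k. (cfg c u, cfg c' u') \<in> ram_step P ^^ j)"

lemma go_refl [simp]: "go P B k c c"
  unfolding go_def by (intro allI impI exI[of _ "0::nat"] exI conjI) auto

lemma go_trans: "go P B k c c' \<Longrightarrow> go P B l c' c'' \<Longrightarrow> k + l \<le> n \<Longrightarrow> go P B n c c''"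
  unfolding go_def
proof (intro allI impI)
  fix u :: "nat set"
  assume 1: "\<forall>u \<subseteq> {..<B}. \<exists>u' \<subseteq> {..<B}. \<exists>j\<le>k. (cfg c u, cfg c' u') \<in> ram_step P ^^ j"
    and 2: "\<forall>u \<subseteq> {..<B}. \<exists>u' \<subseteq> {..<B}. \<exists>j\<le>l. (cfg c' u, cfg c'' u') \<in> ram_step P ^^ j"
    and n: "k + l \<le> n" and u: "u \<subseteq> {..<B}"
  obtain u' j where a: "u' \<subseteq> {..<B}" "j \<le> k" "(cfg c u, cfg c' u') \<in> ram_step P ^^ j"
    using 1[rule_format, OF u] by (elim exE conjE) (rule that)
  obtain u'' i where b: "u'' \<subseteq> {..<B}" "i \<le> l" "(cfg c' u', cfg c'' u'') \<in> ram_step P ^^ i"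
    using 2[rule_format, OF a(1)] by (elim exE conjE) (rule that)
  have "(cfg c u, cfg c'' u'') \<in> ram_step P ^^ (j + i)"
    unfolding relpow_add using a(3) b(3) by (rule relcompI)
  moreover have "j + i \<le> n" using a(2) b(2) n by linarith
  ultimately show "\<exists>u' \<subseteq> {..<B}. \<exists>j\<le>n. (cfg c u, cfg c'' u') \<in> ram_step P ^^ j"
    using b(1) by (intro exI[of _ u''] conjI exI[of _ "j + i"])
qed

lemma go_mono: "go P B k c c' \<Longrightarrow> k \<le> n \<Longrightarrow> go P B n c c'"
  using go_trans[of P B k c c' "n - k" c' n] by simp

lemma go_step:
  assumes "p < length P" "instr_regs m (P ! p) \<subseteq> {..<B}"
    and "\<And>u. exec (P ! p) (cfg (p, m, i, out) u) = Some (cfg c' u)"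
  shows "go P B 1 (p, m, i, out) c'"
  unfolding go_def
proof (intro allI impI)
  fix u assume u: "u \<subseteq> {..<B}"
  obtain p' m' i' out' where c': "c' = (p', m', i', out')" by (cases c') auto
  have "(cfg (p, m, i, out) u, cfg c' (u \<union> instr_regs m (P ! p))) \<in> ram_step P"
    unfolding ram_step_def using assms c' by simp
  then show "\<exists>u' \<subseteq> {..<B}. \<exists>j\<le>1. (cfg (p, m, i, out) u, cfg c' u') \<in> ram_step P ^^ j"
    using u assms(2) by (intro exI[of _ "u \<union> instr_regs m (P ! p)"] conjI exI[of _ "1::nat"]) simp_all
qed

lemma go_LOAD: "p < length P \<Longrightarrow> P ! p = LOAD a \<Longrightarrow> fetch m a = Some v \<Longrightarrow> insert 0 (operand_regs m a) \<subseteq> {..<B}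
    \<Longrightarrow> go P B 1 (p, m, i, out) (Suc p, m(0 := v), i, out)"
  by (rule go_step) (auto simp: set_reg_def)

lemma go_STORE: "p < length P \<Longrightarrow> P ! p = STORE a \<Longrightarrow> address m a = Some r \<Longrightarrow> insert 0 (operand_regs m a) \<subseteq> {..<B}
    \<Longrightarrow> go P B 1 (p, m, i, out) (Suc p, m(r := m 0), i, out)"
  by (rule go_step) (auto simp: set_reg_def)

lemma go_bop: "p < length P \<Longrightarrow> P ! p = bop_instr b a \<Longrightarrow> fetch m a = Some v \<Longrightarrow> insert 0 (operand_regs m a) \<subseteq> {..<B}
    \<Longrightarrow> go P B 1 (p, m, i, out) (Suc p, m(0 := bop_fun b (m 0) v), i, out)"
  by (rule go_step) (cases b; auto simp: set_reg_def)+

lemma go_DIV: "p < length P \<Longrightarrow> P ! p = DIV a \<Longrightarrow> fetch m a = Some v \<Longrightarrow> v \<noteq> 0 \<Longrightarrow> insert 0 (operand_regs m a) \<subseteq> {..<B}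
    \<Longrightarrow> go P B 1 (p, m, i, out) (Suc p, m(0 := m 0 div v), i, out)"
  by (rule go_step) (auto simp: set_reg_def)

lemma go_READ: "p < length P \<Longrightarrow> P ! p = READ a \<Longrightarrow> address m a = Some r \<Longrightarrow> operand_regs m a \<subseteq> {..<B}
    \<Longrightarrow> go P B 1 (p, m, x # i, out) (Suc p, m(r := x), i, out)"
  by (rule go_step) (auto simp: set_reg_def)

lemma go_WRITE: "p < length P \<Longrightarrow> P ! p = WRITE a \<Longrightarrow> fetch m a = Some v \<Longrightarrow> operand_regs m a \<subseteq> {..<B}
    \<Longrightarrow> go P B 1 (p, m, i, out) (Suc p, m, i, out @ [v])"
  by (rule go_step) auto

lemma go_JUMP: "p < length P \<Longrightarrow> P ! p = JUMP l \<Longrightarrow> go P B 1 (p, m, i, out) (l, m, i, out)"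
  by (rule go_step) (auto simp: jump_if_def)

lemma go_JGTZ: "p < length P \<Longrightarrow> P ! p = JGTZ l \<Longrightarrow> 0 < B
    \<Longrightarrow> go P B 1 (p, m, i, out) (if 0 < m 0 then l else Suc p, m, i, out)"
  by (rule go_step) (auto simp: jump_if_def)

lemma go_JZERO: "p < length P \<Longrightarrow> P ! p = JZERO l \<Longrightarrow> 0 < B
    \<Longrightarrow> go P B 1 (p, m, i, out) (if m 0 = 0 then l else Suc p, m, i, out)"
  by (rule go_step) (auto simp: jump_if_def)

text \<open>In this form each rule peels off one instruction and decreases the time budget, so
  straight-line code is executed symbolically.\<close>

lemma cLOAD: "\<lbrakk>p < length P; P ! p = LOAD a; fetch m a = Some v; insert 0 (operand_regs m a) \<subseteq> {..<B}; 0 < n;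
    go P B (n - 1) (Suc p, m(0 := v), i, out) c\<rbrakk> \<Longrightarrow> go P B n (p, m, i, out) c"
  by (rule go_trans[OF go_LOAD]) auto

lemma cSTORE: "\<lbrakk>p < length P; P ! p = STORE a; address m a = Some r; insert 0 (operand_regs m a) \<subseteq> {..<B}; 0 < n;
    go P B (n - 1) (Suc p, m(r := m 0), i, out) c\<rbrakk> \<Longrightarrow> go P B n (p, m, i, out) c"
  by (rule go_trans[OF go_STORE]) auto

lemma cADD: "\<lbrakk>p < length P; P ! p = ADD a; fetch m a = Some v; insert 0 (operand_regs m a) \<subseteq> {..<B}; 0 < n;
    go P B (n - 1) (Suc p, m(0 := m 0 + v), i, out) c\<rbrakk> \<Longrightarrow> go P B n (p, m, i, out) c"
  using go_bop[of p P Plus a m v B i out] by (auto intro: go_trans)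

lemma cSUB: "\<lbrakk>p < length P; P ! p = SUB a; fetch m a = Some v; insert 0 (operand_regs m a) \<subseteq> {..<B}; 0 < n;
    go P B (n - 1) (Suc p, m(0 := m 0 - v), i, out) c\<rbrakk> \<Longrightarrow> go P B n (p, m, i, out) c"
  using go_bop[of p P Minus a m v B i out] by (auto intro: go_trans)

lemma cMULT: "\<lbrakk>p < length P; P ! p = MULT a; fetch m a = Some v; insert 0 (operand_regs m a) \<subseteq> {..<B}; 0 < n;
    go P B (n - 1) (Suc p, m(0 := m 0 * v), i, out) c\<rbrakk> \<Longrightarrow> go P B n (p, m, i, out) c"
  using go_bop[of p P Times a m v B i out] by (auto intro: go_trans)

lemma cDIV: "\<lbrakk>p < length P; P ! p = DIV a; fetch m a = Some v; v \<noteq> 0; insert 0 (operand_regs m a) \<subseteq> {..<B}; 0 < n;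
    go P B (n - 1) (Suc p, m(0 := m 0 div v), i, out) c\<rbrakk> \<Longrightarrow> go P B n (p, m, i, out) c"
  by (rule go_trans[OF go_DIV]) auto

lemma go_end: "p = p' \<Longrightarrow> go P B k (p, m, i, out) (p', m, i, out)"
  by simp

definition RM :: "nat \<Rightarrow> st \<Rightarrow> (nat \<Rightarrow> int) \<Rightarrow> bool" where
  "RM t s m \<longleftrightarrow> (\<forall>x<44. m (rV x) = va s x) \<and> (\<forall>a<8. \<forall>j\<le>t + 1. m (rA a j) = ar s a j)"

text \<open>The contract of an evaluation at stack level \<open>d\<close>: operands saved at lower
  levels, variables and arrays survive.\<close>

definition keep :: "nat \<Rightarrow> (nat \<Rightarrow> int) \<Rightarrow> (nat \<Rightarrow> int) \<Rightarrow> bool" where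
  "keep d m m' \<longleftrightarrow> (\<forall>r. r \<noteq> 0 \<longrightarrow> r < 1 + d \<or> 16 < r \<longrightarrow> m' r = m r)"

lemma RM_keep: "RM t s m \<Longrightarrow> keep d m m' \<Longrightarrow> RM t s m'"
  by (simp add: RM_def keep_def)

lemma keep_trans: "keep d m m' \<Longrightarrow> keep e m' m'' \<Longrightarrow> d \<le> e \<Longrightarrow> keep d m m''"
  by (auto simp: keep_def)

lemma keep_upd: "keep d m m' \<Longrightarrow> d < 16 \<Longrightarrow> keep d m (m'(Suc d := v))"
  by (auto simp: keep_def)

lemma keep_acc: "keep d m m' \<Longrightarrow> keep d m (m'(0 := v))"
  by (auto simp: keep_def)

lemma keep_refl [simp]: "keep d m m"
  by (simp add: keep_def)

lemma length_adr: "length (adr a d) = 13"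
  by (simp add: adr_def)

lemma adr_go:
  assumes "placed P p (adr a d)" "d < 15" "a < 8" "m 21 = int t" "8 * t + 80 \<le> B"
  shows "\<exists>m'. go P B 13 (p, m, i, out) (p + 13, m', i, out) \<and>
    m' (Suc d) = int (rA a (nat (m 0 mod (int t + 2)))) \<and> keep d m m'"
proof -
  have d: "d \<noteq> 20" "d \<noteq> 19" "Suc d < B" "d < B" "0 < B" "21 < B" "Suc (Suc d) < B" using assms by auto
  note pl = assms(1)[unfolded adr_def, simplified]
  have val: "8 * (m 0 mod (int t + 2)) + (64 + int a) = int (rA a (nat (m 0 mod (int t + 2))))"
    by simp
  have z: "m 0 - m 0 div (int t + 2) * (int t + 2) = m 0 mod (int t + 2)"
    by (simp add: minus_div_mult_eq_mod)
  show ?thesis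
    apply (rule exI, rule conjI)
     apply (rule cSTORE, use pl d in simp, use pl in simp, simp, use d in simp, simp)
     apply (rule cLOAD, use pl d in simp, use pl in simp, simp, use d in simp, simp)
     apply (rule cADD, use pl d in simp, use pl in simp, simp, use d in simp, simp)
     apply (rule cSTORE, use pl d in simp, use pl in simp, simp, use d in simp, simp)
     apply (rule cLOAD, use pl d in simp, use pl in simp, simp, use d in simp, simp)
     apply (rule cDIV, use pl d in simp, use pl in simp, simp, use d assms(4) in simp, use d in simp, simp)
     apply (rule cMULT, use pl d in simp, use pl in simp, simp, use d in simp, simp)
     apply (rule cSTORE, use pl d in simp, use pl in simp, simp, use d in simp, simp)
     apply (rule cLOAD, use pl d in simp, use pl in simp, simp, use d in simp, simp)
     apply (rule cSUB, use pl d in simp, use pl in simp, simp, use d in simp, simp)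
     apply (rule cMULT, use pl d in simp, use pl in simp, simp, use d in simp, simp)
     apply (rule cADD, use pl d in simp, use pl in simp, simp, use d in simp, simp)
     apply (rule cSTORE, use pl d in simp, use pl in simp, simp, use d in simp, simp)
     apply (rule go_end, simp)
    apply (rule conjI)
    subgoal using d assms(4) z val by (simp add: mult.commute)
    subgoal using assms(2) by (auto simp: keep_def)
    done
qed

lemma bin_go:
  assumes "go P B k2 (p, m, i, out) (p2, m2, i, out)" "m2 0 = v2" "keep d m m2" "d < 15" "80 \<le> B"
    and "p2 < length P" "P ! p2 = STORE (Reg (Suc d))"
    and "\<And>m'. keep d m m' \<Longrightarrow> \<exists>m1. go P B k1 (Suc p2, m', i, out) (p1, m1, i, out) \<and> m1 0 = v1 \<and> keep (Suc d) m' m1"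
  shows "\<exists>m1. go P B (k1 + k2 + 1) (p, m, i, out) (p1, m1, i, out) \<and> m1 0 = v1 \<and> m1 (Suc d) = v2 \<and> keep d m m1"
proof -
  let ?m' = "m2(Suc d := v2)"
  have k': "keep d m ?m'" using keep_upd[OF assms(3)] assms(4) by simp
  obtain m1 where m1: "go P B k1 (Suc p2, ?m', i, out) (p1, m1, i, out)" "m1 0 = v1" "keep (Suc d) ?m' m1"
    using assms(8)[OF k'] by blast
  have st: "go P B 1 (p2, m2, i, out) (Suc p2, m2(Suc d := m2 0), i, out)"
    by (rule go_STORE[where r = "Suc d"]) (use assms in auto)
  have "go P B (k2 + 1) (p, m, i, out) (Suc p2, ?m', i, out)"
    using go_trans[OF assms(1) st order_refl] assms(2) by simp
  then have "go P B (k1 + k2 + 1) (p, m, i, out) (p1, m1, i, out)"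
    by (rule go_trans[OF _ m1(1)]) simp
  moreover have "m1 (Suc d) = v2" using m1(3) by (simp add: keep_def)
  moreover have "keep d m m1" using keep_trans[OF k' m1(3)] by simp
  ultimately show ?thesis using m1(2) by blast
qed

lemma ex_go:
  "go P B k c (q, m', i, out) \<Longrightarrow> k = k' \<Longrightarrow> q = q' \<Longrightarrow> m' 0 = v \<Longrightarrow> keep d m m' \<Longrightarrow>
    \<exists>m'. go P B k' c (q', m', i, out) \<and> m' 0 = v \<and> keep d m m'"
  by blast

lemma cex_go:
  assumes "8 * t + 80 \<le> B" "va s vT = int t"
  shows "placed P p (cex e d p) \<Longrightarrow> wfe e d \<Longrightarrow> RM t s m \<Longrightarrow>
    \<exists>m'. go P B (elen e) (p, m, i, out) (p + elen e, m', i, out) \<and> m' 0 = ev s e \<and> keep d m m'"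
proof (induction e arbitrary: d p m)
  case (Cn z)
  have "go P B 1 (p, m, i, out) (Suc p, m(0 := z), i, out)"
    by (rule go_LOAD) (use Cn assms in auto)
  then show ?case using keep_acc[OF keep_refl, of d m z] by fastforce
next
  case (Vr x)
  have x: "x < 44" "m (20 + x) = va s x" using Vr by (auto simp: RM_def)
  have "go P B 1 (p, m, i, out) (Suc p, m(0 := va s x), i, out)"
    by (rule go_LOAD) (use Vr x assms in auto)
  then show ?case using keep_acc[OF keep_refl, of d m "va s x"] by fastforce
next
  case (Ar a e)
  have pl: "placed P p (cex e d p)" "placed P (p + elen e) (adr a d)"
    "p + elen e + 13 < length P" "P ! (p + elen e + 13) = LOAD (Ind (1 + d))"
    using Ar.prems(1) by (simp_all add: length_adr add.assoc)
  have w: "a < 8" "d < 15" "wfe e d" using Ar.prems(2) by auto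
  obtain m1 where m1: "go P B (elen e) (p, m, i, out) (p + elen e, m1, i, out)" "m1 0 = ev s e" "keep d m m1"
    using Ar.IH[OF pl(1) w(3) Ar.prems(3)] by blast
  have RM1: "RM t s m1" using RM_keep[OF Ar.prems(3) m1(3)] .
  then have "m1 (rV vT) = va s vT" unfolding RM_def by (elim conjE allE[of _ vT]) simp
  then have m21: "m1 21 = int t" using assms(2) by simp
  define j where "j = ix s (ev s e)"
  have jt: "j \<le> t + 1"
  proof -
    have "ev s e mod (int t + 2) < int t + 2" by simp
    then show ?thesis unfolding j_def ix_def assms(2) by linarith
  qed
  obtain m2 where m2: "go P B 13 (p + elen e, m1, i, out) (p + elen e + 13, m2, i, out)"
      "m2 (Suc d) = int (rA a j)" "keep d m1 m2"
    using adr_go[where m = m1, OF pl(2) w(2,1) m21 assms(1)] unfolding j_def ix_def assms(2) m1(2) by blast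
  have RM2: "RM t s m2" using RM_keep[OF RM1 m2(3)] .
  have jB: "rA a j < B" using jt w(1) assms(1) by linarith
  have val: "m2 (rA a j) = ar s a j" using RM2 w(1) jt by (simp add: RM_def)
  have nm: "nat (m2 (Suc d)) = rA a j" "0 \<le> m2 (Suc d)"
    unfolding m2(2) by (rule nat_int, rule of_nat_0_le_iff)
  have "go P B 1 (p + elen e + 13, m2, i, out) (Suc (p + elen e + 13), m2(0 := ar s a j), i, out)"
    by (rule go_LOAD) (use pl nm jB w assms(1) val in auto)
  then have "go P B (13 + 1) (p + elen e, m1, i, out) (Suc (p + elen e + 13), m2(0 := ar s a j), i, out)"
    by (rule go_trans[OF m2(1)]) simp
  then have "go P B (elen e + 14) (p, m, i, out) (Suc (p + elen e + 13), m2(0 := ar s a j), i, out)"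
    by (rule go_trans[OF m1(1)]) simp
  then show ?case
    by (rule ex_go) (simp_all add: j_def keep_acc[OF keep_trans[OF m1(3) m2(3)]])
next
  case (Bin b e1 e2)
  let ?p2 = "p + elen e2" and ?p1 = "Suc (p + elen e2) + elen e1"
  have pl: "placed P p (cex e2 d p)" "?p2 < length P" "P ! ?p2 = STORE (Reg (Suc d))"
    "placed P (Suc ?p2) (cex e1 (Suc d) (Suc ?p2))" "?p1 < length P" "P ! ?p1 = bop_instr b (Reg (Suc d))"
    using Bin.prems(1) by (simp_all add: add.assoc)
  have w: "d < 15" "wfe e2 d" "wfe e1 (Suc d)" using Bin.prems(2) by auto
  obtain m2 where m2: "go P B (elen e2) (p, m, i, out) (?p2, m2, i, out)" "m2 0 = ev s e2" "keep d m m2"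
    using Bin.IH(2)[OF pl(1) w(2) Bin.prems(3)] by blast
  have "\<exists>m1. go P B (elen e1) (Suc ?p2, m', i, out) (?p1, m1, i, out) \<and> m1 0 = ev s e1 \<and> keep (Suc d) m' m1"
    if "keep d m m'" for m'
    using Bin.IH(1)[OF pl(4) w(3) RM_keep[OF Bin.prems(3) that]] .
  from bin_go[OF m2 w(1) _ pl(2,3) this] assms(1)
  obtain m1 where m1: "go P B (elen e1 + elen e2 + 1) (p, m, i, out) (?p1, m1, i, out)" "m1 0 = ev s e1"
    "m1 (Suc d) = ev s e2" "keep d m m1" by auto
  have "go P B 1 (?p1, m1, i, out) (Suc ?p1, m1(0 := bop_fun b (m1 0) (m1 (Suc d))), i, out)"
    by (rule go_bop) (use pl w assms(1) in auto)
  from go_trans[OF m1(1) this order_refl] show ?case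
    by (rule ex_go) (simp_all add: m1(2,3) keep_acc[OF m1(4)])
next
  case (Dv e1 e2)
  let ?p2 = "p + elen e2" and ?p1 = "Suc (Suc (p + elen e2)) + elen e1"
  have pl: "placed P p (cex e2 d p)" "?p2 < length P" "P ! ?p2 = STORE (Reg (Suc d))"
    "Suc ?p2 < length P" "P ! Suc ?p2 = JZERO (p + elen e1 + elen e2 + 3)"
    "placed P (Suc (Suc ?p2)) (cex e1 (Suc d) (Suc (Suc ?p2)))" "?p1 < length P" "P ! ?p1 = DIV (Reg (Suc d))"
    using Dv.prems(1) by (simp_all add: add.assoc)
  have w: "d < 15" "wfe e2 d" "wfe e1 (Suc d)" using Dv.prems(2) by auto
  obtain m2 where m2: "go P B (elen e2) (p, m, i, out) (?p2, m2, i, out)" "m2 0 = ev s e2" "keep d m m2"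
    using Dv.IH(2)[OF pl(1) w(2) Dv.prems(3)] by blast
  let ?m = "m2(Suc d := m2 0)"
  have km: "keep d m ?m" using keep_upd[OF m2(3)] w(1) by simp
  have "go P B 1 (?p2, m2, i, out) (Suc ?p2, ?m, i, out)"
    by (rule go_STORE) (use pl w assms(1) in auto)
  from go_trans[OF m2(1) this order_refl]
  have g1: "go P B (elen e2 + 1) (p, m, i, out) (Suc ?p2, ?m, i, out)" .
  have "go P B 1 (Suc ?p2, ?m, i, out) (if ?m 0 = 0 then p + elen e1 + elen e2 + 3 else Suc (Suc ?p2), ?m, i, out)"
    by (rule go_JZERO) (use pl assms(1) in auto)
  from go_trans[OF g1 this order_refl]
  have g2: "go P B (elen e2 + 2) (p, m, i, out) (if ?m 0 = 0 then p + elen e1 + elen e2 + 3 else Suc (Suc ?p2), ?m, i, out)"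
    by simp
  show ?case
  proof (cases "ev s e2 = 0")
    case True
    then have "go P B (elen e2 + 2) (p, m, i, out) (p + elen e1 + elen e2 + 3, ?m, i, out)"
      using g2 m2(2) by simp
    then have "go P B (elen (Dv e1 e2)) (p, m, i, out) (p + elen e1 + elen e2 + 3, ?m, i, out)"
      by (rule go_mono) simp
    then show ?thesis by (rule ex_go) (use km in \<open>simp_all add: True m2(2)\<close>)
  next
    case False
    then have g3: "go P B (elen e2 + 2) (p, m, i, out) (Suc (Suc ?p2), ?m, i, out)" using g2 m2(2) by simp
    obtain m1 where m1: "go P B (elen e1) (Suc (Suc ?p2), ?m, i, out) (?p1, m1, i, out)" "m1 0 = ev s e1" "keep (Suc d) ?m m1"
      using Dv.IH(1)[OF pl(6) w(3) RM_keep[OF Dv.prems(3) km]] by blast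
    have v2: "m1 (Suc d) = ev s e2" using m1(3) m2(2) by (simp add: keep_def)
    have g4: "go P B 1 (?p1, m1, i, out) (Suc ?p1, m1(0 := m1 0 div m1 (Suc d)), i, out)"
      by (rule go_DIV) (use pl w assms(1) v2 False in auto)
    from go_trans[OF go_trans[OF g3 m1(1) order_refl] g4 order_refl] show ?thesis
      by (rule ex_go) (simp_all add: m1(2) v2 keep_acc[OF keep_trans[OF km m1(3)]])
  qed
qed


fun clen :: "cm \<Rightarrow> nat" where
  "clen Skp = 0"
| "clen (Asg x e) = elen e + 1"
| "clen (ASt a i e) = elen e + elen i + 16"
| "clen (Sq c1 c2) = clen c1 + clen c2"
| "clen (Ifp e c1 c2) = elen e + clen c1 + clen c2 + 2"
| "clen (Fr x b c) = clen c + 10"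
| "clen (Rd x) = 1"
| "clen (Wr e) = elen e + 1"

fun ccm :: "cm \<Rightarrow> nat \<Rightarrow> instr list" where
  "ccm Skp p = []"
| "ccm (Asg x e) p = cex e 0 p @ [STORE (Reg (rV x))]"
| "ccm (ASt a i e) p = cex e 0 p @ [STORE (Reg 1)] @ cex i 1 (p + elen e + 1) @ adr a 1 @
     [LOAD (Reg 1), STORE (Ind 2)]"
| "ccm (Sq c1 c2) p = ccm c1 p @ ccm c2 (p + clen c1)"
| "ccm (Ifp e c1 c2) p = cex e 0 p @ [JGTZ (p + elen e + clen c2 + 2)] @ ccm c2 (p + elen e + 1) @
     [JUMP (p + elen e + clen c2 + clen c1 + 2)] @ ccm c1 (p + elen e + clen c2 + 2)"
| "ccm (Fr x b c) p = [LOAD (Const 0), STORE (Reg (rV x)), LOAD (Reg (rV b)), SUB (Reg (rV x)),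
     JGTZ (p + 6), JUMP (p + clen c + 10)] @ ccm c (p + 6) @
     [LOAD (Reg (rV x)), ADD (Const 1), STORE (Reg (rV x)), JUMP (p + 2)]"
| "ccm (Rd x) p = [READ (Reg (rV x))]"
| "ccm (Wr e) p = cex e 0 p @ [WRITE (Reg 0)]"

text \<open>An upper bound: both branches of a conditional are charged. A round of a loop costs 3
  instructions for the test and 4 for the increment and the jump back; initialisation takes 2 and
  the failing test 4.\<close>

fun tcm :: "cm \<Rightarrow> nat \<Rightarrow> nat \<Rightarrow> nat" where
  "tcm Skp n t = 0"
| "tcm (Asg x e) n t = elen e + 1"
| "tcm (ASt a i e) n t = elen e + elen i + 16"
| "tcm (Sq c1 c2) n t = tcm c1 n t + tcm c2 n t"
| "tcm (Ifp e c1 c2) n t = elen e + 2 + tcm c1 n t + tcm c2 n t"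
| "tcm (Fr x b c) n t = (if b = vN then n else t) * (tcm c n t + 7) + 6"
| "tcm (Rd x) n t = 1"
| "tcm (Wr e) n t = elen e + 1"

text \<open>Variables 0 and 1 hold the parameters and are read-only; they are the only admissible loop
  bounds, which makes the running time a syntactic function of the parameters.\<close>

fun wfc :: "cm \<Rightarrow> bool" where
  "wfc Skp \<longleftrightarrow> True"
| "wfc (Asg x e) \<longleftrightarrow> 2 \<le> x \<and> x < 44 \<and> wfe e 0"
| "wfc (ASt a i e) \<longleftrightarrow> a < 8 \<and> wfe e 0 \<and> wfe i 1"
| "wfc (Sq c1 c2) \<longleftrightarrow> wfc c1 \<and> wfc c2"
| "wfc (Ifp e c1 c2) \<longleftrightarrow> wfe e 0 \<and> wfc c1 \<and> wfc c2"
| "wfc (Fr x b c) \<longleftrightarrow> 2 \<le> x \<and> x < 44 \<and> b < 2 \<and> x \<notin> mods c \<and> wfc c"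
| "wfc (Rd x) \<longleftrightarrow> 2 \<le> x \<and> x < 44"
| "wfc (Wr e) \<longleftrightarrow> wfe e 0"

lemma length_ccm [simp]: "length (ccm c p) = clen c"
  by (induction c arbitrary: p) (simp_all add: length_adr)

lemma wfc_mods: "wfc c \<Longrightarrow> x < 2 \<Longrightarrow> x \<notin> mods c"
  by (induction c) auto

lemma wfc_va: "wfc c \<Longrightarrow> x < 2 \<Longrightarrow> va (sem c s) x = va s x"
  by (simp add: wfc_mods sem_va)

definition cf :: "nat \<Rightarrow> (nat \<Rightarrow> int) \<Rightarrow> st \<Rightarrow> conf" where
  "cf p m s = (p, m, drop (rdn s) (inp s), outp s)"

lemma RM_setv: "RM t s m \<Longrightarrow> x < 44 \<Longrightarrow> RM t (setv x v s) (m(20 + x := v))"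
  unfolding RM_def by auto

lemma RM_acc: "RM t s m \<Longrightarrow> RM t s (m(0 := v))"
  unfolding RM_def by auto

lemma rA_inj: "a < 8 \<Longrightarrow> b < 8 \<Longrightarrow> rA a j = rA b k \<longleftrightarrow> a = b \<and> j = k"
  by presburger

lemma RM_seta: "RM t s m \<Longrightarrow> a < 8 \<Longrightarrow> RM t (seta a j v s) (m(rA a j := v))"
  unfolding RM_def using rA_inj[of _ a _ j] by auto

lemma ix_le: "va s vT = int t \<Longrightarrow> ix s z \<le> t + 1"
proof -
  assume "va s vT = int t"
  moreover have "z mod (int t + 2) < int t + 2" by simp
  ultimately show ?thesis unfolding ix_def by (simp only:)
qed

definition sim :: "instr list \<Rightarrow> nat \<Rightarrow> nat \<Rightarrow> nat \<Rightarrow> nat \<Rightarrow> (nat \<Rightarrow> int) \<Rightarrow> st \<Rightarrow> nat \<Rightarrow> st \<Rightarrow> bool" where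
  "sim P B t k p m s p' s' \<longleftrightarrow> (\<exists>m'. go P B k (cf p m s) (cf p' m' s') \<and> RM t s' m')"

lemma simI:
  "go P B k (cf p m s) (cf q m' s'') \<Longrightarrow> RM t s'' m' \<Longrightarrow> k \<le> k' \<Longrightarrow> q = p' \<Longrightarrow> s'' = s'
    \<Longrightarrow> sim P B t k' p m s p' s'"
  unfolding sim_def by (metis go_mono)

lemma simE:
  assumes "sim P B t k p m s p' s'"
  obtains m' where "go P B k (cf p m s) (cf p' m' s')" "RM t s' m'"
  using assms unfolding sim_def by blast

lemma sim_ex:
  assumes "8 * t + 80 \<le> B" "va s vT = int t" "placed P p (cex e d p)" "wfe e d" "RM t s m"
  obtains m' where "go P B (elen e) (cf p m s) (cf (p + elen e) m' s)" "m' 0 = ev s e" "keep d m m'" "RM t s m'"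
proof -
  obtain m' where m': "go P B (elen e) (p, m, drop (rdn s) (inp s), outp s) (p + elen e, m', drop (rdn s) (inp s), outp s)"
    "m' 0 = ev s e" "keep d m m'"
    using cex_go[OF assms] by blast
  show ?thesis by (rule that[OF m'(1)[folded cf_def] m'(2,3) RM_keep[OF assms(5) m'(3)]])
qed

text \<open>The induction is over the number \<open>r\<close> of remaining rounds, so the state at
  the head of the loop is arbitrary.\<close>

lemma sim_loop:
  assumes B: "8 * t + 80 \<le> B"
    and pl: "placed P p [LOAD (Reg (rV b)), SUB (Reg (rV x)), JGTZ (p + 4), JUMP q]"
      "placed P (p + 4 + l) [LOAD (Reg (rV x)), ADD (Const 1), STORE (Reg (rV x)), JUMP p]"
    and xb: "x < 44" "b < 44" "x \<noteq> b" "x \<notin> mods c" "b \<notin> mods c"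
    and mono: "\<And>u. rdn u \<le> rdn (sem c u)"
    and body: "\<And>u m. RM t u m \<Longrightarrow> va u vN = va s vN \<Longrightarrow> va u vT = va s vT \<Longrightarrow> rdn (sem c u) \<le> length (inp u)
      \<Longrightarrow> sim P B t k (p + 4) m u (p + 4 + l) (sem c u)"
    and pres: "vN \<notin> insert x (mods c)" "vT \<notin> insert x (mods c)"
  shows "RM t u m \<Longrightarrow> va u vN = va s vN \<Longrightarrow> va u vT = va s vT \<Longrightarrow> va u b - va u x = int r \<Longrightarrow>
    rdn (((\<lambda>u. setv x (va u x + 1) (sem c u)) ^^ r) u) \<le> length (inp u) \<Longrightarrow>
    sim P B t (r * (k + 7) + 4) p m u q (((\<lambda>u. setv x (va u x + 1) (sem c u)) ^^ r) u)"
proof (induction r arbitrary: u m)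
  case 0
  have B0: "0 < B" "20 + b < B" "20 + x < B" using B xb by auto
  have mv: "m (20 + b) = va u b" "m (20 + x) = va u x" using 0(1) xb by (auto simp: RM_def)
  have "go P B 4 (p, m, drop (rdn u) (inp u), outp u) (q, m(0 := va u b, 0 := va u b - va u x), drop (rdn u) (inp u), outp u)"
    apply (rule cLOAD, use pl in simp, use pl in simp, simp, use B0 in simp, simp)
    apply (rule cSUB, use pl in simp, use pl in simp, simp, use B0 in simp, simp)
    apply (rule go_trans[OF go_JGTZ], use pl in simp, use pl in simp, use B0 in simp)
     apply (use mv xb 0 pl in \<open>simp add: fun_upd_def[symmetric]\<close>)
     apply (rule go_JUMP, simp, simp)
    by simp
  then show ?case
    unfolding cf_def[symmetric] by (rule simI) (use RM_acc[OF RM_acc[OF 0(1)]] in simp_all)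
next
  case (Suc r)
  let ?f = "\<lambda>u. setv x (va u x + 1) (sem c u)"
  have B0: "0 < B" "20 + b < B" "20 + x < B" using B xb by auto
  have mv: "m (20 + b) = va u b" "m (20 + x) = va u x" using Suc.prems(1) xb by (auto simp: RM_def)
  let ?m = "m(0 := va u b - va u x)"
  have g1: "go P B 3 (cf p m u) (cf (p + 4) ?m u)"
    unfolding cf_def
    apply (rule cLOAD, use pl in simp, use pl in simp, simp, use B0 in simp, simp)
    apply (rule cSUB, use pl in simp, use pl in simp, simp, use B0 in simp, simp)
    apply (rule go_trans[OF go_JGTZ], use pl in simp, use pl in simp, use B0 in simp)
     apply (use mv xb Suc.prems(4) in \<open>simp add: numeral_eq_Suc\<close>)
    by simp
  have fr: "?f ^^ Suc r = (?f ^^ r) \<circ> ?f" by (rule funpow_Suc_right)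
  have fs: "(?f ^^ Suc r) u = (?f ^^ r) (?f u)" unfolding fr by simp
  have "rdn (?f u) \<le> rdn ((?f ^^ r) (?f u))" by (rule funpow_rdn[OF mono])
  then have "rdn (sem c u) \<le> length (inp u)" using Suc.prems(5) unfolding fs by simp
  then obtain m2 where m2: "go P B k (cf (p + 4) ?m u) (cf (p + 4 + l) m2 (sem c u))" "RM t (sem c u) m2"
    using body[OF RM_acc[OF Suc.prems(1)] Suc.prems(2,3)] by (auto elim: simE)
  have max_rotation: "m2 (20 + x) = va u x" using m2(2) xb by (auto simp: RM_def sem_va)
  let ?m3 = "m2(0 := va u x, 0 := va u x + 1, 20 + x := va u x + 1)"
  have g2: "go P B 4 (cf (p + 4 + l) m2 (sem c u)) (cf p ?m3 (?f u))"
    unfolding cf_def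
    apply (rule cLOAD, use pl in simp, use pl in simp, simp, use B0 in simp, simp)
    apply (rule cADD, use pl in simp, use pl in simp, simp, use B0 in simp, simp)
    apply (rule cSTORE, use pl in simp, use pl in simp, simp, use B0 in simp, simp)
    apply (rule go_trans[OF go_JUMP], use pl in simp, use pl in simp)
     apply (use max_rotation xb in \<open>simp add: sem_va\<close>)
    by simp
  have RM3: "RM t (?f u) ?m3"
    using RM_setv[OF RM_acc[OF RM_acc[OF m2(2)]] xb(1)] xb by (simp add: sem_va)
  have "sim P B t (r * (k + 7) + 4) p ?m3 (?f u) q ((?f ^^ r) (?f u))"
  proof (rule Suc.IH[OF RM3])
    show "rdn ((?f ^^ r) (?f u)) \<le> length (inp (?f u))" using Suc.prems(5) unfolding fs by simp
  qed (use Suc.prems xb pres in \<open>auto simp: sem_va\<close>)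
  then obtain m4 where m4: "go P B (r * (k + 7) + 4) (cf p ?m3 (?f u)) (cf q m4 ((?f ^^ r) (?f u)))" "RM t ((?f ^^ r) (?f u)) m4"
    by (rule simE)
  have "go P B (3 + k + 4 + (r * (k + 7) + 4)) (cf p m u) (cf q m4 ((?f ^^ r) (?f u)))"
    by (rule go_trans[OF go_trans[OF go_trans[OF g1 m2(1) order_refl] g2 order_refl] m4(1) order_refl])
  then show ?case unfolding fs by (rule simI[OF _ m4(2)]) simp_all
qed

text \<open>The last hypothesis keeps every \<open>READ\<close> from getting stuck; since
  \<open>rdn\<close> never decreases, it is inherited by the parts of a command.\<close>

theorem ccm_sim:
  assumes "8 * t + 80 \<le> B"
  shows "wfc c \<Longrightarrow> placed P p (ccm c p) \<Longrightarrow> RM t s m \<Longrightarrow> va s vN = int n \<Longrightarrow> va s vT = int t \<Longrightarrow>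
    rdn (sem c s) \<le> length (inp s) \<Longrightarrow> sim P B t (tcm c n t) p m s (p + clen c) (sem c s)"
proof (induction c arbitrary: p s m)
  case Skp
  show ?case by (rule simI[OF go_refl[where k = 0] Skp(3)]) simp_all
next
  case (Asg x e)
  have pl: "placed P p (cex e 0 p)" "p + elen e < length P" "P ! (p + elen e) = STORE (Reg (20 + x))"
    using Asg.prems(2) by simp_all
  have w: "x < 44" "wfe e 0" using Asg.prems(1) by auto
  obtain m1 where m1: "go P B (elen e) (cf p m s) (cf (p + elen e) m1 s)" "m1 0 = ev s e" "RM t s m1"
    using sim_ex[OF assms Asg.prems(5) pl(1) w(2) Asg.prems(3)] .
  have "go P B 1 (cf (p + elen e) m1 s) (cf (Suc (p + elen e)) (m1(20 + x := m1 0)) (setv x (ev s e) s))"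
    unfolding cf_def setv_simps by (rule go_STORE) (use pl w assms in auto)
  from go_trans[OF m1(1) this order_refl] show ?case
    by (rule simI) (use RM_setv[OF m1(3) w(1)] m1(2) in simp_all)
next
  case (ASt a i e)
  let ?p1 = "p + elen e" let ?p2 = "Suc (p + elen e) + elen i" let ?p3 = "Suc (p + elen e) + elen i + 13"
  have pl: "placed P p (cex e 0 p)" "?p1 < length P" "P ! ?p1 = STORE (Reg 1)"
    "placed P (Suc ?p1) (cex i 1 (Suc ?p1))" "placed P ?p2 (adr a 1)"
    "?p3 < length P" "P ! ?p3 = LOAD (Reg 1)" "Suc ?p3 < length P" "P ! Suc ?p3 = STORE (Ind 2)"
    using ASt.prems(2) by (simp_all add: length_adr add.assoc)
  have w: "a < 8" "wfe e 0" "wfe i 1" using ASt.prems(1) by auto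
  obtain m1 where m1: "go P B (elen e) (cf p m s) (cf ?p1 m1 s)" "m1 0 = ev s e" "RM t s m1"
    using sim_ex[OF assms ASt.prems(5) pl(1) w(2) ASt.prems(3)] .
  let ?m1 = "m1(1 := ev s e)"
  have "go P B 1 (cf ?p1 m1 s) (cf (Suc ?p1) (m1(1 := m1 0)) s)"
    unfolding cf_def by (rule go_STORE) (use pl assms in auto)
  then have g1: "go P B 1 (cf ?p1 m1 s) (cf (Suc ?p1) ?m1 s)" unfolding m1(2) .
  have R1: "RM t s ?m1" using m1(3) by (auto simp: RM_def)
  obtain m2 where m2: "go P B (elen i) (cf (Suc ?p1) ?m1 s) (cf ?p2 m2 s)" "m2 0 = ev s i" "keep 1 ?m1 m2" "RM t s m2"
    using sim_ex[OF assms ASt.prems(5) pl(4) w(3) R1] .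
  define j where "j = ix s (ev s i)"
  have jt: "j \<le> t + 1" unfolding j_def by (rule ix_le[OF ASt.prems(5)])
  have "m2 (rV vT) = va s vT" using m2(4) unfolding RM_def by (elim conjE allE[of _ vT]) simp
  then have m21: "m2 21 = int t" using ASt.prems(5) by simp
  obtain m3 where m3: "go P B 13 (cf ?p2 m2 s) (cf ?p3 m3 s)" "m3 (Suc 1) = int (rA a j)" "keep 1 m2 m3"
    using adr_go[where m = m2, OF pl(5) _ w(1) m21 assms] unfolding j_def ix_def ASt.prems(5) m2(2) cf_def by auto
  have m31: "m3 1 = ev s e" using m2(3) m3(3) by (simp add: keep_def)
  have nm: "nat (m3 2) = rA a j" "0 \<le> m3 2"
    using m3(2) by (simp_all add: numeral_2_eq_2 del: of_nat_add of_nat_mult)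
  have jB: "rA a j < B" using jt w(1) assms by linarith
  let ?m4 = "m3(0 := ev s e)"
  have "go P B 1 (cf ?p3 m3 s) (cf (Suc ?p3) (m3(0 := m3 1)) s)"
    unfolding cf_def by (rule go_LOAD) (use pl assms in auto)
  then have g4: "go P B 1 (cf ?p3 m3 s) (cf (Suc ?p3) ?m4 s)" unfolding m31 .
  have "go P B 1 (cf (Suc ?p3) ?m4 s) (cf (Suc (Suc ?p3)) (?m4(rA a j := ?m4 0)) (seta a j (ev s e) s))"
    unfolding cf_def seta_simps by (rule go_STORE) (use pl assms nm jB in auto)
  then have g5: "go P B 1 (cf (Suc ?p3) ?m4 s) (cf (Suc (Suc ?p3)) (?m4(rA a j := ev s e)) (seta a j (ev s e) s))"
    by simp
  have R5: "RM t (seta a j (ev s e) s) (?m4(rA a j := ev s e))"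
    by (rule RM_seta[OF RM_acc[OF RM_keep[OF m2(4) m3(3)]] w(1)])
  from go_trans[OF go_trans[OF go_trans[OF go_trans[OF go_trans[OF m1(1) g1 order_refl] m2(1) order_refl] m3(1) order_refl] g4 order_refl] g5 order_refl]
  show ?case by (rule simI) (use R5 in \<open>simp_all add: j_def\<close>)
next
  case (Sq c1 c2)
  have pl: "placed P p (ccm c1 p)" "placed P (p + clen c1) (ccm c2 (p + clen c1))"
    using Sq.prems(2) by simp_all
  have w: "wfc c1" "wfc c2" using Sq.prems(1) by auto
  have rd: "rdn (sem c1 s) \<le> length (inp s)" "rdn (sem c2 (sem c1 s)) \<le> length (inp (sem c1 s))"
    using Sq.prems(6) sem_rdn[of "sem c1 s" c2] by simp_all
  obtain m1 where m1: "go P B (tcm c1 n t) (cf p m s) (cf (p + clen c1) m1 (sem c1 s))" "RM t (sem c1 s) m1"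
    using Sq.IH(1)[OF w(1) pl(1) Sq.prems(3-5) rd(1)] by (rule simE)
  have v: "va (sem c1 s) vN = int n" "va (sem c1 s) vT = int t" using wfc_va[OF w(1)] Sq.prems(4,5) by simp_all
  obtain m2 where m2: "go P B (tcm c2 n t) (cf (p + clen c1) m1 (sem c1 s)) (cf (p + clen c1 + clen c2) m2 (sem c2 (sem c1 s)))"
    "RM t (sem c2 (sem c1 s)) m2"
    using Sq.IH(2)[OF w(2) pl(2) m1(2) v rd(2)] by (rule simE)
  from go_trans[OF m1(1) m2(1) order_refl] show ?case
    by (rule simI) (use m2(2) in simp_all)
next
  case (Ifp e c1 c2)
  let ?p1 = "p + elen e" let ?p2 = "Suc (p + elen e)" let ?p3 = "Suc (p + elen e) + clen c2"
  have pl: "placed P p (cex e 0 p)" "?p1 < length P" "P ! ?p1 = JGTZ (Suc ?p3)"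
    "placed P ?p2 (ccm c2 ?p2)" "?p3 < length P" "P ! ?p3 = JUMP (Suc ?p3 + clen c1)" "placed P (Suc ?p3) (ccm c1 (Suc ?p3))"
    using Ifp.prems(2) by (simp_all add: add.assoc)
  have w: "wfe e 0" "wfc c1" "wfc c2" using Ifp.prems(1) by auto
  obtain m1 where m1: "go P B (elen e) (cf p m s) (cf ?p1 m1 s)" "m1 0 = ev s e" "RM t s m1"
    using sim_ex[OF assms Ifp.prems(5) pl(1) w(1) Ifp.prems(3)] .
  have g1: "go P B 1 (cf ?p1 m1 s) (cf (if 0 < ev s e then Suc ?p3 else Suc ?p1) m1 s)"
    using go_JGTZ[OF pl(2,3), of B m1] assms unfolding cf_def m1(2) by simp
  show ?case
  proof (cases "0 < ev s e")
    case True
    obtain m2 where m2: "go P B (tcm c1 n t) (cf (Suc ?p3) m1 s) (cf (Suc ?p3 + clen c1) m2 (sem c1 s))" "RM t (sem c1 s) m2"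
      using Ifp.IH(1)[OF w(2) pl(7) m1(3) Ifp.prems(4,5)] Ifp.prems(6) True by (auto elim: simE)
    have "go P B 1 (cf ?p1 m1 s) (cf (Suc ?p3) m1 s)" using g1 True by simp
    from go_trans[OF go_trans[OF m1(1) this order_refl] m2(1) order_refl] show ?thesis
      by (rule simI) (use m2(2) True in simp_all)
  next
    case False
    obtain m2 where m2: "go P B (tcm c2 n t) (cf ?p2 m1 s) (cf ?p3 m2 (sem c2 s))" "RM t (sem c2 s) m2"
      using Ifp.IH(2)[OF w(3) pl(4) m1(3) Ifp.prems(4,5)] Ifp.prems(6) False by (auto elim: simE)
    have g2: "go P B 1 (cf ?p1 m1 s) (cf ?p2 m1 s)" using g1 False by simp
    have g3: "go P B 1 (cf ?p3 m2 (sem c2 s)) (cf (Suc ?p3 + clen c1) m2 (sem c2 s))"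
      unfolding cf_def by (rule go_JUMP[OF pl(5,6)])
    from go_trans[OF go_trans[OF go_trans[OF m1(1) g2 order_refl] m2(1) order_refl] g3 order_refl] show ?thesis
      by (rule simI) (use m2(2) False in simp_all)
  qed
next
  case (Fr x b c)
  let ?f = "\<lambda>u. setv x (va u x + 1) (sem c u)"
  let ?r = "nat (va s b)" let ?s0 = "setv x 0 s"
  have w: "2 \<le> x" "x < 44" "b < 2" "x \<notin> mods c" "wfc c" using Fr.prems(1) by auto
  have pl: "placed P p [LOAD (Const 0), STORE (Reg (20 + x))]"
    "placed P (p + 2) [LOAD (Reg (20 + b)), SUB (Reg (20 + x)), JGTZ (p + 2 + 4), JUMP (p + clen c + 10)]"
    "placed P (p + 2 + 4) (ccm c (p + 2 + 4))"
    "placed P (p + 2 + 4 + clen c) [LOAD (Reg (20 + x)), ADD (Const 1), STORE (Reg (20 + x)), JUMP (p + 2)]"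
    using Fr.prems(2) by (simp_all add: add.assoc numeral_eq_Suc)
  have g1: "go P B 2 (cf p m s) (cf (p + 2) (m(0 := 0, 20 + x := 0)) ?s0)"
    unfolding cf_def setv_simps
    apply (rule cLOAD, use pl in simp, use pl in simp, simp, use assms in simp, simp)
    apply (rule cSTORE, use pl in simp, use pl in simp, simp, use assms w in simp, simp)
    by simp
  have R0: "RM t ?s0 (m(0 := 0, 20 + x := 0))" by (rule RM_setv[OF RM_acc[OF Fr.prems(3)] w(2)])
  have "b = vN \<or> b = vT" using w(3) by auto
  then have vb: "va s b = int (if b = vN then n else t)" using Fr.prems(4,5) by (elim disjE) simp_all
  have body: "sim P B t (tcm c n t) (p + 2 + 4) m' u (p + 2 + 4 + clen c) (sem c u)"
    if "RM t u m'" "va u vN = va s vN" "va u vT = va s vT" "rdn (sem c u) \<le> length (inp u)" for u m'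
    by (rule Fr.IH[OF w(5) pl(3)]) (use that Fr.prems in simp_all)
  have "sim P B t (?r * (tcm c n t + 7) + 4) (p + 2) (m(0 := 0, 20 + x := 0)) ?s0 (p + clen c + 10) ((?f ^^ ?r) ?s0)"
  proof (rule sim_loop[OF assms pl(2,4) w(2) _ _ w(4) _ sem_rdn body])
    show "b \<notin> mods c" using wfc_mods[OF w(5) w(3)] .
    show "rdn ((?f ^^ ?r) ?s0) \<le> length (inp ?s0)" using Fr.prems(6) by simp
    show "va ?s0 b - va ?s0 x = int ?r" using w vb by auto
  qed (use w R0 wfc_mods[OF w(5)] in auto)
  then obtain m2 where m2: "go P B (?r * (tcm c n t + 7) + 4) (cf (p + 2) (m(0 := 0, 20 + x := 0)) ?s0)
      (cf (p + clen c + 10) m2 ((?f ^^ ?r) ?s0))" "RM t ((?f ^^ ?r) ?s0) m2"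
    by (rule simE)
  from go_trans[OF g1 m2(1) order_refl] show ?case
    by (rule simI) (use m2(2) vb in simp_all)
next
  case (Rd x)
  have w: "x < 44" and pl: "p < length P" "P ! p = READ (Reg (20 + x))" using Rd.prems by simp_all
  have l: "rdn s < length (inp s)" using Rd.prems(6) by simp
  have d: "drop (rdn s) (inp s) = inp s ! rdn s # drop (Suc (rdn s)) (inp s)"
    using Cons_nth_drop_Suc[OF l] by simp
  have "go P B 1 (cf p m s) (cf (Suc p) (m(20 + x := inp s ! rdn s)) (sem (Rd x) s))"
    unfolding cf_def d sem.simps by simp (rule go_READ[unfolded One_nat_def], use pl w assms in auto)
  then show ?case
  proof (rule simI)
    show "RM t (sem (Rd x) s) (m(20 + x := inp s ! rdn s))"
      using RM_setv[OF Rd.prems(3) w, of "inp s ! rdn s"] by (simp add: RM_def)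
  qed simp_all
next
  case (Wr e)
  have pl: "placed P p (cex e 0 p)" "p + elen e < length P" "P ! (p + elen e) = WRITE (Reg 0)"
    using Wr.prems(2) by simp_all
  have w: "wfe e 0" using Wr.prems(1) by auto
  obtain m1 where m1: "go P B (elen e) (cf p m s) (cf (p + elen e) m1 s)" "m1 0 = ev s e" "RM t s m1"
    using sim_ex[OF assms Wr.prems(5) pl(1) w Wr.prems(3)] .
  have "go P B 1 (cf (p + elen e) m1 s) (cf (Suc (p + elen e)) m1 (sem (Wr e) s))"
    unfolding cf_def sem.simps by simp (rule go_WRITE[unfolded One_nat_def], use pl m1(2) assms in auto)
  from go_trans[OF m1(1) this order_refl] show ?case
    by (rule simI) (use m1(3) in \<open>simp_all add: RM_def\<close>)
qed

definition init :: "nat \<Rightarrow> nat \<Rightarrow> int list \<Rightarrow> st" where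
  "init n t xs = \<lparr>va = (\<lambda>_. 0)(vN := int n, vT := int t), ar = (\<lambda>_ _. 0), inp = xs, rdn = 0, outp = []\<rparr>"

text \<open>The two parameters are read before the compiled command starts, because well-formed
  commands may not assign to variables 0 and 1.\<close>

definition prog :: "cm \<Rightarrow> instr list" where
  "prog c = [READ (Reg (rV vN)), READ (Reg (rV vT))] @ ccm c 2 @ [HALT]"

text \<open>The summand 3 counts two reads and the final \<open>HALT\<close>. The last cell of the
  last array has address \<open>64 + 8 * (t + 1) + 7\<close>, one below the space bound.\<close>

theorem prog_computes:
  assumes "wfc c" "rdn (sem c (init n t xs)) \<le> length xs"
  shows "ram_computes (prog c) (int n # int t # xs) (outp (sem c (init n t xs))) (tcm c n t + 3) (8 * t + 80)"
proof -
  let ?P = "prog c" and ?B = "8 * t + 80" and ?s = "init n t xs"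
  let ?m = "(\<lambda>_. 0)(20 := int n, 21 := int t)"
  have pl: "placed ?P 0 ([READ (Reg 20), READ (Reg 21)] @ ccm c 2 @ [HALT])"
    unfolding placed_def prog_def by simp
  have pc: "placed ?P 2 (ccm c 2)" "2 + clen c < length ?P" "?P ! (2 + clen c) = HALT"
    using pl unfolding placed_append by (simp_all add: numeral_eq_Suc)
  have p0: "0 < length ?P" "?P ! 0 = READ (Reg 20)" "Suc 0 < length ?P" "?P ! Suc 0 = READ (Reg 21)"
    using pl by simp_all
  have "go ?P ?B 1 (0, \<lambda>_. 0, int n # int t # xs, []) (Suc 0, (\<lambda>_. 0)(20 := int n), int t # xs, [])"
    by (rule go_READ) (use p0 in auto)
  moreover have "go ?P ?B 1 (Suc 0, (\<lambda>_. 0)(20 := int n), int t # xs, []) (Suc (Suc 0), ?m, xs, [])"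
    by (rule go_READ) (use p0 in auto)
  ultimately have "go ?P ?B (1 + 1) (0, \<lambda>_. 0, int n # int t # xs, []) (Suc (Suc 0), ?m, xs, [])"
    by (rule go_trans) simp
  then have g1: "go ?P ?B 2 (0, \<lambda>_. 0, int n # int t # xs, []) (cf 2 ?m ?s)"
    by (simp add: cf_def init_def numeral_eq_Suc)
  have "sim ?P ?B t (tcm c n t) 2 ?m ?s (2 + clen c) (sem c ?s)"
    by (rule ccm_sim[OF order_refl assms(1) pc(1)]) (use assms(2) in \<open>auto simp: RM_def init_def\<close>)
  then obtain m' where "go ?P ?B (tcm c n t) (cf 2 ?m ?s) (cf (2 + clen c) m' (sem c ?s))" by (rule simE)
  then have "go ?P ?B (tcm c n t + 2) (0, \<lambda>_. 0, int n # int t # xs, []) (cf (2 + clen c) m' (sem c ?s))"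
    by (rule go_trans[OF g1]) simp
  then obtain u k where u: "u \<subseteq> {..<?B}" "k \<le> tcm c n t + 2"
    "(cfg (0, \<lambda>_. 0, int n # int t # xs, []) {}, cfg (cf (2 + clen c) m' (sem c ?s)) u) \<in> ram_step ?P ^^ k"
    unfolding go_def by (metis empty_subsetI)
  have "card u \<le> ?B" using card_mono[OF _ u(1)] by simp
  then show ?thesis
    unfolding ram_computes_def
    by (intro exI[of _ k] exI[of _ "cfg (cf (2 + clen c) m' (sem c ?s)) u"])
      (use u pc in \<open>auto simp: ram_init_def cf_def\<close>)
qed

text \<open>The degrees in the two parameters are maximised separately, so one monomial bounds the
  whole program; counting, of cost \<open>t ^ 3 + n * t\<close>, is bounded by
  \<open>n * t ^ 3\<close> in this way.\<close>

fun dgN :: "cm \<Rightarrow> nat" where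
  "dgN (Sq c1 c2) = max (dgN c1) (dgN c2)"
| "dgN (Ifp e c1 c2) = max (dgN c1) (dgN c2)"
| "dgN (Fr x b c) = dgN c + (if b = vN then 1 else 0)"
| "dgN _ = 0"

fun dgT :: "cm \<Rightarrow> nat" where
  "dgT (Sq c1 c2) = max (dgT c1) (dgT c2)"
| "dgT (Ifp e c1 c2) = max (dgT c1) (dgT c2)"
| "dgT (Fr x b c) = dgT c + (if b = vN then 0 else 1)"
| "dgT _ = 0"

lemma tcm_const: "(\<And>n t. tcm c n t = k) \<Longrightarrow> \<exists>K. \<forall>n t. 1 \<le> n \<longrightarrow> 1 \<le> t \<longrightarrow> tcm c n t \<le> K * (n ^ a * t ^ b)"
  by (rule exI[of _ k]) simp

lemma monomial_mono:
  "1 \<le> n \<Longrightarrow> 1 \<le> t \<Longrightarrow> a \<le> a' \<Longrightarrow> b \<le> b' \<Longrightarrow> n ^ a * t ^ b \<le> n ^ a' * (t::nat) ^ b'"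
  by (intro mult_le_mono power_increasing)

lemma tcm_bound: "\<exists>K. \<forall>n t. 1 \<le> n \<longrightarrow> 1 \<le> t \<longrightarrow> tcm c n t \<le> K * (n ^ dgN c * t ^ dgT c)"
proof (induction c)
  case (Sq c1 c2)
  then obtain K1 K2 where K: "\<And>n t. 1 \<le> n \<Longrightarrow> 1 \<le> t \<Longrightarrow> tcm c1 n t \<le> K1 * (n ^ dgN c1 * t ^ dgT c1)"
    "\<And>n t. 1 \<le> n \<Longrightarrow> 1 \<le> t \<Longrightarrow> tcm c2 n t \<le> K2 * (n ^ dgN c2 * t ^ dgT c2)" by blast
  have "tcm (Sq c1 c2) n t \<le> (K1 + K2) * (n ^ dgN (Sq c1 c2) * t ^ dgT (Sq c1 c2))"
    if nt: "1 \<le> n" "1 \<le> t" for n t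
  proof -
    let ?M = "n ^ dgN (Sq c1 c2) * t ^ dgT (Sq c1 c2)"
    have "tcm c1 n t \<le> K1 * ?M"
      by (rule order_trans[OF K(1)[OF nt] mult_le_mono2[OF monomial_mono[OF nt]]]) simp_all
    moreover have "tcm c2 n t \<le> K2 * ?M"
      by (rule order_trans[OF K(2)[OF nt] mult_le_mono2[OF monomial_mono[OF nt]]]) simp_all
    ultimately show ?thesis unfolding add_mult_distrib tcm.simps by (rule add_mono)
  qed
  then show ?case by blast
next
  case (Ifp e c1 c2)
  then obtain K1 K2 where K: "\<And>n t. 1 \<le> n \<Longrightarrow> 1 \<le> t \<Longrightarrow> tcm c1 n t \<le> K1 * (n ^ dgN c1 * t ^ dgT c1)"
    "\<And>n t. 1 \<le> n \<Longrightarrow> 1 \<le> t \<Longrightarrow> tcm c2 n t \<le> K2 * (n ^ dgN c2 * t ^ dgT c2)" by blast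
  have "tcm (Ifp e c1 c2) n t \<le> (elen e + 2 + K1 + K2) * (n ^ dgN (Ifp e c1 c2) * t ^ dgT (Ifp e c1 c2))"
    if nt: "1 \<le> n" "1 \<le> t" for n t
  proof -
    let ?M = "n ^ dgN (Ifp e c1 c2) * t ^ dgT (Ifp e c1 c2)"
    have "tcm c1 n t \<le> K1 * ?M"
      by (rule order_trans[OF K(1)[OF nt] mult_le_mono2[OF monomial_mono[OF nt]]]) simp_all
    moreover have "tcm c2 n t \<le> K2 * ?M"
      by (rule order_trans[OF K(2)[OF nt] mult_le_mono2[OF monomial_mono[OF nt]]]) simp_all
    moreover have "1 \<le> ?M" using nt by (simp add: Suc_le_eq)
    then have "elen e + 2 \<le> (elen e + 2) * ?M" using mult_le_mono2[of 1 ?M "elen e + 2"] by simp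
    ultimately show ?thesis unfolding add_mult_distrib tcm.simps by linarith
  qed
  then show ?case by blast
next
  case (Fr x b c)
  then obtain K where K: "\<And>n t. 1 \<le> n \<Longrightarrow> 1 \<le> t \<Longrightarrow> tcm c n t \<le> K * (n ^ dgN c * t ^ dgT c)" by blast
  have "tcm (Fr x b c) n t \<le> (K + 13) * (n ^ dgN (Fr x b c) * t ^ dgT (Fr x b c))"
    if nt: "1 \<le> n" "1 \<le> t" for n t
  proof -
    let ?m = "n ^ dgN c * t ^ dgT c" and ?r = "if b = 0 then n else t"
    have M: "n ^ dgN (Fr x b c) * t ^ dgT (Fr x b c) = ?r * ?m" by simp
    have m1: "1 \<le> ?m" using nt by (simp add: Suc_le_eq)
    have r1: "1 \<le> ?r" using nt by simp
    have "tcm c n t + 7 \<le> (K + 7) * ?m" unfolding add_mult_distrib using K[OF nt] m1 by linarith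
    then have "?r * (tcm c n t + 7) \<le> ?r * ((K + 7) * ?m)" by (rule mult_le_mono2)
    moreover have "1 \<le> ?r * ?m" using mult_le_mono[OF r1 m1] by simp
    moreover have "(K + 13) * (?r * ?m) = ?r * ((K + 7) * ?m) + 6 * (?r * ?m)" by (simp add: algebra_simps)
    ultimately show ?thesis unfolding M tcm.simps by linarith
  qed
  then show ?case by blast
qed (rule tcm_const, simp)+

lemma ram_solvable_prog:
  assumes "wfc c"
    and "\<And>n t x y. 1 \<le> t \<Longrightarrow> t \<le> n \<Longrightarrow> (x, y) \<in> problem n t \<Longrightarrow>
      \<exists>xs. x = int n # int t # xs \<and> rdn (sem c (init n t xs)) \<le> length xs \<and> outp (sem c (init n t xs)) = y"
    and "\<And>n t. 3 \<le> n \<Longrightarrow> 1 \<le> t \<Longrightarrow> t \<le> n \<Longrightarrow> real n ^ dgN c * real t ^ dgT c \<le> f (n, t)"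
    and "\<And>n t. 1 \<le> t \<Longrightarrow> t \<le> n \<Longrightarrow> real t \<le> g (n, t)"
  shows "ram_solvable problem f g"
proof -
  obtain K where K: "\<And>n t. 1 \<le> n \<Longrightarrow> 1 \<le> t \<Longrightarrow> tcm c n t \<le> K * (n ^ dgN c * t ^ dgT c)"
    using tcm_bound[of c] by blast
  let ?T = "\<lambda>(n, t). tcm c n t + 3" and ?S = "\<lambda>(n, t). 8 * t + 80"
  have ev: "eventually (\<lambda>(n, t). 3 \<le> n \<and> 1 \<le> t \<and> t \<le> n) params"
    unfolding params_def eventually_inf_principal eventually_filtercomap
    by (rule exI[of _ "\<lambda>n. 3 \<le> n"]) (auto intro: eventually_ge_at_top)
  have "(\<lambda>p. real (?T p)) \<in> O[params](f)"
  proof (rule bigoI[where c = "real K + 3"], rule eventually_mono[OF ev], clarsimp)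
    fix n t :: nat assume nt: "3 \<le> n" "Suc 0 \<le> t" "t \<le> n"
    let ?M = "n ^ dgN c * t ^ dgT c"
    have M1: "1 \<le> ?M" using nt by (simp add: Suc_le_eq)
    have "tcm c n t \<le> K * ?M" using K[of n t] nt by simp
    then have "tcm c n t + 3 \<le> (K + 3) * ?M" unfolding add_mult_distrib using M1 by linarith
    then have "real (tcm c n t + 3) \<le> real ((K + 3) * ?M)" by (rule of_nat_mono)
    also have "\<dots> = (real K + 3) * (real n ^ dgN c * real t ^ dgT c)" by simp
    also have "\<dots> \<le> (real K + 3) * f (n, t)"
      using assms(3)[of n t] nt by (intro mult_left_mono) auto
    also have "\<dots> \<le> (real K + 3) * \<bar>f (n, t)\<bar>" by (intro mult_left_mono) auto
    finally show "real (tcm c n t) + 3 \<le> (real K + 3) * \<bar>f (n, t)\<bar>" by simp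
  qed
  moreover have "(\<lambda>p. real (?S p)) \<in> O[params](g)"
  proof (rule bigoI[where c = 88], rule eventually_mono[OF ev], clarsimp)
    fix n t :: nat assume nt: "3 \<le> n" "Suc 0 \<le> t" "t \<le> n"
    then show "8 * real t + 80 \<le> 88 * \<bar>g (n, t)\<bar>" using assms(4)[of t n] by simp
  qed
  moreover have "ram_computes (prog c) x y (?T (n, t)) (?S (n, t))"
    if "1 \<le> t" "t \<le> n" "(x, y) \<in> problem n t" for n t x y
    using assms(2)[OF that] prog_computes[OF assms(1)] by fastforce
  ultimately show ?thesis unfolding ram_solvable_def
    by (intro exI[of _ "prog c"] exI[of _ ?T] exI[of _ ?S]) auto
qed

section \<open>Counting program\<close>

text \<open>Loops are to be treated by \<open>Fr_invariant\<close> and not by unfolding.\<close>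

declare sem.simps(6) [simp del]

notation Sq (infixr ";;" 60)

abbreviation (input) "vX \<equiv> (2::nat)"
abbreviation (input) "vXN \<equiv> (3::nat)"
abbreviation (input) "vj \<equiv> (4::nat)"
abbreviation (input) "vi \<equiv> (5::nat)"
abbreviation (input) "vP \<equiv> (6::nat)"
abbreviation (input) "vacc \<equiv> (7::nat)"
abbreviation (input) "vq \<equiv> (8::nat)"
abbreviation (input) "vl \<equiv> (9::nat)"
abbreviation (input) "vf \<equiv> (10::nat)"
abbreviation (input) "vM \<equiv> (11::nat)"
abbreviation (input) "vR \<equiv> (12::nat)"
abbreviation (input) "aZ \<equiv> (0::nat)"
abbreviation (input) "aE \<equiv> Suc 0"
abbreviation (input) "cT \<equiv> Suc 0"
abbreviation (input) "aF \<equiv> (2::nat)"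

definition Md :: "ex \<Rightarrow> ex \<Rightarrow> ex" where
  "Md e f = Mi e (Ti (Dv e f) f)"

lemma ev_Md [simp]: "ev s (Md e f) = ev s e mod ev s f"
  by (simp add: Md_def minus_div_mult_eq_mod)

lemma ix_eq: "va s cT = int t \<Longrightarrow> 0 \<le> z \<Longrightarrow> z \<le> int t + 1 \<Longrightarrow> ix s z = nat z"
  by (simp add: ix_def)

definition has_params :: "nat \<Rightarrow> nat \<Rightarrow> st \<Rightarrow> bool" where
  "has_params n t s \<longleftrightarrow> va s vN = int n \<and> va s cT = int t"

definition holds :: "nat \<Rightarrow> nat list \<Rightarrow> st \<Rightarrow> bool" where
  "holds a z s \<longleftrightarrow> (\<forall>j<length z. ar s a j = int (z ! j))"

lemma has_params_sem: "wfc c \<Longrightarrow> has_params n t s \<Longrightarrow> has_params n t (sem c s)"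
  by (simp add: has_params_def wfc_va)

lemma has_params_setv: "has_params n t s \<Longrightarrow> 2 \<le> x \<Longrightarrow> has_params n t (setv x v s)"
  by (auto simp: has_params_def)

lemma holds_sem: "a \<notin> amods c \<Longrightarrow> holds a z s \<Longrightarrow> holds a z (sem c s)"
  by (simp add: holds_def sem_ar)

text \<open>\<open>vXN\<close> starts at \<open>X\<close>, so that \<open>n\<close> rounds produce
  the exponent \<open>n + 1\<close> of the modulus.\<close>

definition count_init :: cm where
  "count_init = Asg vX (Cn 1) ;; Fr vj cT (Asg vX (Ti (Vr vX) (Vr vN))) ;; Asg vX (Pl (Vr vX) (Cn 2)) ;;
     Asg vXN (Vr vX) ;; Fr vi vN (Asg vXN (Ti (Vr vXN) (Vr vX)))"

text \<open>Only \<open>n\<close> and \<open>t\<close> are admissible loop bounds, so a power with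
  exponent \<open>z ! j\<close> takes \<open>n\<close> rounds of which the first
  \<open>z ! j\<close> multiply.\<close>

definition count_pow_inner :: cm where
  "count_pow_inner = Fr vi vN (Ifp (Mi (Ar aZ (Vr vj)) (Vr vi)) (Asg vP (Ti (Vr vP) (Vr vX))) Skp)"

definition count_pow :: cm where
  "count_pow = Fr vj cT (Asg vP (Cn 1) ;; count_pow_inner ;; ASt aE (Vr vj) (Vr vP))"

text \<open>One step of the recursion of \<open>run_gf\<close>, performed in place. In increasing
  order of \<open>j\<close> the entry at \<open>j + 1\<close> is still the old one; the old entry at
  0 is saved in \<open>vf\<close> and copied behind the table, where it serves as the successor of
  the last state.\<close>

definition count_step :: cm where
  "count_step = Asg vf (Ar aF (Cn 0)) ;; ASt aF (Vr vM) (Vr vf) ;;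
     Fr vj cT (Ifp (Mi (Vr vM) (Vr vj))
       (ASt aF (Vr vj) (Pl (Ti (Dv (Mi (Ar aE (Vr vj)) (Vr vX)) (Mi (Vr vX) (Cn 1))) (Vr vf))
         (Ti (Ar aE (Vr vj)) (Ar aF (Pl (Vr vj) (Cn 1)))))) Skp)"

text \<open>The closed walks at one state \<open>vq\<close>: the table starts as the indicator of
  \<open>vq\<close>, as in \<open>run_gf\<close> for the empty word, and undergoes \<open>t\<close>
  steps.\<close>

definition count_state :: cm where
  "count_state = Fr vj cT (ASt aF (Vr vj) (Cn 0)) ;; ASt aF (Vr vq) (Cn 1) ;; Fr vl cT count_step ;;
     Asg vacc (Pl (Vr vacc) (Ar aF (Vr vq)))"

definition count :: cm where
  "count = count_init ;; count_pow ;; Asg vacc (Cn 0) ;; Fr vq cT (Ifp (Mi (Vr vM) (Vr vq)) count_state Skp) ;;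
     Asg vR (Md (Vr vacc) (Vr vXN)) ;; Asg vR (Md (Vr vR) (Mi (Vr vX) (Cn 1)))"

lemmas count_defs = count_init_def count_pow_inner_def count_pow_def count_step_def count_state_def count_def Md_def

lemma wfc_count: "wfc count_init" "wfc count_pow_inner" "wfc count_pow" "wfc count_step" "wfc count_state" "wfc count"
  by (simp_all add: count_defs)

lemma mods_count_init: "mods count_init = {2, 3, 4, 5}" "amods count_init = {}"
  by (auto simp: count_defs)

lemma mods_count_pow_inner: "mods count_pow_inner = {5, 6}" "amods count_pow_inner = {}"
  by (auto simp: count_defs)

lemma mods_count_pow: "mods count_pow = {4, 5, 6}" "amods count_pow = {aE}"
  by (auto simp: count_defs)

lemma mods_count_step: "mods count_step = {4, 10}" "amods count_step = {aF}"
  by (auto simp: count_defs)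

lemma mods_count_state: "mods count_state = {4, 7, 9, 10}" "amods count_state = {aF}"
  by (auto simp: count_defs)

lemma mods_count: "mods count = {2, 3, 4, 5, 6, 7, 8, 9, 10, 12}" "amods count = {aE, aF}" "pure count"
  by (auto simp: count_defs)

lemmas mods_counts = mods_count_init mods_count_pow_inner mods_count_pow mods_count_step mods_count_state mods_count

lemma count_init_spec:
  assumes "has_params n t s"
  shows "va (sem count_init s) vX = int n ^ t + 2" "va (sem count_init s) vXN = (int n ^ t + 2) ^ Suc n"
proof -
  let ?c1 = "Fr vj cT (Asg vX (Ti (Vr vX) (Vr vN)))" and ?c2 = "Fr vi vN (Asg vXN (Ti (Vr vXN) (Vr vX)))"
  define s1 where "s1 = setv vX 1 s"
  define s2 where "s2 = sem ?c1 s1"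
  define s3 where "s3 = setv vXN (va s2 vX + 2) (setv vX (va s2 vX + 2) s2)"
  have p1: "va s1 cT = int t" "va s1 vN = int n" "va s1 vX = 1" using assms by (simp_all add: s1_def has_params_def)
  have X: "va s2 vX = int n ^ t" unfolding s2_def
    by (rule Fr_invariant[where k = t and I = "\<lambda>i u. va u vX = int n ^ i"]) (use p1 in \<open>simp_all add: mult.commute\<close>)
  have p2: "va s2 cT = int t" "va s2 vN = int n" unfolding s2_def using p1 by (simp_all add: sem_va)
  have p3: "va s3 vX = int n ^ t + 2" "va s3 vXN = int n ^ t + 2" "va s3 vN = int n"
    unfolding s3_def using X p2 by simp_all
  have XN: "va (sem ?c2 s3) vXN = (int n ^ t + 2) ^ Suc n"
    by (rule Fr_invariant[where k = n and I = "\<lambda>i u. va u vXN = (int n ^ t + 2) ^ Suc i"])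
      (use p3 in \<open>simp_all add: mult.commute\<close>)
  have e: "sem count_init s = sem ?c2 s3" by (simp add: count_init_def s3_def s2_def s1_def)
  show "va (sem count_init s) vXN = (int n ^ t + 2) ^ Suc n" unfolding e by (rule XN)
  show "va (sem count_init s) vX = int n ^ t + 2" unfolding e using p3 by (simp add: sem_va)
qed

lemma count_pow_inner_spec:
  assumes "has_params n t s" "va s vj = int j" "j < t" "ar s aZ j = int c" "c \<le> n" "va s vP = 1"
  shows "va (sem count_pow_inner s) vP = va s vX ^ c"
proof -
  have "va (sem count_pow_inner s) vP = va s vX ^ (min n c)"
    unfolding count_pow_inner_def
  proof (rule Fr_invariant[where k = n and I = "\<lambda>i u. va u vP = va s vX ^ (min i c)"])
    fix i :: nat and u :: st assume a: "i < n" "va u vi = int i" "va u vP = va s vX ^ min i c"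
      and fr: "\<And>y. y \<noteq> vi \<Longrightarrow> y \<notin> mods (Ifp (Mi (Ar aZ (Vr vj)) (Vr vi)) (Asg vP (Ti (Vr vP) (Vr vX))) Skp) \<Longrightarrow> va u y = va s y"
      and fa: "\<And>b. b \<notin> amods (Ifp (Mi (Ar aZ (Vr vj)) (Vr vi)) (Asg vP (Ti (Vr vP) (Vr vX))) Skp) \<Longrightarrow> ar u b = ar s b"
    have v: "va u vX = va s vX" "va u vj = int j" "va u cT = int t" "ar u aZ = ar s aZ"
      using fr[of vX] fr[of vj] fr[of cT] fa[of aZ] assms by (auto simp: has_params_def)
    have "ix u (int j) = j" using ix_eq[OF v(3), of "int j"] assms(3) by simp
    then show "va (setv vi (int (Suc i)) (sem (Ifp (Mi (Ar aZ (Vr vj)) (Vr vi)) (Asg vP (Ti (Vr vP) (Vr vX))) Skp) u)) vP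
        = va s vX ^ min (Suc i) c"
      using a v assms(4) by (auto simp: min_def mult.commute split: if_splits) (metis le_antisym not_less_eq_eq)
  qed (use assms in \<open>simp_all add: has_params_def\<close>)
  then show ?thesis using assms(5) by (simp add: min_def)
qed

lemma count_pow_spec:
  assumes "has_params n t s" "holds aZ z s" "length z \<le> t" "set z \<subseteq> {1..n}"
  shows "\<forall>j<length z. ar (sem count_pow s) aE j = va s vX ^ (z ! j)"
proof -
  let ?b = "Asg vP (Cn 1) ;; count_pow_inner ;; ASt aE (Vr vj) (Vr vP)"
  have "\<forall>j<length z. j < t \<longrightarrow> ar (sem (Fr vj cT ?b) s) aE j = va s vX ^ (z ! j)"
  proof (rule Fr_invariant[where k = t and I = "\<lambda>i u. \<forall>j<length z. j < i \<longrightarrow> ar u aE j = va s vX ^ (z ! j)"])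
    fix i :: nat and u :: st assume a: "i < t" "va u vj = int i" "\<forall>j<length z. j < i \<longrightarrow> ar u aE j = va s vX ^ (z ! j)"
      and fr: "\<And>y. y \<noteq> vj \<Longrightarrow> y \<notin> mods ?b \<Longrightarrow> va u y = va s y"
      and fa: "\<And>b. b \<notin> amods ?b \<Longrightarrow> ar u b = ar s b"
    have v: "va u vX = va s vX" "va u cT = int t" "va u vN = int n" "ar u aZ = ar s aZ"
      using fr[of vX] fr[of cT] fr[of vN] fa[of aZ] assms(1) by (auto simp: has_params_def mods_counts)
    let ?u = "setv vP 1 u"
    have ix: "ix w (int i) = i" if "va w cT = int t" for w using ix_eq[OF that, of "int i"] a(1) by simp
    let ?w = "sem count_pow_inner ?u"
    have w: "va ?w vj = int i" "va ?w cT = int t" "ar ?w aE = ar u aE" using a v by (simp_all add: sem_va sem_ar mods_counts)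
    have P: "i < length z \<Longrightarrow> va ?w vP = va s vX ^ (z ! i)"
      using count_pow_inner_spec[of n t ?u i "z ! i"] a v assms by (auto simp: has_params_def holds_def subset_iff)
    show "\<forall>j<length z. j < Suc i \<longrightarrow> ar (setv vj (int (Suc i)) (sem ?b u)) aE j = va s vX ^ (z ! j)"
      using a(3) P w ix[OF w(2)] by (auto simp: less_Suc_eq)
  qed (use assms in \<open>simp_all add: has_params_def mods_counts\<close>)
  then show ?thesis using assms(3) by (simp add: count_pow_def)
qed

lemma count_step_spec:
  assumes "has_params n t s" "va s vM = int (length z)" "1 \<le> length z" "length z \<le> t" "va s vX = X"
    and "\<forall>j<length z. ar s aE j = X ^ (z ! j)" "\<forall>j<length z. ar s aF j = run_gf X z q l j"
  shows "\<forall>j<length z. ar (sem count_step s) aF j = run_gf X z q (Suc l) j"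
proof -
  let ?m = "length z"
  let ?b = "Ifp (Mi (Vr vM) (Vr vj))
       (ASt aF (Vr vj) (Pl (Ti (Dv (Mi (Ar aE (Vr vj)) (Vr vX)) (Mi (Vr vX) (Cn 1))) (Vr vf))
         (Ti (Ar aE (Vr vj)) (Ar aF (Pl (Vr vj) (Cn 1)))))) Skp"
  let ?g = "run_gf X z q l 0"
  define s1 where "s1 = seta aF ?m ?g (setv vf ?g s)"
  have i0: "ix s 0 = 0" using ix_eq[of s t 0] assms(1) by (simp add: has_params_def)
  have im: "ix (setv vf ?g s) (int ?m) = ?m"
    using ix_eq[of "setv vf ?g s" t "int ?m"] assms by (simp add: has_params_def)
  have z0: "0 < ?m" using assms(3) by linarith
  have e: "sem count_step s = sem (Fr vj cT ?b) s1"
    unfolding s1_def count_step_def using i0 im assms(2,7) z0 by simp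
  \<comment> \<open>Entries before \<open>i\<close> are new, the others old, and the cell behind the
    table keeps the old entry of state 0.\<close>
  let ?I = "\<lambda>i u. (\<forall>j<?m. ar u aF j = (if j < i then run_gf X z q (Suc l) j else run_gf X z q l j)) \<and> ar u aF ?m = ?g"
  have "?I t (sem (Fr vj cT ?b) s1)"
  proof (rule Fr_invariant[where k = t and I = ?I])
    fix i :: nat and u :: st assume a: "i < t" "va u vj = int i" "?I i u"
      and fr: "\<And>y. y \<noteq> vj \<Longrightarrow> y \<notin> mods ?b \<Longrightarrow> va u y = va s1 y"
      and fa: "\<And>b. b \<notin> amods ?b \<Longrightarrow> ar u b = ar s1 b"
    have v: "va u vX = X" "va u cT = int t" "va u vM = int ?m" "va u vf = ?g" "ar u aE = ar s aE"
      using fr[of vX] fr[of cT] fr[of vM] fr[of vf] fa[of aE] assms by (auto simp: has_params_def s1_def)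
    have ix: "ix u (int i) = i" "ix u (int i + 1) = Suc i"
      using ix_eq[OF v(2), of "int i"] ix_eq[OF v(2), of "int i + 1"] a(1) by simp_all
    show "?I (Suc i) (setv vj (int (Suc i)) (sem ?b u))"
    proof (cases "i < ?m")
      case True
      have F: "ar u aF (Suc i) = run_gf X z q l (Suc i mod ?m)"
      proof (cases "Suc i < ?m")
        case False
        then have "Suc i = ?m" using True by simp
        then show ?thesis using a(3) by simp
      qed (use a(3) in simp)
      have "sem ?b u = seta aF i (run_gf X z q (Suc l) i) u"
        using True a(2) v ix F assms(6) by simp
      then show ?thesis using a(3) True by (auto simp: less_Suc_eq)
    next
      case False
      then have "sem ?b u = u" using a(2) v by simp
      then show ?thesis using a(3) False by (auto simp: less_Suc_eq)
    qed
  qed (use assms z0 in \<open>simp_all add: has_params_def s1_def\<close>)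
  then show ?thesis unfolding e using assms(4) by simp
qed

lemma count_state_spec:
  assumes "has_params n t s" "va s vM = int (length z)" "1 \<le> length z" "length z \<le> t" "va s vX = X"
    and "\<forall>j<length z. ar s aE j = X ^ (z ! j)" "va s vq = int q" "q < length z"
  shows "va (sem count_state s) vacc = va s vacc + run_gf X z q t q"
proof -
  let ?c0 = "Fr vj cT (ASt aF (Vr vj) (Cn 0))" and ?c2 = "Fr vl cT count_step"
  define s1 where "s1 = sem ?c0 s"
  have "\<forall>j<t. ar s1 aF j = 0" unfolding s1_def
  proof (rule Fr_invariant[where k = t and I = "\<lambda>i u. \<forall>j<i. ar u aF j = 0"])
    fix i :: nat and u :: st assume a: "i < t" "va u vj = int i" "\<forall>j<i. ar u aF j = 0"
      and fr: "\<And>y. y \<noteq> vj \<Longrightarrow> y \<notin> mods (ASt aF (Vr vj) (Cn 0)) \<Longrightarrow> va u y = va s y"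
    have "va u cT = int t" using fr[of cT] assms(1) by (simp add: has_params_def)
    then have "ix u (int i) = i" using ix_eq[of u t "int i"] a(1) by simp
    then show "\<forall>j<Suc i. ar (setv vj (int (Suc i)) (sem (ASt aF (Vr vj) (Cn 0)) u)) aF j = 0"
      using a by (auto simp: less_Suc_eq)
  qed (use assms(1) in \<open>simp_all add: has_params_def\<close>)
  moreover have v1: "va s1 y = va s y" if "y \<noteq> vj" for y unfolding s1_def using that by (simp add: sem_va)
  have ix1: "ix w (int q) = q" if "va w cT = int t" for w using ix_eq[OF that, of "int q"] assms(4,8) by simp
  have T1: "va s1 cT = int t" "va s1 vq = int q" using v1 assms by (simp_all add: has_params_def)
  define s2 where "s2 = seta aF q 1 s1"
  have s2: "sem (ASt aF (Vr vq) (Cn 1)) s1 = s2" unfolding s2_def using T1 ix1[OF T1(1)] by simp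
  have F2: "\<forall>j<length z. ar s2 aF j = run_gf X z q 0 j"
    using calculation assms(4) unfolding s2_def by simp
  have v2: "va s2 y = va s y" if "y \<noteq> vj" for y unfolding s2_def using v1[OF that] by simp
  have E2: "ar s2 aE = ar s aE" unfolding s2_def s1_def by (simp add: sem_ar)
  define s3 where "s3 = sem ?c2 s2"
  have "\<forall>j<length z. ar s3 aF j = run_gf X z q t j" unfolding s3_def
  proof (rule Fr_invariant[where k = t and I = "\<lambda>i u. \<forall>j<length z. ar u aF j = run_gf X z q i j"])
    fix i :: nat and u :: st assume a: "i < t" "va u vl = int i" "\<forall>j<length z. ar u aF j = run_gf X z q i j"
      and fr: "\<And>y. y \<noteq> vl \<Longrightarrow> y \<notin> mods count_step \<Longrightarrow> va u y = va s2 y"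
      and fa: "\<And>b. b \<notin> amods count_step \<Longrightarrow> ar u b = ar s2 b"
    have "\<forall>j<length z. ar (sem count_step u) aF j = run_gf X z q (Suc i) j"
      by (rule count_step_spec[of n t])
        (use assms a(3) fr[of vN] fr[of cT] fr[of vM] fr[of vX] fa[of aE] E2 v2 in \<open>simp_all add: has_params_def mods_counts\<close>)
    then show "\<forall>j<length z. ar (setv vl (int (Suc i)) (sem count_step u)) aF j = run_gf X z q (Suc i) j" by simp
  qed (use assms F2 v2 in \<open>simp_all add: has_params_def mods_counts\<close>)
  then have Fq: "ar s3 aF q = run_gf X z q t q" using assms(8) by simp
  have v3: "va s3 y = va s y" if "y \<notin> {vj, vl, vf}" for y
    unfolding s3_def using that v2 by (simp add: sem_va mods_counts)
  have "sem count_state s = setv vacc (va s3 vacc + ar s3 aF (ix s3 (va s3 vq))) s3"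
    unfolding count_state_def by (simp add: s3_def s2[simplified] s1_def[symmetric])
  moreover have "ix s3 (va s3 vq) = q" using v3[of vq] v3[of cT] ix1[of s3] assms by (simp add: has_params_def)
  ultimately show ?thesis using Fq v3[of vacc] by simp
qed

theorem count_spec:
  assumes "has_params n t s" "holds aZ z s" "lyndon z" "length z \<le> t" "set z \<subseteq> {1..n}" "va s vM = int (length z)"
  shows "va (sem count s) vR = int (count_below n t z)"
proof -
  define X where "X = int n ^ t + 2"
  have m1: "1 \<le> length z" using assms(3) by (cases z) (auto simp: lyndon_def)
  define s1 where "s1 = sem count_init s"
  define s2 where "s2 = sem count_pow s1"
  define s3 where "s3 = setv vacc 0 s2"
  let ?b = "Ifp (Mi (Vr vM) (Vr vq)) count_state Skp"
  define s4 where "s4 = sem (Fr vq cT ?b) s3"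
  have p1: "has_params n t s1" unfolding s1_def by (rule has_params_sem[OF wfc_count(1) assms(1)])
  have p2: "has_params n t s2" unfolding s2_def by (rule has_params_sem[OF wfc_count(3) p1])
  have p3: "has_params n t s3" unfolding s3_def by (rule has_params_setv[OF p2]) simp
  have X1: "va s1 vX = X" "va s1 vXN = X ^ Suc n" unfolding s1_def X_def by (rule count_init_spec[OF assms(1)])+
  have z1: "holds aZ z s1" unfolding s1_def by (rule holds_sem[OF _ assms(2)]) (simp add: mods_counts)
  have E2: "\<forall>j<length z. ar s2 aE j = X ^ (z ! j)"
    unfolding s2_def X1(1)[symmetric] by (rule count_pow_spec[OF p1 z1 assms(4,5)])
  have v3: "va s3 vX = X" "va s3 vXN = X ^ Suc n" "va s3 vM = int (length z)" "va s3 vacc = 0" "ar s3 aE = ar s2 aE"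
    unfolding s3_def s2_def s1_def using X1 assms(6) by (simp_all add: sem_va mods_counts s1_def)
  have "va s4 vacc = (\<Sum>q<min t (length z). run_gf X z q t q)" unfolding s4_def
  proof (rule Fr_invariant[where k = t and I = "\<lambda>i u. va u vacc = (\<Sum>q<min i (length z). run_gf X z q t q)"])
    fix i :: nat and u :: st assume a: "i < t" "va u vq = int i" "va u vacc = (\<Sum>q<min i (length z). run_gf X z q t q)"
      and fr: "\<And>y. y \<noteq> vq \<Longrightarrow> y \<notin> mods ?b \<Longrightarrow> va u y = va s3 y"
      and fa: "\<And>b. b \<notin> amods ?b \<Longrightarrow> ar u b = ar s3 b"
    have v: "va u vX = X" "has_params n t u" "va u vM = int (length z)" "ar u aE = ar s2 aE"
      using fr[of vX] fr[of cT] fr[of vN] fr[of vM] fa[of aE] v3 p3 by (auto simp: has_params_def mods_counts)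
    show "va (setv vq (int (Suc i)) (sem ?b u)) vacc = (\<Sum>q<min (Suc i) (length z). run_gf X z q t q)"
    proof (cases "i < length z")
      case True
      have "va (sem count_state u) vacc = va u vacc + run_gf X z i t i"
        by (rule count_state_spec[OF v(2,3) m1 assms(4) v(1)]) (use v(4) E2 a(2) True in simp_all)
      then show ?thesis using a True v by (simp add: min_absorb1)
    next
      case False
      then show ?thesis using a v by (simp add: min_absorb2)
    qed
  qed (use p3 v3 in \<open>simp_all add: has_params_def mods_counts\<close>)
  then have acc: "va s4 vacc = (\<Sum>q<length z. run_gf X z q t q)" using assms(4) by (simp add: min_absorb2)
  have v4: "va s4 vX = X" "va s4 vXN = X ^ Suc n" unfolding s4_def using v3 by (simp_all add: sem_va mods_counts)
  have "va (sem count s) vR = va s4 vacc mod X ^ Suc n mod (X - 1)"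
    unfolding count_def using v4 by (simp add: s4_def[symmetric] s3_def[symmetric] s2_def[symmetric] s1_def[symmetric] del: power_Suc)
  also have "\<dots> = int (count_below n t z)" unfolding acc by (rule count_below_run_gf[OF assms(3-5)]) (simp add: X_def)
  finally show ?thesis .
qed

section \<open>Locating a block\<close>

abbreviation (input) "vper \<equiv> (13::nat)"
abbreviation (input) "vcm \<equiv> (14::nat)"
abbreviation (input) "vg \<equiv> (15::nat)"
abbreviation (input) "vh \<equiv> (16::nat)"
abbreviation (input) "vcur \<equiv> (17::nat)"
abbreviation (input) "vK \<equiv> (18::nat)"

text \<open>All \<open>n\<close> rounds are run; once the count reaches \<open>K\<close> the
  candidate stays. At the bound \<open>vcm\<close> nothing is counted, since a candidate that got so
  far must be the letter sought.\<close>

definition find_try :: cm where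
  "find_try = Ifp (Mi (Vr vcm) (Vr vcur))
     (ASt aZ (Vr vg) (Vr vcur) ;; Asg vM (Pl (Vr vg) (Cn 1)) ;; count ;;
      Ifp (Mi (Vr vK) (Vr vR)) (Asg vcur (Pl (Vr vcur) (Cn 1))) Skp) Skp"

definition find_letter :: cm where
  "find_letter = Asg vcur (Cn 1) ;; Fr vh vN find_try"

definition find_step :: cm where
  "find_step = find_letter ;; ASt aZ (Vr vg) (Vr vcur) ;;
     Ifp (Mi (Vr vcm) (Vr vcur)) (Asg vper (Pl (Vr vg) (Cn 1))) Skp ;;
     Asg vcm (Ar aZ (Mi (Pl (Vr vg) (Cn 1)) (Vr vper)))"

definition find_block :: cm where
  "find_block = Asg vper (Cn 1) ;; Asg vcm (Vr vN) ;; Fr vg cT find_step"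

lemma wfc_find: "wfc find_try" "wfc find_letter" "wfc find_step" "wfc find_block"
  by (simp_all add: find_try_def find_letter_def find_step_def find_block_def wfc_count mods_counts)

lemma mods_find_try: "mods find_try = {2, 3, 4, 5, 6, 7, 8, 9, 10, 11, 12, 17}" "amods find_try = {aZ, aE, aF}" "pure find_try"
  by (auto simp: find_try_def mods_counts)

lemma mods_find_letter: "mods find_letter = {2, 3, 4, 5, 6, 7, 8, 9, 10, 11, 12, 16, 17}" "amods find_letter = {aZ, aE, aF}" "pure find_letter"
  by (auto simp: find_letter_def mods_find_try)

lemma mods_find_step: "mods find_step = {2, 3, 4, 5, 6, 7, 8, 9, 10, 11, 12, 13, 14, 16, 17}" "amods find_step = {aZ, aE, aF}" "pure find_step"
  by (auto simp: find_step_def mods_find_letter)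

lemma mods_find: "mods find_block = {2, 3, 4, 5, 6, 7, 8, 9, 10, 11, 12, 13, 14, 15, 16, 17}" "amods find_block = {aZ, aE, aF}" "pure find_block"
  by (auto simp: find_block_def mods_find_step)

lemmas mods_finds = mods_counts mods_find_try mods_find_letter mods_find_step mods_find

lemma holds_snoc:
  assumes "holds a (take i w) s" "i < length w" "v = int c"
  shows "holds a (take i w @ [c]) (seta a i v s)"
  using assms by (auto simp: holds_def nth_append less_Suc_eq)

lemma holds_take_seta: "holds a (take i w) s \<Longrightarrow> holds a (take i w) (seta a i v s)"
  by (auto simp: holds_def)

lemma holds_take: "holds a w s \<Longrightarrow> holds a (take i w) s"
  by (auto simp: holds_def)

lemma duval_period_bounds: "1 \<le> duval_period w l \<and> duval_period w l \<le> max 1 l"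
  by (induction l) auto

text \<open>The letter predicted by the period of the prefix, which is the largest that can follow
  in a necklace; the first letter is bounded only by \<open>n\<close>.\<close>

definition next_bound :: "nat \<Rightarrow> nat list \<Rightarrow> nat \<Rightarrow> nat" where
  "next_bound n a i = (if i = 0 then n else a ! (i - duval_period a i))"

lemma ix_nat: "has_params n t s \<Longrightarrow> z = int j \<Longrightarrow> j \<le> Suc t \<Longrightarrow> ix s z = j"
  using ix_eq[of s t z] by (simp add: has_params_def)

context params_ok
begin

lemma diff_words_le: "a \<in> diff_words n t \<Longrightarrow> j < t \<Longrightarrow> 1 \<le> a ! j \<and> a ! j \<le> n"
  by (auto simp: diff_words_def strings_def subset_iff)

lemma le_next_bound:
  assumes "a \<in> diff_words n t" "neck a" "i < t" shows "a ! i \<le> next_bound n a i" "next_bound n a i \<le> n"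
proof -
  have l: "length a = t" by (rule diff_words_length[OF assms(1)])
  show "a ! i \<le> next_bound n a i"
  proof (cases "i = 0")
    case True
    then show ?thesis using diff_words_le[OF assms(1,3)] by (simp add: next_bound_def)
  next
    case False
    have "periodic (duval_period a i) (take i a)" "duval_period a i \<le> i"
      using duval[OF assms(2), of i] False assms(3) l by auto
    then show ?thesis using neck_periodic_next_le[OF assms(2)] assms(3) l False by (simp add: next_bound_def)
  qed
  show "next_bound n a i \<le> n" using diff_words_le[OF assms(1), of "i - duval_period a i"] assms(3) by (simp add: next_bound_def)
qed

text \<open>Every prefix that the search submits to the counting program is therefore a Lyndon word,
  as \<open>count_spec\<close> demands.\<close>

lemma lyndon_extend:
  assumes "a \<in> diff_words n t" "neck a" "i < t" "c < next_bound n a i" shows "lyndon (take i a @ [c])"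
proof (cases "i = 0")
  case False
  have l: "length a = t" by (rule diff_words_length[OF assms(1)])
  have d: "1 \<le> duval_period a i" "duval_period a i \<le> i" "lyndon (take (duval_period a i) a)" "periodic (duval_period a i) (take i a)"
    using duval[OF assms(2), of i] False assms(3) l by auto
  show ?thesis
    by (rule lyndon_snoc_less[of "duval_period a i"]) (use d assms(3,4) l False in \<open>simp_all add: min_absorb1 next_bound_def\<close>)
qed simp

lemma find_letter_spec:
  assumes "has_params n t s" "is_block n t K a" "va s vK = int K" "i < t" "va s vg = int i" "holds aZ (take i a) s"
    and "va s vcm = int (next_bound n a i)"
  shows "va (sem find_letter s) vcur = int (a ! i) \<and> holds aZ (take i a) (sem find_letter s)"
proof -
  have a: "a \<in> diff_words n t" "neck a" using assms(2) by (auto simp: is_block_def)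
  have l: "length a = t" by (rule diff_words_length[OF a(1)])
  have ai: "1 \<le> a ! i" "a ! i \<le> n" using diff_words_le[OF a(1) assms(4)] by auto
  define s1 where "s1 = setv vcur 1 s"
  \<comment> \<open>The candidate goes up by 1 in each round until it meets \<open>a ! i\<close>,
    which happens within \<open>n\<close> rounds.\<close>
  let ?I = "\<lambda>k u. va u vcur = int (min (Suc k) (a ! i)) \<and> holds aZ (take i a) u"
  have "?I n (sem (Fr vh vN find_try) s1)"
  proof (rule Fr_invariant[where k = n and I = ?I])
    fix k :: nat and u :: st assume I: "k < n" "va u vh = int k" "?I k u"
      and fr: "\<And>y. y \<noteq> vh \<Longrightarrow> y \<notin> mods find_try \<Longrightarrow> va u y = va s1 y"
    have pu: "has_params n t u" and v: "va u vK = int K" "va u vg = int i" "va u vcm = int (next_bound n a i)"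
      using fr[of vN] fr[of cT] fr[of vK] fr[of vg] fr[of vcm] assms by (auto simp: has_params_def s1_def mods_finds)
    define c where "c = min (Suc k) (a ! i)"
    have cu: "va u vcur = int c" "holds aZ (take i a) u" using I(3) by (auto simp: c_def)
    have c1: "1 \<le> c" "c \<le> a ! i" using ai by (auto simp: c_def)
    have "?I (Suc k) (sem find_try u)"
    proof (cases "c < next_bound n a i")
      case True
      define u1 where "u1 = setv vM (int i + 1) (seta aZ i (int c) u)"
      define u2 where "u2 = sem count u1"
      have ixg: "ix u (int i) = i" by (rule ix_nat[OF pu refl]) (use assms(4) in simp)
      have e: "sem find_try u = (if int K - va u2 vR > 0 then setv vcur (int c + 1) u2 else u2)"
        unfolding find_try_def using True cu v ixg by (simp add: u2_def u1_def sem_va mods_finds)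
      have R: "va u2 vR = int (count_below n t (take i a @ [c]))" unfolding u2_def
      proof (rule count_spec)
        show "has_params n t u1" using pu by (simp add: u1_def has_params_def)
        show "holds aZ (take i a @ [c]) u1"
          using holds_snoc[OF cu(2), of "int c" c] assms(4) l by (simp add: u1_def holds_def)
        show "lyndon (take i a @ [c])" by (rule lyndon_extend[OF a assms(4) True])
        show "set (take i a @ [c]) \<subseteq> {1..n}"
          using a(1) c1 ai(2) set_take_subset[of i a] by (auto simp: diff_words_def strings_def)
      qed (use assms(4) l in \<open>simp_all add: u1_def\<close>)
      have hz: "holds aZ (take i a) u2" unfolding u2_def
        by (rule holds_sem) (use holds_take_seta[OF cu(2)] in \<open>simp_all add: mods_finds u1_def holds_def\<close>)
      have cur2: "va u2 vcur = int c" using cu by (simp add: u2_def u1_def sem_va mods_finds)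
      show ?thesis
      proof (cases "c < a ! i")
        case lt: True
        have "count_below n t (take i a @ [c]) < K" by (rule is_block_prefix_less[OF assms(2,4) lt])
        then have "sem find_try u = setv vcur (int c + 1) u2" unfolding e R by simp
        moreover have "min (Suc (Suc k)) (a ! i) = Suc c" using lt by (simp add: c_def)
        ultimately show ?thesis using hz by (simp add: holds_def)
      next
        case False
        then have ca: "c = a ! i" using c1 by simp
        have "K \<le> count_below n t (take i a @ [c])" unfolding ca by (rule is_block_prefix_ge[OF assms(2,4)])
        then have "sem find_try u = u2" unfolding e R by simp
        moreover have "min (Suc (Suc k)) (a ! i) = c" using ca by (auto simp: c_def)
        ultimately show ?thesis using hz cur2 by simp
      qed
    next
      case False
      have "c = a ! i" using False c1 le_next_bound(1)[OF a assms(4)] by simp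
      then have "min (Suc (Suc k)) (a ! i) = c" by (auto simp: c_def)
      moreover have "sem find_try u = u" unfolding find_try_def using False cu v by simp
      ultimately show ?thesis using cu by simp
    qed
    then show "?I (Suc k) (setv vh (int (Suc k)) (sem find_try u))" by (simp add: holds_def)
  qed (use assms ai in \<open>simp_all add: has_params_def s1_def mods_finds holds_def\<close>)
  moreover have "min (Suc n) (a ! i) = a ! i" using ai by simp
  moreover have "sem find_letter s = sem (Fr vh vN find_try) s1" by (simp add: find_letter_def s1_def)
  ultimately show ?thesis by simp
qed

text \<open>The period is maintained while the letters are found: the comparison of a new letter
  with its bound is the case distinction in \<open>duval_period\<close>.\<close>

theorem find_spec:
  assumes "has_params n t s" "is_block n t K a" "va s vK = int K"
  shows "holds aZ a (sem find_block s) \<and> va (sem find_block s) vper = int (duval_period a t)"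
proof -
  have a: "a \<in> diff_words n t" "neck a" using assms(2) by (auto simp: is_block_def)
  have l: "length a = t" by (rule diff_words_length[OF a(1)])
  define s1 where "s1 = setv vcm (int n) (setv vper 1 s)"
  have e: "sem find_block s = sem (Fr vg cT find_step) s1" using assms(1) by (simp add: find_block_def s1_def has_params_def)
  let ?I = "\<lambda>i u. holds aZ (take i a) u \<and> va u vper = int (duval_period a i) \<and> (i < t \<longrightarrow> va u vcm = int (next_bound n a i))"
  have "?I t (sem (Fr vg cT find_step) s1)"
  proof (rule Fr_invariant[where k = t and I = ?I])
    fix i :: nat and u :: st assume I: "i < t" "va u vg = int i" "?I i u"
      and fr: "\<And>y. y \<noteq> vg \<Longrightarrow> y \<notin> mods find_step \<Longrightarrow> va u y = va s1 y"
    have pu: "has_params n t u" and vK: "va u vK = int K"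
      using fr[of vN] fr[of cT] fr[of vK] assms by (auto simp: has_params_def s1_def mods_finds)
    define u1 where "u1 = sem find_letter u"
    have u1: "va u1 vcur = int (a ! i)" "holds aZ (take i a) u1"
      using find_letter_spec[OF pu assms(2) vK I(1,2)] I(1,3) by (auto simp: u1_def)
    have p1: "has_params n t u1" unfolding u1_def by (rule has_params_sem[OF wfc_find(2) pu])
    have v1: "va u1 vg = int i" "va u1 vper = int (duval_period a i)" "va u1 vcm = int (next_bound n a i)"
      using I by (simp_all add: u1_def sem_va mods_finds)
    define u2 where "u2 = seta aZ i (int (a ! i)) u1"
    have h2: "holds aZ (take (Suc i) a) u2"
      using holds_snoc[OF u1(2), of "int (a ! i)" "a ! i"] I(1) l by (simp add: u2_def take_Suc_conv_app_nth)
    have d: "int (duval_period a (Suc i)) = (if a ! i < next_bound n a i then int i + 1 else int (duval_period a i))"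
    proof (cases "i = 0")
      case False
      then show ?thesis by (simp add: next_bound_def)
    qed simp
    define u3 where "u3 = setv vper (int (duval_period a (Suc i))) u2"
    have b: "1 \<le> duval_period a (Suc i)" "duval_period a (Suc i) \<le> Suc i" using duval_period_bounds[of a "Suc i"] by auto
    have p3: "has_params n t u3" using p1 by (simp add: u3_def u2_def has_params_def)
    have ix3: "ix u3 (int i + 1 - int (duval_period a (Suc i))) = Suc i - duval_period a (Suc i)"
      by (rule ix_nat[OF p3]) (use b I(1) in \<open>auto simp: of_nat_diff\<close>)
    have z3: "ar u3 aZ (Suc i - duval_period a (Suc i)) = int (a ! (Suc i - duval_period a (Suc i)))"
      using h2 b I(1) l by (simp add: u3_def holds_def)
    have "setv vper (int (duval_period a i)) u2 = u2"
      using v1(2) by (simp add: setv_def u2_def seta_def fun_upd_idem)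
    then have i3: "(if a ! i < next_bound n a i then setv vper (int i + 1) u2 else u2) = u3"
      unfolding u3_def d by simp
    have ixg: "ix u1 (int i) = i" by (rule ix_nat[OF p1 refl]) (use I(1) in simp)
    have "sem find_step u = setv vcm (int (a ! (Suc i - duval_period a (Suc i)))) u3"
    proof -
      have "sem find_step u = sem (Asg vcm (Ar aZ (Mi (Pl (Vr vg) (Cn 1)) (Vr vper))))
          (if a ! i < next_bound n a i then setv vper (int i + 1) u2 else u2)"
        unfolding find_step_def using u1(1) v1 ixg by (simp add: u1_def[symmetric] u2_def)
      also have "\<dots> = setv vcm (ar u3 aZ (ix u3 (int i + 1 - int (duval_period a (Suc i))))) u3"
        unfolding i3 using v1 by (simp add: u3_def u2_def del: duval_period.simps)
      finally show ?thesis unfolding ix3 z3 .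
    qed
    then show "?I (Suc i) (setv vg (int (Suc i)) (sem find_step u))"
      using h2 by (simp add: u3_def holds_def next_bound_def del: duval_period.simps)
  qed (use assms t1 in \<open>simp_all add: has_params_def s1_def mods_finds holds_def next_bound_def\<close>)
  then show ?thesis unfolding e using l by simp
qed

text \<open>The one-letter word \<open>[n]\<close> is Lyndon and bounds every word, so the length of
  the cycle is itself a value of the counting program.\<close>

lemma count_total:
  assumes "has_params n t s" "ar s aZ 0 = int n" "va s vM = 1"
  shows "va (sem count s) vR = int (length C)"
proof -
  have "va (sem count s) vR = int (count_below n t [n])"
    by (rule count_spec[OF assms(1)]) (use assms t1 tn in \<open>simp_all add: holds_def\<close>)
  moreover have "count_below n t [n] = card (diff_words n t)"
  proof -
    have "below [n] w" if "w \<in> diff_words n t" for w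
      unfolding below_def
    proof
      fix i
      have "rotate i w \<in> diff_words n t" by (rule rotate_in_diff_words[OF that])
      then show "take (length [n]) (rotate i w) \<le> [n]" using diff_words_le[of "rotate i w" 0] t1
        by (cases "rotate i w") (auto simp: diff_words_def strings_def)
    qed
    then have "{w \<in> diff_words n t. below [n] w} = diff_words n t" by blast
    then show ?thesis by (simp add: count_below_def)
  qed
  ultimately show ?thesis by (simp add: length_C)
qed

end

text \<open>The first cell is copied to cell \<open>t\<close>, just behind the word, and then all
  cells move down by one.\<close>

definition rot :: "nat \<Rightarrow> cm" where
  "rot a = ASt a (Vr cT) (Ar a (Cn 0)) ;; Fr vj cT (ASt a (Vr vj) (Ar a (Pl (Vr vj) (Cn 1))))"

lemma wfc_rot: "a < 8 \<Longrightarrow> wfc (rot a)"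
  by (simp add: rot_def)

lemma mods_rot: "mods (rot a) = {4}" "amods (rot a) = {a}" "pure (rot a)"
  by (auto simp: rot_def)

lemma rot_spec:
  assumes "has_params n t s" "holds a w s" "length w = t" "1 \<le> t"
  shows "holds a (rotate1 w) (sem (rot a) s)"
proof -
  let ?b = "ASt a (Vr vj) (Ar a (Pl (Vr vj) (Cn 1)))"
  define w' where "w' = w @ [hd w]"
  have w0: "w \<noteq> []" using assms(3,4) by auto
  define s1 where "s1 = seta a t (int (hd w)) s"
  have ix0: "ix s 0 = 0" "ix s (int t) = t" using ix_nat[OF assms(1), of 0 0] ix_nat[OF assms(1) refl, of t] by simp_all
  have e: "sem (rot a) s = sem (Fr vj cT ?b) s1"
    using assms w0 ix0 by (simp add: rot_def s1_def has_params_def holds_def hd_conv_nth)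
  let ?I = "\<lambda>i u. \<forall>j\<le>t. ar u a j = int (if j < i then w' ! Suc j else w' ! j)"
  have "?I t (sem (Fr vj cT ?b) s1)"
  proof (rule Fr_invariant[where k = t and I = ?I])
    fix i :: nat and u :: st assume I: "i < t" "va u vj = int i" "?I i u"
      and fr: "\<And>y. y \<noteq> vj \<Longrightarrow> y \<notin> mods ?b \<Longrightarrow> va u y = va s1 y"
    have pu: "has_params n t u" using fr[of vN] fr[of cT] assms(1) by (simp add: has_params_def s1_def)
    have ix: "ix u (int i) = i" "ix u (int i + 1) = Suc i"
      using ix_nat[OF pu refl, of i] ix_nat[OF pu, of "int i + 1" "Suc i"] I(1) by simp_all
    have "sem ?b u = seta a i (int (w' ! Suc i)) u" using I ix by simp
    then show "?I (Suc i) (setv vj (int (Suc i)) (sem ?b u))" using I(3) by (auto simp: less_Suc_eq)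
  next
    show "?I 0 (setv vj 0 s1)" using assms(2,3) by (auto simp: s1_def w'_def holds_def nth_append le_less)
  qed (use assms in \<open>simp_all add: has_params_def s1_def\<close>)
  moreover have "rotate1 w = tl w'" using w0 by (cases w) (simp_all add: w'_def)
  then have "\<forall>j<t. rotate1 w ! j = w' ! Suc j" using assms(3) by (simp add: nth_tl w'_def)
  ultimately show ?thesis unfolding e holds_def using assms(3) by simp
qed

section \<open>The ranking program\<close>

abbreviation (input) "vo1 \<equiv> (19::nat)"
abbreviation (input) "vo \<equiv> (20::nat)"
abbreviation (input) "vcmp \<equiv> (21::nat)"
abbreviation (input) "vones \<equiv> (22::nat)"
abbreviation (input) "vlen \<equiv> (23::nat)"
abbreviation (input) "vprev \<equiv> (24::nat)"
abbreviation (input) "ve \<equiv> (25::nat)"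
abbreviation (input) "vr \<equiv> (26::nat)"
abbreviation (input) "vidx \<equiv> (27::nat)"
abbreviation (input) "vtot \<equiv> (28::nat)"
abbreviation (input) "vst \<equiv> (29::nat)"
abbreviation (input) "voff \<equiv> (30::nat)"
abbreviation (input) "vend \<equiv> (31::nat)"
abbreviation (input) "vb \<equiv> (32::nat)"
abbreviation (input) "vsum \<equiv> (33::nat)"
abbreviation (input) "vw \<equiv> (34::nat)"
abbreviation (input) "aS \<equiv> (3::nat)"
abbreviation (input) "aY \<equiv> (4::nat)"

text \<open>Three copies of the differences are needed: \<open>aS\<close> stays unchanged,
  \<open>aY\<close> is rotated, and \<open>aZ\<close> holds the largest rotation found so far.
  Afterwards \<open>vprev\<close> is the last element of the subset, that is, the sum of the
  differences.\<close>

definition read_subset :: cm where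
  "read_subset = Asg vprev (Cn 0) ;; Fr vj cT (Rd ve ;; ASt aS (Vr vj) (Mi (Vr ve) (Vr vprev)) ;;
     ASt aY (Vr vj) (Mi (Vr ve) (Vr vprev)) ;; ASt aZ (Vr vj) (Mi (Vr ve) (Vr vprev)) ;; Asg vprev (Vr ve))"

text \<open>The first nonzero difference decides; the square tests for being nonzero with a
  comparison that only recognises positive values.\<close>

definition compare_arrays :: cm where
  "compare_arrays = Asg vcmp (Cn 0) ;; Fr vj cT (Ifp (Ti (Vr vcmp) (Vr vcmp)) Skp
     (Asg vcmp (Mi (Ar aY (Vr vj)) (Ar aZ (Vr vj)))))"

definition copy_array :: cm where
  "copy_array = Fr vj cT (ASt aZ (Vr vj) (Ar aY (Vr vj)))"

definition max_step :: cm where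
  "max_step = compare_arrays ;; Ifp (Vr vcmp) (Asg vo1 (Vr vo) ;; copy_array) Skp ;; rot aY"

text \<open>Only a strictly larger rotation replaces the stored one, so \<open>vo1\<close> is the
  least index at which the maximum occurs.\<close>

definition max_rot :: cm where
  "max_rot = Asg vo1 (Cn 0) ;; Fr vo cT max_step"

definition ones_prefix :: cm where
  "ones_prefix = Asg vones (Cn 1) ;; Fr vj cT (Ifp (Mi (Vr vo1) (Vr vj))
     (Ifp (Mi (Ar aS (Vr vj)) (Cn 1)) (Asg vones (Cn 0)) Skp) Skp)"

definition period_step :: cm where
  "period_step = Ifp (Mi (Vr vlen) (Vr vl))
     (Ifp (Mi (Vr vcm) (Ar aZ (Vr vl))) (Asg vper (Pl (Vr vl) (Cn 1))) Skp ;;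
      Asg vcm (Ar aZ (Mi (Pl (Vr vl) (Cn 1)) (Vr vper)))) Skp"

text \<open>The initial bound 0 keeps the first letter from counting as a descent, so the period is
  still 1 after it.\<close>

definition find_period :: cm where
  "find_period = Asg vper (Cn 1) ;; Asg vcm (Cn 0) ;; Fr vl cT period_step"

definition count_all :: cm where
  "count_all = ASt aZ (Cn 0) (Vr vN) ;; Asg vM (Cn 1) ;; count ;; Asg vtot (Vr vR)"

text \<open>The sum is never below \<open>t\<close>, so the second branch is taken exactly for the
  word of ones.\<close>

definition rank_start :: cm where
  "rank_start = Ifp (Mi (Vr vprev) (Vr cT)) Skp (Asg vo1 (Mi (Vr cT) (Cn 1)))"

definition rank_len :: cm where
  "rank_len = Asg vlen (Vr cT) ;; Ifp (Vr vones) (Asg vlen (Mi (Vr cT) (Vr vo1))) Skp"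

text \<open>The total is computed after the count for the prefix because it overwrites the first
  cell of \<open>aZ\<close>.\<close>

definition rank_out :: cm where
  "rank_out = Asg vM (Vr vper) ;; count ;; Asg vr (Vr vR) ;; count_all ;;
     Ifp (Vr vones) (Asg vr (Mi (Mi (Vr vtot) (Vr vr)) (Vr vo1)))
       (Asg vr (Pl (Mi (Mi (Vr vtot) (Vr vr)) (Vr vo1)) (Vr vper))) ;;
     Wr (Pl (Md (Vr vr) (Vr vtot)) (Cn 1))"

definition rank_cm :: cm where
  "rank_cm = read_subset ;; max_rot ;; rank_start ;; ones_prefix ;; rank_len ;; find_period ;; rank_out"

definition locate :: cm where
  "locate = find_block ;; Asg vM (Vr vper) ;; count ;; Asg vst (Mi (Vr vtot) (Vr vR)) ;;
     Asg voff (Mi (Mi (Vr vidx) (Cn 1)) (Vr vst))"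

definition ones_suffix :: cm where
  "ones_suffix = Asg vones (Cn 1) ;; Fr vj cT (Ifp (Mi (Pl (Vr vj) (Cn 1)) (Vr voff))
     (Ifp (Mi (Vr vper) (Vr vj)) (Ifp (Mi (Ar aZ (Vr vj)) (Cn 1)) (Asg vones (Cn 0)) Skp) Skp) Skp)"

text \<open>\<open>vend\<close> is the number \<open>e\<close> of \<open>unrank_correct\<close>, and
  \<open>vb\<close> is the number of ones read before it. \<open>vK\<close> selects the block that
  follows, which is the first block when the end of the cycle is reached.\<close>

definition next_block :: cm where
  "next_block = Asg vend (Pl (Vr vst) (Vr vper)) ;;
     Ifp (Mi (Pl (Vr vend) (Cn 2)) (Vr vtot)) (Asg vend (Vr vtot)) Skp ;;
     Asg vb (Pl (Mi (Vr vend) (Vr vidx)) (Cn 1)) ;;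
     Ifp (Mi (Vr vtot) (Vr vend)) (Asg vK (Mi (Vr vtot) (Vr vend))) (Asg vK (Vr vtot)) ;; find_block"

text \<open>\<open>vb\<close> is set to 0 so that \<open>write_subset\<close> can treat both cases
  alike, as \<open>vb\<close> ones followed by a prefix of \<open>aZ\<close>.\<close>

definition rotate_block :: cm where
  "rotate_block = Asg vb (Cn 0) ;; Fr vw cT (Ifp (Mi (Vr voff) (Vr vw)) (rot aZ) Skp)"

definition write_step :: cm where
  "write_step = Ifp (Mi (Vr vb) (Vr vw)) (Asg vsum (Pl (Vr vsum) (Cn 1)))
      (Asg vsum (Pl (Vr vsum) (Ar aZ (Mi (Vr vw) (Vr vb))))) ;; Wr (Vr vsum)"

definition write_subset :: cm where
  "write_subset = Asg vsum (Cn 0) ;; Fr vw cT write_step"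

text \<open>The index is 1-based, so the distance from its position to the end of the cycle is
  \<open>vtot - vidx + 1\<close>.\<close>

definition unrank_cm :: cm where
  "unrank_cm = Rd vidx ;; count_all ;; Asg vK (Pl (Mi (Vr vtot) (Vr vidx)) (Cn 1)) ;; locate ;; ones_suffix ;;
     Ifp (Vr vones) next_block rotate_block ;; write_subset"

lemmas rank_defs = read_subset_def compare_arrays_def copy_array_def max_step_def max_rot_def ones_prefix_def
  period_step_def find_period_def count_all_def rank_start_def rank_len_def rank_out_def
lemmas unrank_defs = locate_def ones_suffix_def next_block_def rotate_block_def write_step_def write_subset_def

lemma mods_rank:
  "mods read_subset = {4, 24, 25}" "amods read_subset = {0, 3, 4}"
  "mods compare_arrays = {4, 21}" "amods compare_arrays = {}" "pure compare_arrays"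
  "mods copy_array = {4}" "amods copy_array = {0}" "pure copy_array"
  "mods max_step = {4, 19, 21}" "amods max_step = {0, 4}" "pure max_step"
  "mods max_rot = {4, 19, 20, 21}" "amods max_rot = {0, 4}" "pure max_rot"
  "mods ones_prefix = {4, 22}" "amods ones_prefix = {}" "pure ones_prefix"
  "mods period_step = {13, 14}" "amods period_step = {}" "pure period_step"
  "mods find_period = {9, 13, 14}" "amods find_period = {}" "pure find_period"
  "mods count_all = {2, 3, 4, 5, 6, 7, 8, 9, 10, 11, 12, 28}" "amods count_all = {aZ, aE, aF}" "pure count_all"
  "mods rank_start = {19}" "amods rank_start = {}" "pure rank_start"
  "mods rank_len = {23}" "amods rank_len = {}" "pure rank_len"
  by (auto simp: rank_defs mods_rot mods_finds)

lemma mods_unrank: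
  "mods locate = {2, 3, 4, 5, 6, 7, 8, 9, 10, 11, 12, 13, 14, 15, 16, 17, 29, 30}"
    "amods locate = {aZ, aE, aF}" "pure locate"
  "mods ones_suffix = {4, 22}" "amods ones_suffix = {}" "pure ones_suffix"
  "mods next_block = {2, 3, 4, 5, 6, 7, 8, 9, 10, 11, 12, 13, 14, 15, 16, 17, 18, 31, 32}"
    "amods next_block = {aZ, aE, aF}" "pure next_block"
  "mods rotate_block = {4, 32, 34}" "amods rotate_block = {aZ}" "pure rotate_block"
  "mods write_step = {33}" "amods write_step = {}"
  "mods write_subset = {33, 34}" "amods write_subset = {}"
  by (auto simp: unrank_defs mods_rot mods_finds)

lemma wfc_rank:
  "wfc read_subset" "wfc compare_arrays" "wfc copy_array" "wfc max_step" "wfc max_rot" "wfc ones_prefix" "wfc find_period"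
  "wfc count_all" "wfc rank_start" "wfc rank_len" "wfc rank_out" "wfc rank_cm"
  by (simp_all add: rank_defs rank_cm_def wfc_rot wfc_find wfc_count mods_rot mods_finds Md_def)

lemma wfc_unrank:
  "wfc locate" "wfc ones_suffix" "wfc next_block" "wfc rotate_block" "wfc write_subset" "wfc unrank_cm"
  by (simp_all add: unrank_defs unrank_cm_def wfc_rot wfc_find wfc_count wfc_rank mods_rot mods_finds)

lemma dg_rank: "dgN rank_cm = 1" "dgT rank_cm = 3"
  by (simp_all add: rank_cm_def rank_defs rot_def count_defs)

lemma dg_unrank: "dgN unrank_cm = 2" "dgT unrank_cm = 4"
  by (simp_all add: unrank_cm_def unrank_defs rank_defs find_block_def find_step_def find_letter_def find_try_def rot_def count_defs)

section \<open>Correctness of the parts of the ranking program\<close>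

lemma psums_nth: "i < length d \<Longrightarrow> psums p d ! i = p + sum_list (take (Suc i) d)"
  by (induction d arbitrary: p i) (auto simp: less_Suc_eq_0_disj)

lemma sum_take_Suc: "i < length d \<Longrightarrow> sum_list (take (Suc i) d) = sum_list (take i d) + d ! i"
  by (simp add: take_Suc_conv_app_nth)

lemma read_subset_spec:
  assumes "has_params n t s" "inp s = map int (psums 0 d)" "rdn s = 0" "length d = t"
  shows "holds aS d (sem read_subset s) \<and> holds aY d (sem read_subset s) \<and> holds aZ d (sem read_subset s) \<and>
    va (sem read_subset s) vprev = int (sum_list d) \<and> rdn (sem read_subset s) = t \<and>
    outp (sem read_subset s) = outp s"
proof -
  let ?b = "Rd ve ;; ASt aS (Vr vj) (Mi (Vr ve) (Vr vprev)) ;;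
     ASt aY (Vr vj) (Mi (Vr ve) (Vr vprev)) ;; ASt aZ (Vr vj) (Mi (Vr ve) (Vr vprev)) ;; Asg vprev (Vr ve)"
  define s1 where "s1 = setv vprev 0 s"
  let ?I = "\<lambda>i u. holds aS (take i d) u \<and> holds aY (take i d) u \<and> holds aZ (take i d) u \<and>
    va u vprev = int (sum_list (take i d)) \<and> rdn u = i \<and> outp u = outp s"
  have "?I t (sem (Fr vj cT ?b) s1)"
  proof (rule Fr_invariant[where k = t and I = ?I])
    fix i :: nat and u :: st assume I: "i < t" "va u vj = int i" "?I i u"
      and fr: "\<And>y. y \<noteq> vj \<Longrightarrow> y \<notin> mods ?b \<Longrightarrow> va u y = va s1 y" and inp: "inp u = inp s1"
    have pu: "has_params n t u" using fr[of vN] fr[of cT] assms by (auto simp: has_params_def s1_def)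
    have e: "inp u ! rdn u = int (sum_list (take i d)) + int (d ! i)"
      using I inp assms(2,4) by (simp add: s1_def psums_nth sum_take_Suc del: take_Suc)
    have ix: "ix w (int i) = i" if "va w cT = int t" for w
      using ix_eq[OF that, of "int i"] I(1) by simp
    have vT: "va u cT = int t" using pu by (simp add: has_params_def)
    let ?e = "int (sum_list (take i d)) + int (d ! i)"
    have ixs: "ix ((setv ve ?e u)\<lparr>rdn := Suc i\<rparr>) (int i) = i"
      "ix (seta aS i (int (d ! i)) ((setv ve ?e u)\<lparr>rdn := Suc i\<rparr>)) (int i) = i"
      "ix (seta aY i (int (d ! i)) (seta aS i (int (d ! i)) ((setv ve ?e u)\<lparr>rdn := Suc i\<rparr>))) (int i) = i"
      by (rule ix, simp add: vT)+
    have "sem ?b u = setv vprev ?e (seta aZ i (int (d ! i)) (seta aY i (int (d ! i))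
        (seta aS i (int (d ! i)) ((setv ve ?e u)\<lparr>rdn := Suc i\<rparr>))))"
      using I(2,3) e ixs by simp
    moreover have "take (Suc i) d = take i d @ [d ! i]" using I(1) assms(4) by (simp add: take_Suc_conv_app_nth)
    ultimately show "?I (Suc i) (setv vj (int (Suc i)) (sem ?b u))"
      using I(1,3) assms(4) by (auto simp: holds_def nth_append less_Suc_eq)
  qed (use assms in \<open>simp_all add: has_params_def s1_def holds_def\<close>)
  moreover have "sem read_subset s = sem (Fr vj cT ?b) s1" by (simp add: read_subset_def s1_def)
  ultimately show ?thesis using assms(4) by simp
qed

lemma compare_spec:
  assumes "has_params n t s" "holds aY y s" "holds aZ z s" "length y = t" "length z = t"
  shows "0 < va (sem compare_arrays s) vcmp \<longleftrightarrow> z < y"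
proof -
  let ?b = "Ifp (Ti (Vr vcmp) (Vr vcmp)) Skp (Asg vcmp (Mi (Ar aY (Vr vj)) (Ar aZ (Vr vj))))"
  define s1 where "s1 = setv vcmp 0 s"
  let ?I = "\<lambda>i u. va u vcmp = 0 \<and> take i y = take i z \<or> 0 < va u vcmp \<and> take i z < take i y \<or>
     va u vcmp < 0 \<and> take i y < take i z"
  have "?I t (sem (Fr vj cT ?b) s1)"
  proof (rule Fr_invariant[where k = t and I = ?I])
    fix i :: nat and u :: st assume I: "i < t" "va u vj = int i" "?I i u"
      and fr: "\<And>y. y \<noteq> vj \<Longrightarrow> y \<notin> mods ?b \<Longrightarrow> va u y = va s1 y"
      and fa: "\<And>a. a \<notin> amods ?b \<Longrightarrow> ar u a = ar s1 a"
    have pu: "has_params n t u" using fr[of vN] fr[of cT] assms by (auto simp: has_params_def s1_def)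
    have ix: "ix u (int i) = i" by (rule ix_nat[OF pu refl]) (use I(1) in simp)
    have a: "ar u aY i = int (y ! i)" "ar u aZ i = int (z ! i)"
      using fa[of aY] fa[of aZ] assms I(1) by (simp_all add: s1_def holds_def)
    have sn: "take (Suc i) y = take i y @ [y ! i]" "take (Suc i) z = take i z @ [z ! i]"
      using I(1) assms(4,5) by (simp_all add: take_Suc_conv_app_nth)
    have len: "length (take i y) = length (take i z)" using assms(4,5) by simp
    have e: "va (sem ?b u) vcmp = (if va u vcmp = 0 then int (y ! i) - int (z ! i) else va u vcmp)"
      using I(2) ix a by (auto simp: zero_less_mult_iff not_less)
    consider "va u vcmp = 0" "take i y = take i z" | "0 < va u vcmp" "take i z < take i y"
      | "va u vcmp < 0" "take i y < take i z" using I(3) by blast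
    then have "?I (Suc i) (sem ?b u)"
    proof cases
      case 1
      then show ?thesis unfolding e sn 1(2) append_less_same by auto
    next
      case 2
      then have "take i z @ [z ! i] < take i y @ [y ! i]" using append_less_imp[OF len[symmetric]] by blast
      then show ?thesis unfolding e sn using 2(1) by auto
    next
      case 3
      then have "take i y @ [y ! i] < take i z @ [z ! i]" using append_less_imp[OF len] by blast
      then show ?thesis unfolding e sn using 3(1) by auto
    qed
    then show "?I (Suc i) (setv vj (int (Suc i)) (sem ?b u))" by simp
  qed (use assms in \<open>simp_all add: has_params_def s1_def\<close>)
  moreover have "sem compare_arrays s = sem (Fr vj cT ?b) s1" by (simp add: compare_arrays_def s1_def)
  ultimately show ?thesis using assms(4,5) by auto
qed

lemma copy_spec:
  assumes "has_params n t s" "holds aY y s" "length y = t"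
  shows "holds aZ y (sem copy_array s)"
proof -
  let ?b = "ASt aZ (Vr vj) (Ar aY (Vr vj))"
  let ?I = "\<lambda>i u. holds aZ (take i y) u"
  have "?I t (sem (Fr vj cT ?b) s)"
  proof (rule Fr_invariant[where k = t and I = ?I])
    fix i :: nat and u :: st assume I: "i < t" "va u vj = int i" "?I i u"
      and fr: "\<And>y. y \<noteq> vj \<Longrightarrow> y \<notin> mods ?b \<Longrightarrow> va u y = va s y"
      and fa: "\<And>a. a \<notin> amods ?b \<Longrightarrow> ar u a = ar s a"
    have pu: "has_params n t u" using fr[of vN] fr[of cT] assms by (auto simp: has_params_def)
    have ix: "ix u (int i) = i" by (rule ix_nat[OF pu refl]) (use I(1) in simp)
    have "ar u aY i = int (y ! i)" using fa[of aY] assms I(1) by (simp add: holds_def)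
    then have "sem ?b u = seta aZ i (int (y ! i)) u" using I(2) ix by simp
    moreover have "take (Suc i) y = take i y @ [y ! i]" using I(1) assms(3) by (simp add: take_Suc_conv_app_nth)
    ultimately show "?I (Suc i) (setv vj (int (Suc i)) (sem ?b u))"
      using holds_snoc[OF I(3), of "int (y ! i)" "y ! i"] I(1) assms(3) by (simp add: holds_def)
  qed (use assms in \<open>simp_all add: has_params_def holds_def\<close>)
  then show ?thesis using assms(3) by (simp add: copy_array_def)
qed

lemma max_rot_spec:
  assumes "has_params n t s" "holds aY d s" "holds aZ d s" "length d = t" "1 \<le> t"
  shows "holds aZ (max_rotation d) (sem max_rot s) \<and> va (sem max_rot s) vo1 = int (LEAST k. rotate k d = max_rotation d)"
proof -
  define s1 where "s1 = setv vo1 0 s"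
  \<comment> \<open>The strict inequality for the indices before \<open>k\<close> records that the
    maximum was not met earlier; it yields the \<open>LEAST\<close> in the claim.\<close>
  let ?I = "\<lambda>i u. holds aY (rotate i d) u \<and> (\<exists>k<t. va u vo1 = int k \<and> holds aZ (rotate k d) u \<and>
     (\<forall>j<i. rotate j d \<le> rotate k d) \<and> (\<forall>j<k. rotate j d < rotate k d))"
  have "?I t (sem (Fr vo cT max_step) s1)"
  proof (rule Fr_invariant[where k = t and I = ?I])
    fix i :: nat and u :: st assume I: "i < t" "va u vo = int i" "?I i u"
      and fr: "\<And>y. y \<noteq> vo \<Longrightarrow> y \<notin> mods max_step \<Longrightarrow> va u y = va s1 y"
    have pu: "has_params n t u" using fr[of vN] fr[of cT] assms by (auto simp: has_params_def s1_def mods_rank)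
    have hY: "holds aY (rotate i d) u" using I(3) by blast
    obtain k where k: "k < t" "va u vo1 = int k" "holds aZ (rotate k d) u"
      "\<forall>j<i. rotate j d \<le> rotate k d" "\<forall>j<k. rotate j d < rotate k d" using I(3) by blast
    define u1 where "u1 = sem compare_arrays u"
    have p1: "has_params n t u1" unfolding u1_def by (rule has_params_sem[OF wfc_rank(2) pu])
    have cmp: "0 < va u1 vcmp \<longleftrightarrow> rotate k d < rotate i d"
      unfolding u1_def by (rule compare_spec[OF pu hY k(3)]) (use assms(4) in simp_all)
    have a1: "ar u1 = ar u" unfolding u1_def by (rule ext) (simp add: sem_ar mods_rank)
    have v1: "va u1 vo1 = int k" "va u1 vo = int i" unfolding u1_def using k I by (simp_all add: sem_va mods_rank)
    define u2 where "u2 = (if 0 < va u1 vcmp then sem copy_array (setv vo1 (int i) u1) else u1)"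
    have p2: "has_params n t u2" unfolding u2_def using has_params_sem[OF wfc_rank(3)] has_params_setv[OF p1, of vo1] p1 by simp
    have hY2: "holds aY (rotate i d) u2" unfolding u2_def using hY a1 by (simp add: holds_def sem_ar mods_rank)
    have e: "sem max_step u = sem (rot aY) u2"
      unfolding max_step_def u2_def using v1 by (simp add: u1_def[symmetric])
    have hY3: "holds aY (rotate (Suc i) d) (sem max_step u)"
      unfolding e rotate_Suc by (rule rot_spec[OF p2 hY2]) (use assms in simp_all)
    have "\<exists>k<t. va u2 vo1 = int k \<and> holds aZ (rotate k d) u2 \<and>
      (\<forall>j<Suc i. rotate j d \<le> rotate k d) \<and> (\<forall>j<k. rotate j d < rotate k d)"
    proof (cases "0 < va u1 vcmp")
      case True
      then have lt: "rotate k d < rotate i d" using cmp by simp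
      have "holds aZ (rotate i d) u2"
        unfolding u2_def if_P[OF True]
        by (rule copy_spec[OF has_params_setv[OF p1]]) (use hY a1 assms(4) in \<open>simp_all add: holds_def\<close>)
      moreover have "va u2 vo1 = int i" using True by (simp add: u2_def sem_va mods_rank)
      moreover have "\<forall>j<i. rotate j d < rotate i d" using k(4) lt by (meson le_less_trans)
      ultimately show ?thesis using I(1) by (intro exI[of _ i]) (auto simp: less_Suc_eq less_imp_le)
    next
      case False
      then have "u2 = u1" "rotate i d \<le> rotate k d" using cmp by (auto simp: u2_def)
      then show ?thesis using k v1 a1 by (intro exI[of _ k]) (auto simp: less_Suc_eq holds_def)
    qed
    then have "\<exists>k<t. va (sem max_step u) vo1 = int k \<and> holds aZ (rotate k d) (sem max_step u) \<and>
      (\<forall>j<Suc i. rotate j d \<le> rotate k d) \<and> (\<forall>j<k. rotate j d < rotate k d)"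
      unfolding e by (simp add: sem_va sem_ar mods_rot holds_def)
    then show "?I (Suc i) (setv vo (int (Suc i)) (sem max_step u))"
      using hY3 by (simp add: holds_def del: rotate_Suc)
  qed (use assms in \<open>auto simp: has_params_def s1_def holds_def mods_rank\<close>)
  then obtain k where k: "k < t" "va (sem (Fr vo cT max_step) s1) vo1 = int k"
     "holds aZ (rotate k d) (sem (Fr vo cT max_step) s1)"
     "\<forall>j<t. rotate j d \<le> rotate k d" "\<forall>j<k. rotate j d < rotate k d" by blast
  have d0: "d \<noteq> []" using assms(4,5) by auto
  obtain i where i: "i < t" "max_rotation d = rotate i d" using max_rotation_rotation[OF d0] assms(4) by metis
  have mk: "rotate k d = max_rotation d" using k(4) i rotate_le_max_rotation[OF d0, of k] by (metis antisym)
  have "(LEAST k. rotate k d = max_rotation d) = k"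
  proof (rule Least_equality)
    show "rotate k d = max_rotation d" by (rule mk)
    fix j assume "rotate j d = max_rotation d"
    then show "k \<le> j" using k(5) mk by (metis less_irrefl not_le_imp_less)
  qed
  moreover have "sem max_rot s = sem (Fr vo cT max_step) s1" by (simp add: max_rot_def s1_def)
  ultimately show ?thesis using k(2,3) mk by simp
qed

lemma ones_prefix_spec:
  assumes "has_params n t s" "holds aS d s" "length d = t" "va s vo1 = int k" "k \<le> t" "\<forall>c\<in>set d. 1 \<le> c"
  shows "va (sem ones_prefix s) vones = (if \<forall>j<k. d ! j = 1 then 1 else 0)"
proof -
  let ?b = "Ifp (Mi (Vr vo1) (Vr vj)) (Ifp (Mi (Ar aS (Vr vj)) (Cn 1)) (Asg vones (Cn 0)) Skp) Skp"
  define s1 where "s1 = setv vones 1 s"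
  let ?I = "\<lambda>i u. va u vones = (if \<forall>j<min i k. d ! j = 1 then 1 else 0)"
  have "?I t (sem (Fr vj cT ?b) s1)"
  proof (rule Fr_invariant[where k = t and I = ?I])
    fix i :: nat and u :: st assume I: "i < t" "va u vj = int i" "?I i u"
      and fr: "\<And>y. y \<noteq> vj \<Longrightarrow> y \<notin> mods ?b \<Longrightarrow> va u y = va s1 y"
      and fa: "\<And>a. a \<notin> amods ?b \<Longrightarrow> ar u a = ar s1 a"
    have pu: "has_params n t u" and v: "va u vo1 = int k" "ar u aS i = int (d ! i)"
      using fr[of vN] fr[of cT] fr[of vo1] fa[of aS] assms I(1) by (auto simp: has_params_def s1_def holds_def)
    have ix: "ix u (int i) = i" by (rule ix_nat[OF pu refl]) (use I(1) in simp)
    have di: "1 \<le> d ! i" using assms(3,6) I(1) by simp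
    have "?I (Suc i) (sem ?b u)"
    proof (cases "i < k")
      case True
      then have m: "min (Suc i) k = Suc i" "min i k = i" by auto
      have e: "va (sem ?b u) vones = (if d ! i = 1 then va u vones else 0)"
        using True I(2) ix v di by auto
      show ?thesis unfolding e m using I(3) unfolding m by (auto simp: less_Suc_eq)
    next
      case False
      then have "sem ?b u = u" "min (Suc i) k = min i k" using I(2) v by auto
      then show ?thesis using I(3) by simp
    qed
    then show "?I (Suc i) (setv vj (int (Suc i)) (sem ?b u))" by simp
  qed (use assms in \<open>simp_all add: has_params_def s1_def\<close>)
  moreover have "sem ones_prefix s = sem (Fr vj cT ?b) s1" by (simp add: ones_prefix_def s1_def)
  moreover have "min t k = k" using assms(5) by simp
  ultimately show ?thesis by simp
qed

lemma period_spec: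
  assumes "has_params n t s" "holds aZ w s" "length w = t" "va s vlen = int m" "1 \<le> m" "m \<le> t"
  shows "va (sem find_period s) vper = int (duval_period w m)"
proof -
  define s1 where "s1 = setv vcm 0 (setv vper 1 s)"
  let ?I = "\<lambda>i u. va u vper = int (duval_period w (min i m)) \<and>
    (i < m \<longrightarrow> va u vcm = (if i = 0 then 0 else int (w ! (i - duval_period w i))))"
  have "?I t (sem (Fr vl cT period_step) s1)"
  proof (rule Fr_invariant[where k = t and I = ?I])
    fix i :: nat and u :: st assume I: "i < t" "va u vl = int i" "?I i u"
      and fr: "\<And>y. y \<noteq> vl \<Longrightarrow> y \<notin> mods period_step \<Longrightarrow> va u y = va s1 y"
      and fa: "\<And>a. a \<notin> amods period_step \<Longrightarrow> ar u a = ar s1 a"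
    have pu: "has_params n t u" and v: "va u vlen = int m" "ar u aZ = ar s aZ"
      using fr[of vN] fr[of cT] fr[of vlen] fa[of aZ] assms by (auto simp: has_params_def s1_def mods_rank)
    have "?I (Suc i) (sem period_step u)"
    proof (cases "i < m")
      case True
      have ix: "ix u (int i) = i" by (rule ix_nat[OF pu refl]) (use I(1) in simp)
      have wi: "ar u aZ i = int (w ! i)" using v(2) assms(2,3) I(1) by (simp add: holds_def)
      have per: "va u vper = int (duval_period w i)" using I(3) True by simp
      have cm: "va u vcm = (if i = 0 then 0 else int (w ! (i - duval_period w i)))" using I(3) True by simp
      define u1 where "u1 = setv vper (int (duval_period w (Suc i))) u"
      have id: "setv vper (int (duval_period w i)) u = u" using per by (simp add: setv_def fun_upd_idem)
      have u1: "(if int (w ! i) < va u vcm then setv vper (int i + 1) u else u) = u1"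
        using id unfolding u1_def cm by (cases "i = 0") (auto simp: add.commute)
      have b: "1 \<le> duval_period w (Suc i)" "duval_period w (Suc i) \<le> Suc i" using duval_period_bounds[of w "Suc i"] by auto
      have p1: "has_params n t u1" using pu by (simp add: u1_def has_params_def)
      have ix1: "ix u1 (int i + 1 - int (duval_period w (Suc i))) = Suc i - duval_period w (Suc i)"
        by (rule ix_nat[OF p1]) (use b I(1) in \<open>auto simp: of_nat_diff\<close>)
      have "sem period_step u = sem (Asg vcm (Ar aZ (Mi (Pl (Vr vl) (Cn 1)) (Vr vper))))
          (if int (w ! i) < va u vcm then setv vper (int i + 1) u else u)"
        unfolding period_step_def using I(2) v(1) True ix wi by simp
      also have "\<dots> = setv vcm (ar u1 aZ (ix u1 (int i + 1 - int (duval_period w (Suc i))))) u1"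
        unfolding u1 using I(2) by (simp add: u1_def del: duval_period.simps)
      also have "ar u1 aZ (ix u1 (int i + 1 - int (duval_period w (Suc i)))) = int (w ! (Suc i - duval_period w (Suc i)))"
        unfolding ix1 using v(2) assms(2,3) b I(1) by (simp add: u1_def holds_def)
      finally have "sem period_step u = setv vcm (int (w ! (Suc i - duval_period w (Suc i)))) u1" .
      moreover have "min (Suc i) m = Suc i" using True by simp
      ultimately show ?thesis by (simp add: u1_def del: duval_period.simps)
    next
      case False
      then have "sem period_step u = u" unfolding period_step_def using I(2) v(1) by simp
      moreover have "min (Suc i) m = min i m" using False by simp
      ultimately show ?thesis using I(3) False by simp
    qed
    then show "?I (Suc i) (setv vl (int (Suc i)) (sem period_step u))" by (simp del: duval_period.simps)
  qed (use assms in \<open>simp_all add: has_params_def s1_def mods_rank\<close>)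
  moreover have "sem find_period s = sem (Fr vl cT period_step) s1" by (simp add: find_period_def s1_def)
  moreover have "min t m = m" using assms(6) by simp
  ultimately show ?thesis by simp
qed

context params_ok
begin

lemma total_spec:
  assumes "has_params n t s" shows "va (sem count_all s) vtot = int (length C)"
proof -
  let ?s1 = "setv vM 1 (seta aZ 0 (int n) s)"
  have ix0: "ix s 0 = 0" using ix_nat[OF assms, of 0 0] by simp
  have "va (sem count ?s1) vR = int (length C)"
    by (rule count_total) (use assms in \<open>simp_all add: has_params_def\<close>)
  then show ?thesis using ix0 assms by (simp add: count_all_def has_params_def)
qed

theorem rank_cm_correct:
  assumes "s \<in> Subset n t"
  defines "r \<equiv> sem rank_cm (init n t (encode_set s))"
  shows "rdn r \<le> length (encode_set s)" "outp r = [rank_pos n t (diff_rep s) + 1]"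
proof -
  define d where "d = diff_rep s"
  have d: "d \<in> diff_words n t" unfolding d_def by (rule diff_rep_in_diff_words[OF assms(1)])
  have ld: "length d = t" and d0: "d \<noteq> []" using diff_words_length[OF d] diff_words_nonempty[OF d] by auto
  have d1: "\<forall>c\<in>set d. 1 \<le> c" using diff_words_ge[OF d] by blast
  have enc: "encode_set s = map int (psums 0 d)" unfolding encode_set_def d_def psums_diff_rep[OF assms(1)] ..
  define s0 where "s0 = init n t (encode_set s)"
  have p0: "has_params n t s0" by (simp add: s0_def init_def has_params_def)
  define s1 where "s1 = sem read_subset s0"
  have r1: "holds aS d s1" "holds aY d s1" "holds aZ d s1" "va s1 vprev = int (sum_list d)" "rdn s1 = t" "outp s1 = []"
    using read_subset_spec[OF p0 _ _ ld] enc by (auto simp: s1_def s0_def init_def)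
  have p1: "has_params n t s1" unfolding s1_def by (rule has_params_sem[OF wfc_rank(1) p0])
  define s2 where "s2 = sem max_rot s1"
  have p2: "has_params n t s2" unfolding s2_def by (rule has_params_sem[OF wfc_rank(5) p1])
  have r2: "holds aZ (max_rotation d) s2" "va s2 vo1 = int (LEAST k. rotate k d = max_rotation d)"
    using max_rot_spec[OF p1 r1(2,3) ld t1] by (auto simp: s2_def)
  have v2: "holds aS d s2" "va s2 vprev = int (sum_list d)" "rdn s2 = t" "outp s2 = []"
    unfolding s2_def using r1 sem_pure[of max_rot s1] by (simp_all add: holds_def sem_ar sem_va mods_rank)
  define k where "k = (if sum_list d = t then t - 1 else LEAST k. rotate k d = max_rotation d)"
  have kt: "k < t"
  proof -
    obtain i where "i < t" "rotate i d = max_rotation d" using max_rotation_rotation[OF d0] ld by metis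
    then have "(LEAST k. rotate k d = max_rotation d) < t" using Least_le[of "\<lambda>k. rotate k d = max_rotation d" i] by simp
    then show ?thesis using t1 by (simp add: k_def)
  qed
  have "t \<le> sum_list d"
  proof -
    have "length e \<le> sum_list e" if "\<forall>c\<in>set e. 1 \<le> c" for e :: "nat list" using that by (induction e) auto
    then show ?thesis using d1 ld by blast
  qed
  define s3 where "s3 = sem rank_start s2"
  have v3: "va s3 vo1 = int k" "holds aS d s3" "holds aZ (max_rotation d) s3" "rdn s3 = t" "outp s3 = []"
    unfolding s3_def rank_start_def k_def using r2 v2 p2 \<open>t \<le> sum_list d\<close> t1
    by (auto simp: has_params_def holds_def of_nat_diff)
  have p3: "has_params n t s3" unfolding s3_def by (rule has_params_sem[OF wfc_rank(9) p2])
  define s4 where "s4 = sem ones_prefix s3"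
  define b where "b = (\<forall>j<k. d ! j = 1)"
  have p4: "has_params n t s4" unfolding s4_def by (rule has_params_sem[OF wfc_rank(6) p3])
  have v4: "va s4 vones = (if b then 1 else 0)" "va s4 vo1 = int k" "holds aZ (max_rotation d) s4" "rdn s4 = t" "outp s4 = []"
    unfolding s4_def b_def using ones_prefix_spec[OF p3 v3(2) ld v3(1) less_imp_le[OF kt] d1] v3 sem_pure[of ones_prefix s3]
    by (simp_all add: holds_def sem_ar sem_va mods_rank)
  define m where "m = (if b then t - k else t)"
  define s5 where "s5 = sem rank_len s4"
  have p5: "has_params n t s5" unfolding s5_def by (rule has_params_sem[OF wfc_rank(10) p4])
  have v5: "va s5 vlen = int m" "va s5 vones = (if b then 1 else 0)" "va s5 vo1 = int k" "holds aZ (max_rotation d) s5" "rdn s5 = t" "outp s5 = []"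
    unfolding s5_def rank_len_def m_def using v4 p4 kt by (auto simp: has_params_def holds_def of_nat_diff)
  have m: "1 \<le> m" "m \<le> t" using kt t1 by (auto simp: m_def)
  have lm: "length (max_rotation d) = t" by (rule length_max_rotation[OF d])
  define s6 where "s6 = sem find_period s5"
  define q where "q = duval_period (max_rotation d) m"
  have p6: "has_params n t s6" unfolding s6_def by (rule has_params_sem[OF wfc_rank(7) p5])
  have v6: "va s6 vper = int q" "va s6 vones = (if b then 1 else 0)" "va s6 vo1 = int k" "holds aZ (max_rotation d) s6" "rdn s6 = t" "outp s6 = []"
    unfolding s6_def q_def using period_spec[OF p5 v5(4) lm v5(1) m] v5 sem_pure[of find_period s5]
    by (simp_all add: holds_def sem_ar sem_va mods_rank)
  define s7 where "s7 = sem count (setv vM (int q) s6)"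
  have q: "1 \<le> q" "q \<le> m" "lyndon (take q (max_rotation d))"
    using duval[OF neck_max_rotation[OF d0] m(1)] m(2) lm unfolding q_def by auto
  have R7: "va s7 vR = int (count_below n t (take q (max_rotation d)))" unfolding s7_def
  proof (rule count_spec)
    show "has_params n t (setv vM (int q) s6)" using p6 by (simp add: has_params_def)
    show "holds aZ (take q (max_rotation d)) (setv vM (int q) s6)" using holds_take[OF v6(4)] by (simp add: holds_def)
    show "set (take q (max_rotation d)) \<subseteq> {1..n}"
      using max_rotation_in_diff_words[OF d d0] set_take_subset[of q "max_rotation d"] by (auto simp: diff_words_def strings_def)
  qed (use q m lm in simp_all)
  define s8 where "s8 = setv vr (int (count_below n t (take q (max_rotation d)))) s7"
  have p8: "has_params n t s8" unfolding s8_def s7_def using has_params_sem[OF wfc_count(6) has_params_setv[OF p6, of vM]] by (simp add: has_params_def)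
  have v8: "va s8 vr = int (count_below n t (take q (max_rotation d)))" "va s8 vper = int q" "va s8 vones = (if b then 1 else 0)" "va s8 vo1 = int k" "rdn s8 = t" "outp s8 = []"
    unfolding s8_def s7_def using v6 sem_pure[of count "setv vM (int q) s6"] by (simp_all add: sem_va mods_counts)
  define s9 where "s9 = sem count_all s8"
  have v9: "va s9 vtot = int (length C)" "va s9 vr = int (count_below n t (take q (max_rotation d)))" "va s9 vper = int q" "va s9 vones = (if b then 1 else 0)" "va s9 vo1 = int k" "rdn s9 = t" "outp s9 = []"
    unfolding s9_def using total_spec[OF p8] v8 sem_pure[of count_all s8] by (simp_all add: sem_va mods_rank)
  let ?pre = "Ifp (Vr vones) (Asg vr (Mi (Mi (Vr vtot) (Vr vr)) (Vr vo1)))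
       (Asg vr (Pl (Mi (Mi (Vr vtot) (Vr vr)) (Vr vo1)) (Vr vper))) ;; Wr (Pl (Md (Vr vr) (Vr vtot)) (Cn 1))"
  have "r = sem rank_out s6"
    unfolding r_def rank_cm_def by (simp add: s0_def s1_def s2_def s3_def s4_def s5_def s6_def)
  also have "\<dots> = sem ?pre s9"
    unfolding rank_out_def using v6(1) R7 by (simp add: s9_def s8_def s7_def)
  finally have r: "r = sem ?pre s9" .
  have pos: "rank_pos n t d = (int (length C) - int (count_below n t (take q (max_rotation d))) - int k + (if b then 0 else int q)) mod int (length C)"
    unfolding rank_pos_def Let_def length_C k_def[symmetric] b_def[symmetric] m_def[symmetric] q_def[symmetric] ..
  have "rdn r = t" unfolding r using v9 by simp
  then show "rdn r \<le> length (encode_set s)" unfolding enc using ld by simp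
  show "outp r = [rank_pos n t (diff_rep s) + 1]"
    unfolding d_def[symmetric] pos unfolding r using v9 by simp
qed

end

section \<open>The unranking program\<close>

lemma ones_suffix_spec:
  assumes "has_params n t s" "holds aZ a s" "length a = t" "va s voff = int k" "va s vper = int q" "\<forall>c\<in>set a. 1 \<le> c"
  shows "va (sem ones_suffix s) vones = (if \<exists>j<t. k \<le> j \<and> j < q \<and> a ! j \<noteq> 1 then 0 else 1)"
proof -
  let ?b = "Ifp (Mi (Pl (Vr vj) (Cn 1)) (Vr voff))
     (Ifp (Mi (Vr vper) (Vr vj)) (Ifp (Mi (Ar aZ (Vr vj)) (Cn 1)) (Asg vones (Cn 0)) Skp) Skp) Skp"
  define s1 where "s1 = setv vones 1 s"
  let ?I = "\<lambda>i u. va u vones = (if \<exists>j<i. k \<le> j \<and> j < q \<and> a ! j \<noteq> 1 then 0 else 1)"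
  have "?I t (sem (Fr vj cT ?b) s1)"
  proof (rule Fr_invariant[where k = t and I = ?I])
    fix i :: nat and u :: st assume I: "i < t" "va u vj = int i" "?I i u"
      and fr: "\<And>y. y \<noteq> vj \<Longrightarrow> y \<notin> mods ?b \<Longrightarrow> va u y = va s1 y"
      and fa: "\<And>a. a \<notin> amods ?b \<Longrightarrow> ar u a = ar s1 a"
    have pu: "has_params n t u" and v: "va u voff = int k" "va u vper = int q" "ar u aZ i = int (a ! i)"
      using fr[of vN] fr[of cT] fr[of voff] fr[of vper] fa[of aZ] assms I(1) by (auto simp: has_params_def s1_def holds_def)
    have ix: "ix u (int i) = i" by (rule ix_nat[OF pu refl]) (use I(1) in simp)
    have ai: "1 \<le> a ! i" using assms(3,6) I(1) by simp
    have e: "va (sem ?b u) vones = (if k \<le> i \<and> i < q \<and> a ! i \<noteq> 1 then 0 else va u vones)"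
      using I(2) ix v ai by auto
    have "?I (Suc i) (sem ?b u)" unfolding e I(3) by (auto simp: less_Suc_eq)
    then show "?I (Suc i) (setv vj (int (Suc i)) (sem ?b u))" by simp
  qed (use assms in \<open>simp_all add: has_params_def s1_def\<close>)
  moreover have "sem ones_suffix s = sem (Fr vj cT ?b) s1" by (simp add: ones_suffix_def s1_def)
  ultimately show ?thesis by simp
qed

lemma rotate_block_spec:
  assumes "has_params n t s" "holds aZ a s" "length a = t" "1 \<le> t" "va s voff = int k" "k \<le> t"
  shows "holds aZ (rotate k a) (sem rotate_block s) \<and> va (sem rotate_block s) vb = 0"
proof -
  let ?b = "Ifp (Mi (Vr voff) (Vr vw)) (rot aZ) Skp"
  define s1 where "s1 = setv vb 0 s"
  let ?I = "\<lambda>i u. holds aZ (rotate (min i k) a) u"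
  have "?I t (sem (Fr vw cT ?b) s1)"
  proof (rule Fr_invariant[where k = t and I = ?I])
    fix i :: nat and u :: st assume I: "i < t" "va u vw = int i" "?I i u"
      and fr: "\<And>y. y \<noteq> vw \<Longrightarrow> y \<notin> mods ?b \<Longrightarrow> va u y = va s1 y"
    have pu: "has_params n t u" and v: "va u voff = int k"
      using fr[of vN] fr[of cT] fr[of voff] assms by (auto simp: has_params_def s1_def mods_rot)
    have "?I (Suc i) (sem ?b u)"
    proof (cases "i < k")
      case True
      then have m: "min (Suc i) k = Suc i" "min i k = i" by auto
      have "holds aZ (rotate1 (rotate i a)) (sem (rot aZ) u)"
        by (rule rot_spec[OF pu]) (use I(3) m assms in simp_all)
      then show ?thesis unfolding m rotate_Suc using True I(2) v by simp
    next
      case False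
      then have "sem ?b u = u" "min (Suc i) k = min i k" using I(2) v by auto
      then show ?thesis using I(3) by simp
    qed
    then show "?I (Suc i) (setv vw (int (Suc i)) (sem ?b u))" by (simp add: holds_def)
  qed (use assms in \<open>simp_all add: has_params_def s1_def holds_def mods_rot\<close>)
  moreover have "sem rotate_block s = sem (Fr vw cT ?b) s1" by (simp add: rotate_block_def s1_def)
  moreover have "min t k = k" using assms(6) by simp
  ultimately show ?thesis by (simp add: sem_va mods_rot s1_def)
qed

lemma write_subset_spec:
  assumes "has_params n t s" "holds aZ w s" "length w = t" "va s vb = int b" "b \<le> t"
  shows "outp (sem write_subset s) = outp s @ map int (psums 0 (replicate b 1 @ take (t - b) w)) \<and>
    rdn (sem write_subset s) = rdn s"
proof -
  define f where "f = replicate b 1 @ take (t - b) w"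
  have lf: "length f = t" using assms(3,5) by (simp add: f_def)
  define s1 where "s1 = setv vsum 0 s"
  let ?I = "\<lambda>i u. outp u = outp s @ map int (take i (psums 0 f)) \<and> va u vsum = int (sum_list (take i f)) \<and> rdn u = rdn s"
  have "?I t (sem (Fr vw cT write_step) s1)"
  proof (rule Fr_invariant[where k = t and I = ?I])
    fix i :: nat and u :: st assume I: "i < t" "va u vw = int i" "?I i u"
      and fr: "\<And>y. y \<noteq> vw \<Longrightarrow> y \<notin> mods write_step \<Longrightarrow> va u y = va s1 y"
      and fa: "\<And>a. a \<notin> amods write_step \<Longrightarrow> ar u a = ar s1 a"
    have pu: "has_params n t u" and v: "va u vb = int b" "ar u aZ = ar s aZ"
      using fr[of vN] fr[of cT] fr[of vb] fa[of aZ] assms by (auto simp: has_params_def s1_def mods_unrank)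
    have fi: "f ! i = (if i < b then 1 else w ! (i - b))" using I(1) assms(3,5) by (auto simp: f_def nth_append)
    have ix: "\<not> i < b \<Longrightarrow> ix u (int i - int b) = i - b"
      by (rule ix_nat[OF pu]) (use I(1) in \<open>auto simp: of_nat_diff\<close>)
    have wi: "ar u aZ (i - b) = int (w ! (i - b))" using v(2) assms(2,3) I(1) by (simp add: holds_def)
    let ?v = "int (sum_list (take (Suc i) f))"
    have sv: "?v = int (sum_list (take i f)) + int (f ! i)" using sum_take_Suc[of i f] I(1) lf by simp
    have "sem write_step u = (setv vsum ?v u)\<lparr>outp := outp u @ [?v]\<rparr>"
      unfolding sv fi write_step_def using I(2,3) v(1) ix wi by (simp add: setv_def)
    moreover have "take (Suc i) (psums 0 f) = take i (psums 0 f) @ [sum_list (take (Suc i) f)]"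
      using I(1) lf psums_nth[of i f 0] by (simp add: take_Suc_conv_app_nth)
    ultimately show "?I (Suc i) (setv vw (int (Suc i)) (sem write_step u))"
      using I(3) by (simp add: setv_def)
  qed (use assms in \<open>simp_all add: has_params_def s1_def mods_unrank\<close>)
  moreover have "sem write_subset s = sem (Fr vw cT write_step) s1" by (simp add: write_subset_def s1_def)
  ultimately show ?thesis using lf unfolding f_def[symmetric] by simp
qed

context params_ok
begin

lemma locate_spec:
  assumes "has_params n t s" "is_block n t K a" "va s vK = int K" "va s vtot = int (length C)"
  shows "holds aZ a (sem locate s)" "va (sem locate s) vper = int (duval_period a t)"
    "va (sem locate s) vst = int (length C) - int (count_below n t (take (duval_period a t) a))"
    "va (sem locate s) voff = va s vidx - 1 - va (sem locate s) vst"
proof -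
  have a: "a \<in> diff_words n t" "neck a" using assms(2) by (auto simp: is_block_def)
  have la: "length a = t" by (rule diff_words_length[OF a(1)])
  define q where "q = duval_period a t"
  define s1 where "s1 = sem find_block s"
  have f: "holds aZ a s1" "va s1 vper = int q" using find_spec[OF assms(1-3)] by (auto simp: s1_def q_def)
  have p1: "has_params n t s1" unfolding s1_def by (rule has_params_sem[OF wfc_find(4) assms(1)])
  have q: "1 \<le> q" "q \<le> t" "lyndon (take q a)" using duval[OF a(2) t1] la unfolding q_def by auto
  define s2 where "s2 = sem count (setv vM (int q) s1)"
  have R: "va s2 vR = int (count_below n t (take q a))" unfolding s2_def
  proof (rule count_spec)
    show "has_params n t (setv vM (int q) s1)" using p1 by (simp add: has_params_def)
    show "holds aZ (take q a) (setv vM (int q) s1)" using holds_take[OF f(1)] by (simp add: holds_def)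
    show "set (take q a) \<subseteq> {1..n}" using a(1) set_take_subset[of q a] by (auto simp: diff_words_def strings_def)
  qed (use q la in simp_all)
  have v2: "va s2 vtot = int (length C)" "va s2 vidx = va s vidx" "va s2 vper = int q" "holds aZ a s2"
    unfolding s2_def s1_def using assms(4) f by (simp_all add: sem_va sem_ar mods_finds holds_def s1_def)
  have e: "sem locate s = setv voff (va s2 vidx - 1 - (va s2 vtot - va s2 vR)) (setv vst (va s2 vtot - va s2 vR) s2)"
    unfolding locate_def using f(2) by (simp add: s1_def[symmetric] s2_def)
  show "holds aZ a (sem locate s)" "va (sem locate s) vper = int (duval_period a t)"
    "va (sem locate s) vst = int (length C) - int (count_below n t (take (duval_period a t) a))"
    "va (sem locate s) voff = va s vidx - 1 - va (sem locate s) vst"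
    unfolding e using v2 R by (simp_all add: holds_def q_def[symmetric])
qed

theorem unrank_cm_correct:
  assumes "i \<in> {1..length C}"
  defines "r \<equiv> sem unrank_cm (init n t [int i])"
  shows "rdn r \<le> length [int i]" "outp r = map int (psums 0 (cyclic_substring C (i - 1) t))"
proof -
  define p where "p = i - 1"
  have p: "p < length C" "i = Suc p" using assms(1) by (auto simp: p_def)
  have "1 \<le> length C - p" using p(1) by linarith
  then obtain a where a: "is_block n t (length C - p) a" using is_block_exists[of "length C - p"] by auto
  have ad: "a \<in> diff_words n t" "neck a" using a by (auto simp: is_block_def)
  have la: "length a = t" and a1: "\<forall>c\<in>set a. 1 \<le> c" using diff_words_length[OF ad(1)] diff_words_ge[OF ad(1)] by auto
  define q where "q = duval_period a t"
  define st where "st = length C - count_below n t (take q a)"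
  define e where "e = (if length C < st + q + 2 then length C else st + q)"
  note U = unrank_correct[OF p(1) a, folded q_def, folded st_def, folded e_def]
  have qt: "q \<le> t" using duval[OF ad(2) t1] la unfolding q_def by auto
  define s0 where "s0 = sem (Rd vidx) (init n t [int i])"
  have p0: "has_params n t s0" "va s0 vidx = int i" "rdn s0 = 1" "outp s0 = []" by (simp_all add: s0_def init_def has_params_def)
  define s1 where "s1 = sem count_all s0"
  have v1: "va s1 vtot = int (length C)" "va s1 vidx = int i" "rdn s1 = 1" "outp s1 = []" "has_params n t s1"
    unfolding s1_def using total_spec[OF p0(1)] p0 sem_pure[of count_all s0] has_params_sem[OF wfc_rank(8) p0(1)]
    by (simp_all add: sem_va mods_rank)
  define s2 where "s2 = setv vK (int (length C - p)) s1"
  have Ke: "int (length C) - int i + 1 = int (length C - p)" using p by (simp add: of_nat_diff)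
  have v2: "va s2 vtot = int (length C)" "va s2 vidx = int i" "rdn s2 = 1" "outp s2 = []" "has_params n t s2" "va s2 vK = int (length C - p)"
    unfolding s2_def using v1 by (simp_all add: has_params_def)
  define s3 where "s3 = sem locate s2"
  note l3 = locate_spec[OF v2(5) a v2(6,1), folded s3_def q_def]
  have st3: "va s3 vst = int st" unfolding l3(3) st_def using U(1) by (simp add: of_nat_diff)
  have off3: "va s3 voff = int (p - st)" unfolding l3(4) st3 v2(2) using p(2) U(2) by (simp add: of_nat_diff)
  have v3: "has_params n t s3" "rdn s3 = 1" "outp s3 = []" "va s3 vtot = int (length C)" "va s3 vidx = int i"
    unfolding s3_def using v2 sem_pure[of locate s2] has_params_sem[OF wfc_unrank(1) v2(5)] by (simp_all add: sem_va mods_unrank)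
  define s4 where "s4 = sem ones_suffix s3"
  define bad where "bad = (\<exists>j. p - st \<le> j \<and> j < q \<and> a ! j \<noteq> 1)"
  have bad: "(\<exists>j<t. p - st \<le> j \<and> j < q \<and> a ! j \<noteq> 1) = bad" unfolding bad_def using qt by (meson less_le_trans)
  have v4: "va s4 vones = (if bad then 0 else 1)" "has_params n t s4" "rdn s4 = 1" "outp s4 = []" "va s4 vtot = int (length C)"
    "va s4 vidx = int i" "va s4 vst = int st" "va s4 vper = int q" "va s4 voff = int (p - st)" "holds aZ a s4"
    unfolding s4_def using ones_suffix_spec[OF v3(1) l3(1) la off3 l3(2) a1, unfolded bad] v3 l3(1,2) st3 off3 sem_pure[of ones_suffix s3]
      has_params_sem[OF wfc_unrank(2) v3(1)] by (simp_all add: sem_va sem_ar holds_def mods_unrank)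
  define s5 where "s5 = sem (Ifp (Vr vones) next_block rotate_block) s4"
  have "\<exists>w b. holds aZ w s5 \<and> length w = t \<and> va s5 vb = int b \<and> b \<le> t \<and>
      cyclic_substring C p t = replicate b 1 @ take (t - b) w \<and> has_params n t s5 \<and> rdn s5 = 1 \<and> outp s5 = []"
  proof (cases bad)
    case True
    have s5: "s5 = sem rotate_block s4" unfolding s5_def using True v4(1) by simp
    have "p - st \<le> t" using U(2,3) qt by linarith
    then have h: "holds aZ (rotate (p - st) a) s5 \<and> va s5 vb = 0"
      unfolding s5 by (rule rotate_block_spec[OF v4(2,10) la t1 v4(9)])
    have "cyclic_substring C p t = rotate (p - st) a" using U(5) True unfolding bad_def by simp
    moreover have "has_params n t s5" "rdn s5 = 1" "outp s5 = []"
      unfolding s5 using has_params_sem[OF wfc_unrank(4) v4(2)] sem_pure[of rotate_block s4] v4 by (simp_all add: mods_unrank)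
    ultimately show ?thesis using h la by (intro exI[of _ "rotate (p - st) a"] exI[of _ 0]) simp
  next
    case False
    have s5: "s5 = sem next_block s4" unfolding s5_def using False v4(1) by simp
    define K where "K = (if e < length C then length C - e else length C)"
    have C0: "1 \<le> length C" using p(1) by simp
    have eC: "e \<le> length C" "p < e" using U(3,4) p(1) by (auto simp: e_def)
    have K: "1 \<le> K" "K \<le> length C" using C0 by (auto simp: K_def)
    obtain a' where a': "is_block n t K a'" using is_block_exists[OF K] by blast
    have la': "length a' = t" using a' diff_words_length unfolding is_block_def by blast
    have c: "e - p \<le> t" "cyclic_substring C p t = replicate (e - p) 1 @ take (t - (e - p)) a'"
      using U(6)[of a'] False a' unfolding bad_def K_def by auto
    define u1 where "u1 = setv vend (int e) s4"
    define u2 where "u2 = setv vb (int (e - p)) u1"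
    define u3 where "u3 = setv vK (int K) u2"
    have e1: "(if int (length C) < int st + int q + 2 then setv vend (int (length C)) (setv vend (int st + int q) s4)
        else setv vend (int st + int q) s4) = u1"
      by (auto simp: u1_def e_def setv_def)
    have e2: "int e - int i + 1 = int (e - p)" using eC p(2) by (simp add: of_nat_diff)
    have e3: "(if int e < int (length C) then setv vK (int (length C) - int e) u2 else setv vK (int (length C)) u2) = u3"
      using eC by (auto simp: u3_def K_def of_nat_diff)
    have tv: "va u1 vend = int e" "va u1 vidx = int i" "va u2 vtot = int (length C)" "va u2 vend = int e"
      using v4 by (simp_all add: u1_def u2_def)
    have "sem next_block s4 = sem (Asg vb (Pl (Mi (Vr vend) (Vr vidx)) (Cn 1)) ;;
        Ifp (Mi (Vr vtot) (Vr vend)) (Asg vK (Mi (Vr vtot) (Vr vend))) (Asg vK (Vr vtot)) ;; find_block)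
        (if int (length C) < int st + int q + 2 then setv vend (int (length C)) (setv vend (int st + int q) s4)
        else setv vend (int st + int q) s4)"
      unfolding next_block_def using v4 by simp
    also have "\<dots> = sem (Ifp (Mi (Vr vtot) (Vr vend)) (Asg vK (Mi (Vr vtot) (Vr vend))) (Asg vK (Vr vtot)) ;; find_block) u2"
      unfolding e1 using tv e2 by (simp add: u2_def)
    also have "\<dots> = sem find_block (if int e < int (length C) then setv vK (int (length C) - int e) u2 else setv vK (int (length C)) u2)"
      using tv by simp
    also have "\<dots> = sem find_block u3" unfolding e3 ..
    finally have s5: "s5 = sem find_block u3" unfolding s5 .
    have pu: "has_params n t u3" using v4(2) by (simp add: u3_def u2_def u1_def has_params_def)
    have "holds aZ a' s5" unfolding s5 using find_spec[OF pu a'] by (simp add: u3_def)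
    moreover have "va s5 vb = int (e - p)" unfolding s5 by (simp add: sem_va mods_finds u3_def u2_def)
    moreover have "has_params n t s5" unfolding s5 by (rule has_params_sem[OF wfc_find(4) pu])
    moreover have "rdn s5 = 1" "outp s5 = []" unfolding s5 using sem_pure[of find_block u3] v4
      by (simp_all add: mods_finds u3_def u2_def u1_def)
    ultimately show ?thesis using c la' by blast
  qed
  then obtain w b where w: "holds aZ w s5" "length w = t" "va s5 vb = int b" "b \<le> t"
    "cyclic_substring C p t = replicate b 1 @ take (t - b) w" "has_params n t s5" "rdn s5 = 1" "outp s5 = []" by blast
  have "sem unrank_cm (init n t [int i]) = sem write_subset s5"
  proof -
    have "setv vK (va s1 vtot - va s1 vidx + 1) s1 = s2" unfolding v1 Ke s2_def ..
    then have k: "sem (Asg vK (Pl (Mi (Vr vtot) (Vr vidx)) (Cn 1))) s1 = s2" by simp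
    show ?thesis unfolding unrank_cm_def sem.simps(4) s0_def[symmetric] s1_def[symmetric] k s3_def[symmetric]
      s4_def[symmetric] s5_def[symmetric] ..
  qed
  then have r: "r = sem write_subset s5" unfolding r_def .
  have o: "outp r = map int (psums 0 (cyclic_substring C p t))" "rdn r = 1"
    unfolding r w(5) using write_subset_spec[OF w(6,1-4)] w(7,8) by simp_all
  show "rdn r \<le> length [int i]" using o by simp
  show "outp r = map int (psums 0 (cyclic_substring C (i - 1) t))" using o unfolding p_def by simp
qed

end

theorem theorem3:
  shows "(\<forall>n t. 1 \<le> t \<and> t \<le> n \<longrightarrow> universal_cycle n t (G_down (n - t + 1) t n)) \<and>
     ram_solvable (ranking_problem (\<lambda>n t. G_down (n - t + 1) t n))
       (\<lambda>(n, t). real n ^ 2 * real t ^ 3)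
       (\<lambda>(n, t). real n * real t ^ 3) \<and>
     ram_solvable (unranking_problem (\<lambda>n t. G_down (n - t + 1) t n))
       (\<lambda>(n, t). real n ^ 2 * real t ^ 4 * ln (real n))
       (\<lambda>(n, t). real n * real t ^ 3)"
proof (intro conjI allI impI)
  fix n t :: nat assume "1 \<le> t \<and> t \<le> n"
  then interpret params_ok n t by unfold_locales auto
  show "universal_cycle n t (G_down (n - t + 1) t n)" by (rule universal_cycle_G_down)
next
  have space: "real t \<le> real n * real t ^ 3" if nt: "1 \<le> t" "t \<le> n" for n t :: nat
  proof -
    have "1 * real t ^ 1 \<le> real n * real t ^ 3" using nt by (intro mult_mono power_increasing) auto
    then show ?thesis by simp
  qed
  show "ram_solvable (ranking_problem (\<lambda>n t. G_down (n - t + 1) t n))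
       (\<lambda>(n, t). real n ^ 2 * real t ^ 3) (\<lambda>(n, t). real n * real t ^ 3)"
  proof (rule ram_solvable_prog[OF wfc_rank(12)])
    fix n t x y assume nt: "1 \<le> t" "t \<le> n" and "(x, y) \<in> ranking_problem (\<lambda>n t. G_down (n - t + 1) t n) n t"
    then obtain s where s: "s \<in> Subset n t" "x = int n # int t # encode_set s"
      "y = [int (rank t (G_down (n - t + 1) t n) s)]" by (auto simp: ranking_problem_def)
    interpret params_ok n t using nt by unfold_locales
    show "\<exists>xs. x = int n # int t # xs \<and> rdn (sem rank_cm (init n t xs)) \<le> length xs \<and> outp (sem rank_cm (init n t xs)) = y"
      using rank_cm_correct[OF s(1)] rank_G_down[OF s(1)] s(2,3) by (intro exI[of _ "encode_set s"]) simp
  next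
    fix n t :: nat assume nt: "3 \<le> n" "1 \<le> t" "t \<le> n"
    have "real n ^ 1 \<le> real n ^ 2" using nt by (intro power_increasing) auto
    then show "real n ^ dgN rank_cm * real t ^ dgT rank_cm \<le> (case (n, t) of (n, t) \<Rightarrow> real n ^ 2 * real t ^ 3)"
      unfolding dg_rank by (simp add: mult_right_mono)
  qed (use space in simp)
  show "ram_solvable (unranking_problem (\<lambda>n t. G_down (n - t + 1) t n))
       (\<lambda>(n, t). real n ^ 2 * real t ^ 4 * ln (real n)) (\<lambda>(n, t). real n * real t ^ 3)"
  proof (rule ram_solvable_prog[OF wfc_unrank(6)])
    fix n t x y assume nt: "1 \<le> t" "t \<le> n" and "(x, y) \<in> unranking_problem (\<lambda>n t. G_down (n - t + 1) t n) n t"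
    then obtain i where i: "i \<in> {1..length (G_down (n - t + 1) t n)}" "x = int n # int t # [int i]"
      "y = encode_set (unrank n t (G_down (n - t + 1) t n) i)" by (auto simp: unranking_problem_def)
    interpret params_ok n t using nt by unfold_locales
    have "i \<in> {1..length C}" using i(1) unfolding G_down_necklace_cycle .
    from unrank_cm_correct[OF this] unrank_G_down[OF i(1)] i(2,3)
    show "\<exists>xs. x = int n # int t # xs \<and> rdn (sem unrank_cm (init n t xs)) \<le> length xs \<and> outp (sem unrank_cm (init n t xs)) = y"
      by (intro exI[of _ "[int i]"]) simp
  next
    fix n t :: nat assume nt: "3 \<le> n" "1 \<le> t" "t \<le> n"
    \<comment> \<open>The threshold 3 is an integer above \<open>exp 1\<close>, so the logarithm is
      at least 1.\<close>
    have "3 \<le> real n" using nt(1) by simp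
    then have "exp 1 \<le> real n" using exp_le by linarith
    then have "1 \<le> ln (real n)" using nt(1) by (simp add: ln_ge_iff)
    then have "real n ^ 2 * real t ^ 4 * 1 \<le> real n ^ 2 * real t ^ 4 * ln (real n)" by (intro mult_left_mono) auto
    then show "real n ^ dgN unrank_cm * real t ^ dgT unrank_cm \<le> (case (n, t) of (n, t) \<Rightarrow> real n ^ 2 * real t ^ 4 * ln (real n))"
      unfolding dg_unrank by simp
  qed (use space in simp)
qed

end
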